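(* Let $d\in\mathbb{N}$ and let $m$ be a real-valued Radon measure on $\mathbb{R}^d$ such that for every $\eta>0$ there exists $\beta_\eta<\infty$ with $$\int|f|^2\,d|m|\le\eta\left(\int|\nabla f|^2\,dx+\beta_\eta\int|f|^2\,dx\right),\qquad f\in C_0^\infty(\mathbb{R}^d).$$ Then for every sufficiently large $\alpha>0$ there exist a finite constant $c$ and $\varepsilon_0>0$ such that for all $0<\varepsilon<\varepsilon_0$ $$\left\|(-\Delta+\varepsilon^2\Delta^2+m+\alpha)^{-1}-(-\Delta+m+\alpha)^{-1}\right\|\le c\,\bigl(\varepsilon^2+\eta(m,\varepsilon)\bigr)$$ (operator norm in $L^2(\mathbb{R}^d,dx)$), whenever $\eta(m,\varepsilon)>0$ is chosen such that $$\int|f|^2\,d|m|\le\eta(m,\varepsilon)\left(\int|\nabla f|^2\,dx+\beta(\varepsilon)\int|f|^2\,dx\right),\qquad f\in C_0^\infty(\mathbb{R}^d),$$ where $\beta(\varepsilon)=\dfrac{1+\sqrt{1-4\varepsilon^2\alpha}}{2\varepsilon^2}$.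
   Context: A real-valued Radon measure $m$ on $\mathbb{R}^d$ is written $m=m^+-m^-$ with positive Radon measures $m^\pm$ such that $m^+(\mathbb{R}^d\setminus B)=0=m^-(B)$ for some Borel set $B$; $|m|=m^++m^-$. $C_0^\infty(\mathbb{R}^d)$ is the space of smooth functions with compact support. Under the stated hypothesis on $m$ there is a unique bounded linear map $J_m:H^1(\mathbb{R}^d)\to L^2(\mathbb{R}^d,|m|)$ with $J_mf=f$ for $f\in C_0^\infty(\mathbb{R}^d)$. Let $A_m$ be the operator on $L^2(\mathbb{R}^d,|m|)$ given by $A_mh(x)=h(x)$ for $x\in B$ and $A_mh(x)=-h(x)$ for $x\notin B$. For $\varepsilon\ge0$ let $$\mathcal{E}_\varepsilon^m(f,f)=\varepsilon^2(\Delta f,\Delta f)+(\nabla f,\nabla f)+(A_mJ_mf,J_mf)_{L^2(|m|)},$$ with domain $H^2(\mathbb{R}^d)$ if $\varepsilon>0$, and $H^1(\mathbb{R}^d)$ if $\varepsilon=0$ (in which case the term $\varepsilon^2(\Delta f,\Delta f)$ is absent). This form is lower semibounded and closed in $L^2(\mathbb{R}^d,dx)$, and $-\Delta+\varepsilon^2\Delta^2+m$ (respectively $-\Delta+m$ for $\varepsilon=0$) denotes the associated lower semibounded self-adjoint operator in $L^2(\mathbb{R}^d,dx)$. *)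

theory Defs
  imports "HOL-Analysis.Analysis"
begin

text \<open>
  Functions are complex valued on \<open>real ^ 'd\<close>, where \<open>d = CARD('d)\<close>.  Elements of \<open>L\<^sup>2\<close> are
  handled through measurable representatives; identities between them are meant almost everywhere.
\<close>

subsection \<open>Test functions\<close>

definition partial :: "'d::finite \<Rightarrow> (real ^ 'd \<Rightarrow> complex) \<Rightarrow> real ^ 'd \<Rightarrow> complex" where
  "partial i f x = frechet_derivative f (at x) (axis i 1)"

primrec Ck :: "nat \<Rightarrow> (real ^ 'd::finite \<Rightarrow> complex) \<Rightarrow> bool" where
  "Ck 0 f \<longleftrightarrow> continuous_on UNIV f"
| "Ck (Suc k) f \<longleftrightarrow> (\<forall>x. f differentiable (at x)) \<and> (\<forall>i. Ck k (partial i f))"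

definition test_functions :: "(real ^ 'd::finite \<Rightarrow> complex) set" where
  "test_functions = {f. (\<forall>k. Ck k f) \<and> compact (closure {x. f x \<noteq> 0})}"

subsection \<open>\<open>L\<^sup>2\<close> spaces\<close>

definition L2 :: "'x measure \<Rightarrow> ('x \<Rightarrow> complex) set" where
  "L2 M = {f \<in> borel_measurable M. integrable M (\<lambda>x. (cmod (f x))\<^sup>2)}"

definition L2_norm :: "'x measure \<Rightarrow> ('x \<Rightarrow> complex) \<Rightarrow> real" where
  "L2_norm M f = sqrt (LINT x|M. (cmod (f x))\<^sup>2)"

definition L2_inner :: "'x measure \<Rightarrow> ('x \<Rightarrow> complex) \<Rightarrow> ('x \<Rightarrow> complex) \<Rightarrow> complex" where
  "L2_inner M f g = (LINT x|M. f x * cnj (g x))"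

text \<open>Operator norm of a map of \<open>L2 M\<close> into itself, possibly infinite.\<close>

definition L2_opnorm :: "'x measure \<Rightarrow> (('x \<Rightarrow> complex) \<Rightarrow> 'x \<Rightarrow> complex) \<Rightarrow> ennreal" where
  "L2_opnorm M T = (SUP u \<in> {u \<in> L2 M. L2_norm M u \<le> 1}. ennreal (L2_norm M (T u)))"

subsection \<open>Sobolev spaces\<close>

definition is_weak_partial ::
    "'d::finite \<Rightarrow> (real ^ 'd \<Rightarrow> complex) \<Rightarrow> (real ^ 'd \<Rightarrow> complex) \<Rightarrow> bool" where
  "is_weak_partial i f g \<longleftrightarrow> f \<in> L2 lborel \<and> g \<in> L2 lborel \<and>
     (\<forall>\<phi>\<in>test_functions. (LINT x|lborel. f x * partial i \<phi> x) = - (LINT x|lborel. g x * \<phi> x))"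

text \<open>The choice is unique up to Lebesgue-null sets whenever a weak derivative in \<open>L\<^sup>2\<close> exists.\<close>

definition weak_partial :: "'d::finite \<Rightarrow> (real ^ 'd \<Rightarrow> complex) \<Rightarrow> real ^ 'd \<Rightarrow> complex" where
  "weak_partial i f = (SOME g. is_weak_partial i f g)"

definition H1 :: "(real ^ 'd::finite \<Rightarrow> complex) set" where
  "H1 = {f \<in> L2 lborel. \<forall>i. \<exists>g. is_weak_partial i f g}"

definition H2 :: "(real ^ 'd::finite \<Rightarrow> complex) set" where
  "H2 = {f \<in> H1. \<forall>i. weak_partial i f \<in> H1}"

definition H1_norm :: "(real ^ 'd::finite \<Rightarrow> complex) \<Rightarrow> real" where
  "H1_norm f = sqrt ((L2_norm lborel f)\<^sup>2 + (\<Sum>i\<in>UNIV. (L2_norm lborel (weak_partial i f))\<^sup>2))"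

definition laplacian :: "(real ^ 'd::finite \<Rightarrow> complex) \<Rightarrow> real ^ 'd \<Rightarrow> complex" where
  "laplacian f x = (\<Sum>i\<in>UNIV. weak_partial i (weak_partial i f) x)"

subsection \<open>Real-valued Radon measures\<close>

text \<open>On \<open>real ^ 'd\<close> a locally finite Borel measure is automatically regular.\<close>

definition radon_measure :: "(real ^ 'd::finite) measure \<Rightarrow> bool" where
  "radon_measure M \<longleftrightarrow> sets M = sets borel \<and> (\<forall>K. compact K \<longrightarrow> emeasure M K < \<infinity>)"

text \<open>
  A real-valued Radon measure \<open>m\<close> is represented by \<open>m\<^sup>+\<close>, \<open>m\<^sup>-\<close> and a Borel set \<open>B\<close> that
  separates them.  Both parts may have infinite total mass, so \<open>m\<close> itself need not be
  defined on all Borel sets.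
\<close>

definition real_radon_measure ::
    "(real ^ 'd::finite) measure \<Rightarrow> (real ^ 'd) measure \<Rightarrow> (real ^ 'd) set \<Rightarrow> bool" where
  "real_radon_measure mp mn B \<longleftrightarrow> radon_measure mp \<and> radon_measure mn \<and> B \<in> sets borel \<and>
     emeasure mp (- B) = 0 \<and> emeasure mn B = 0"

definition total_variation ::
    "(real ^ 'd::finite) measure \<Rightarrow> (real ^ 'd) measure \<Rightarrow> (real ^ 'd) measure" where
  "total_variation mp mn = measure_of UNIV (sets borel) (\<lambda>A. emeasure mp A + emeasure mn A)"

text \<open>\<open>\<integral>|f|\<^sup>2 dM \<le> \<eta> (\<integral>|\<nabla>f|\<^sup>2 dx + \<beta> \<integral>|f|\<^sup>2 dx)\<close> on test functions\<close>

definition form_bound :: "(real ^ 'd::finite) measure \<Rightarrow> real \<Rightarrow> real \<Rightarrow> bool" where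
  "form_bound M \<eta> \<beta> \<longleftrightarrow> (\<forall>f\<in>test_functions.
     (LINT x|M. (cmod (f x))\<^sup>2)
       \<le> \<eta> * ((LINT x|lborel. (\<Sum>i\<in>UNIV. (cmod (partial i f x))\<^sup>2))
              + \<beta> * (LINT x|lborel. (cmod (f x))\<^sup>2)))"

subsection \<open>The forms and their operators\<close>

text \<open>Bounded linear maps from \<open>H1\<close> to \<open>L2 M\<close> extending the inclusion of test functions.
  Boundedness and linearity imply that almost everywhere equal arguments have \<open>M\<close>-almost
  everywhere equal images.\<close>

definition is_form_embedding :: "(real ^ 'd::finite) measure
    \<Rightarrow> ((real ^ 'd \<Rightarrow> complex) \<Rightarrow> real ^ 'd \<Rightarrow> complex) \<Rightarrow> bool" where
  "is_form_embedding M J \<longleftrightarrow>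
     (\<forall>f\<in>H1. J f \<in> L2 M) \<and>
     (\<forall>f\<in>H1. \<forall>g\<in>H1. \<forall>a b.
        AE x in M. J (\<lambda>y. a * f y + b * g y) x = a * J f x + b * J g x) \<and>
     (\<exists>C. \<forall>f\<in>H1. L2_norm M (J f) \<le> C * H1_norm f) \<and>
     (\<forall>f\<in>test_functions. AE x in M. J f x = f x)"

definition form_embedding :: "(real ^ 'd::finite) measure
    \<Rightarrow> (real ^ 'd \<Rightarrow> complex) \<Rightarrow> real ^ 'd \<Rightarrow> complex" where
  "form_embedding M = (SOME J. is_form_embedding M J)"

definition sign_op :: "(real ^ 'd::finite) set \<Rightarrow> (real ^ 'd \<Rightarrow> complex) \<Rightarrow> real ^ 'd \<Rightarrow> complex" where
  "sign_op B h x = (if x \<in> B then h x else - h x)"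

definition schroedinger_domain :: "real \<Rightarrow> (real ^ 'd::finite \<Rightarrow> complex) set" where
  "schroedinger_domain \<epsilon> = (if \<epsilon> = 0 then H1 else H2)"

text \<open>The sesquilinear form whose diagonal is \<open>\<E>\<^sub>\<epsilon>\<^sup>m(f,f)\<close>, linear in the first argument.\<close>

definition schroedinger_form ::
    "(real ^ 'd::finite) measure \<Rightarrow> (real ^ 'd) measure \<Rightarrow> (real ^ 'd) set \<Rightarrow> real
     \<Rightarrow> (real ^ 'd \<Rightarrow> complex) \<Rightarrow> (real ^ 'd \<Rightarrow> complex) \<Rightarrow> complex" where
  "schroedinger_form mp mn B \<epsilon> f g =
     (if \<epsilon> = 0 then 0
      else complex_of_real (\<epsilon>\<^sup>2) * L2_inner lborel (laplacian f) (laplacian g))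
     + (\<Sum>i\<in>UNIV. L2_inner lborel (weak_partial i f) (weak_partial i g))
     + (let M = total_variation mp mn; J = form_embedding M
        in L2_inner M (sign_op B (J f)) (J g))"

text \<open>
  The graph of the operator in \<open>L2 lborel\<close> associated with a form \<open>a\<close> with domain \<open>D\<close>
  (first representation theorem).  A graph contains all representatives of its values.
\<close>

definition form_operator :: "(real ^ 'd::finite \<Rightarrow> complex) set
    \<Rightarrow> ((real ^ 'd \<Rightarrow> complex) \<Rightarrow> (real ^ 'd \<Rightarrow> complex) \<Rightarrow> complex)
    \<Rightarrow> ((real ^ 'd \<Rightarrow> complex) \<times> (real ^ 'd \<Rightarrow> complex)) set" where
  "form_operator D a =
     {(f, h). f \<in> D \<and> h \<in> L2 lborel \<and> (\<forall>g\<in>D. a f g = L2_inner lborel h g)}"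

definition schroedinger_op ::
    "(real ^ 'd::finite) measure \<Rightarrow> (real ^ 'd) measure \<Rightarrow> (real ^ 'd) set \<Rightarrow> real
     \<Rightarrow> ((real ^ 'd \<Rightarrow> complex) \<times> (real ^ 'd \<Rightarrow> complex)) set" where
  "schroedinger_op mp mn B \<epsilon> =
     form_operator (schroedinger_domain \<epsilon>) (schroedinger_form mp mn B \<epsilon>)"

text \<open>\<open>T + \<alpha>\<close> maps onto \<open>L2 lborel\<close> and is bounded below, that is, it is a bijection with
  bounded inverse.\<close>

definition boundedly_invertible_shift ::
    "((real ^ 'd::finite \<Rightarrow> complex) \<times> (real ^ 'd \<Rightarrow> complex)) set \<Rightarrow> real \<Rightarrow> bool" where
  "boundedly_invertible_shift T \<alpha> \<longleftrightarrow>
     (\<forall>u\<in>L2 lborel. \<exists>(f, h)\<in>T. AE x in lborel. h x + complex_of_real \<alpha> * f x = u x) \<and>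
     (\<exists>C. \<forall>(f, h)\<in>T.
        L2_norm lborel f \<le> C * L2_norm lborel (\<lambda>x. h x + complex_of_real \<alpha> * f x))"

text \<open>\<open>(T + \<alpha>)\<^sup>-\<^sup>1 u\<close>, meaningful if \<open>boundedly_invertible_shift T \<alpha>\<close> holds; the choice is then
  unique up to Lebesgue-null sets.\<close>

definition shift_inverse ::
    "((real ^ 'd::finite \<Rightarrow> complex) \<times> (real ^ 'd \<Rightarrow> complex)) set \<Rightarrow> real
     \<Rightarrow> (real ^ 'd \<Rightarrow> complex) \<Rightarrow> real ^ 'd \<Rightarrow> complex" where
  "shift_inverse T \<alpha> u =
     (SOME f. \<exists>h. (f, h) \<in> T \<and> (AE x in lborel. h x + complex_of_real \<alpha> * f x = u x))"

end

theory Submission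
  imports Defs
begin

text \<open>
  The Hilbert space \<open>H\<^sup>1\<close> is handled without the Fourier transform.  Density of the test
  functions in \<open>H\<^sup>1\<close> and \<open>H\<^sup>2\<close>-regularity both follow from one uniqueness fact:
  \<open>v \<in> L\<^sup>2\<close> and \<open>v - \<Delta>v = 0\<close> in the sense of distributions imply \<open>v = 0\<close>.  Indeed
  \<open>w(h) = \<integral> v(y) \<phi>(y + h) dy\<close> is a bounded classical solution of \<open>w = \<Delta>w\<close> for every test
  function \<open>\<phi>\<close>, hence zero by the maximum principle.

  For the estimate let \<open>f\<close> and \<open>g\<close> be the resolvents of \<open>-\<Delta> + m\<close> and of
  \<open>-\<Delta> + \<epsilon>\<^sup>2\<Delta>\<^sup>2 + m\<close> applied to \<open>u\<close>, and put \<open>f' = (1 - \<epsilon>\<^sup>2\<Delta>)\<^sup>-\<^sup>1 f\<close> and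
  \<open>h = f - f' = - \<epsilon>\<^sup>2\<Delta>f'\<close>.  Testing the equation of \<open>f\<close> with \<open>h\<close> bounds
  \<open>N\<^sup>2 = \<parallel>\<nabla>h\<parallel>\<^sup>2 + \<epsilon>\<^sup>-\<^sup>2 \<parallel>h\<parallel>\<^sup>2\<close> by \<open>(u, h) - m(f, h)\<close>.  Since \<open>\<beta>(\<epsilon>) \<le> \<epsilon>\<^sup>-\<^sup>2\<close>, the form bound
  gives \<open>\<parallel>J h\<parallel>\<^sup>2 \<le> \<eta> N\<^sup>2\<close>, so that \<open>N = O(\<epsilon> + \<surd>\<eta>)\<close>.  Because
  \<open>\<epsilon>\<^sup>2\<Delta>\<^sup>2f' - \<Delta>f' = - \<Delta>f\<close>, the form of \<open>-\<Delta> + \<epsilon>\<^sup>2\<Delta>\<^sup>2 + m + \<alpha>\<close> sends the pair of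
  \<open>f' - g\<close> and \<open>w\<close> to \<open>- m(h, w) - \<alpha>(h, w)\<close>, and coercivity bounds \<open>f' - g\<close> by
  \<open>O(\<parallel>J h\<parallel> + \<parallel>h\<parallel>) = O((\<epsilon> + \<surd>\<eta>) N) = O(\<epsilon>\<^sup>2 + \<eta>)\<close>.
\<close>

section \<open>Semi-Hilbert spaces of functions\<close>

text \<open>The theorem speaks of functions, not of classes modulo null sets. Every inner product
  here is therefore only semidefinite, limits are not unique, and derivatives, embeddings and
  resolvents are choices that are linear almost everywhere at best. So the Hilbert space arguments
  are proved once for semidefinite products on sets of functions and reused for \<open>L2\<close>,
  \<open>H1\<close>, \<open>H2\<close> and the shifted forms. The obstacle in the estimate is that f
  lies only in \<open>H1\<close>, outside the domain \<open>H2\<close> of the fourth-order form, so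
  f - g cannot be inserted into that form. The smoothing f' lies in \<open>H2\<close>, and its
  defining equation turns the fourth-order term into the missing part of the gradient term. The rate
  is linear in \<eta> because sqrt \<eta> is gained twice: once in N, and once more in the |m|-norm
  of h. Coercivity and the threshold for \<alpha> come from the form bound with factor 1/2; the
  sharper \<eta> enters only through h.\<close>

lemma tendsto_0_squeeze:
  fixes a b :: "nat \<Rightarrow> real"
  assumes "\<And>n. 0 \<le> a n" "\<And>n. a n \<le> b n" "b \<longlonglongrightarrow> 0"
  shows "a \<longlonglongrightarrow> 0"
  by (rule real_tendsto_sandwich[OF _ _ tendsto_const assms(3)]) (auto simp: assms)

locale semi_inner =
  fixes V :: "('x \<Rightarrow> complex) set" and ip :: "('x \<Rightarrow> complex) \<Rightarrow> ('x \<Rightarrow> complex) \<Rightarrow> complex"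
  assumes lin_closed: "f \<in> V \<Longrightarrow> g \<in> V \<Longrightarrow> (\<lambda>x. a * f x + b * g x) \<in> V"
    and ip_lin: "f \<in> V \<Longrightarrow> g \<in> V \<Longrightarrow> h \<in> V \<Longrightarrow>
      ip (\<lambda>x. a * f x + b * g x) h = a * ip f h + b * ip g h"
    and ip_cnj: "f \<in> V \<Longrightarrow> g \<in> V \<Longrightarrow> ip g f = cnj (ip f g)"
    and ip_nonneg: "f \<in> V \<Longrightarrow> 0 \<le> Re (ip f f)"
begin

definition nrm :: "('x \<Rightarrow> complex) \<Rightarrow> real" where
  "nrm f = sqrt (Re (ip f f))"

lemma ip_lin2:
  "f \<in> V \<Longrightarrow> g \<in> V \<Longrightarrow> h \<in> V \<Longrightarrow>
    ip h (\<lambda>x. a * f x + b * g x) = cnj a * ip h f + cnj b * ip h g"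
  by (subst ip_cnj) (auto simp: ip_lin lin_closed ip_cnj[of h f] ip_cnj[of h g])

lemma add_closed: "f \<in> V \<Longrightarrow> g \<in> V \<Longrightarrow> (\<lambda>x. f x + g x) \<in> V"
  using lin_closed[of f g 1 1] by simp

lemma diff_closed: "f \<in> V \<Longrightarrow> g \<in> V \<Longrightarrow> (\<lambda>x. f x - g x) \<in> V"
  using lin_closed[of f g 1 "-1"] by simp

lemma ip_diff: "f \<in> V \<Longrightarrow> g \<in> V \<Longrightarrow> h \<in> V \<Longrightarrow> ip (\<lambda>x. f x - g x) h = ip f h - ip g h"
  using ip_lin[of f g h 1 "-1"] by simp

lemma ip_diff2: "f \<in> V \<Longrightarrow> g \<in> V \<Longrightarrow> h \<in> V \<Longrightarrow> ip h (\<lambda>x. f x - g x) = ip h f - ip h g"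
  using ip_lin2[of f g h 1 "-1"] by simp

lemma ip_add: "f \<in> V \<Longrightarrow> g \<in> V \<Longrightarrow> h \<in> V \<Longrightarrow> ip (\<lambda>x. f x + g x) h = ip f h + ip g h"
  using ip_lin[of f g h 1 "1"] by simp

lemma ip_self: "f \<in> V \<Longrightarrow> ip f f = complex_of_real ((nrm f)\<^sup>2)"
  using ip_cnj[of f f] ip_nonneg[of f] by (simp add: nrm_def complex_eq_iff)

lemma nrm_nonneg: "f \<in> V \<Longrightarrow> 0 \<le> nrm f"
  by (simp add: nrm_def ip_nonneg)

lemma nrm_sq_lin:
  assumes "f \<in> V" "g \<in> V"
  shows "(nrm (\<lambda>x. a * f x + b * g x))\<^sup>2 =
    (cmod a)\<^sup>2 * (nrm f)\<^sup>2 + 2 * Re (a * cnj b * ip f g) + (cmod b)\<^sup>2 * (nrm g)\<^sup>2"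
proof -
  have "complex_of_real ((nrm (\<lambda>x. a * f x + b * g x))\<^sup>2) =
      a * cnj a * ip f f + (a * cnj b * ip f g + cnj (a * cnj b * ip f g)) + b * cnj b * ip g g"
    using assms
    by (subst ip_self[symmetric]) (simp_all add: lin_closed ip_lin ip_lin2 ip_cnj[of f g] algebra_simps)
  also have "\<dots> = complex_of_real ((cmod a)\<^sup>2 * (nrm f)\<^sup>2 + 2 * Re (a * cnj b * ip f g)
      + (cmod b)\<^sup>2 * (nrm g)\<^sup>2)"
    unfolding complex_mult_cnj complex_add_cnj using assms
    by (simp add: ip_self cmod_power2)
  finally show ?thesis
    by (simp only: of_real_eq_iff)
qed

text \<open>The function g - s * cnj (ip f g) * f has nonnegative square for every real s. If nrm f
  > 0, the minimum at s = 1 / nrm f ^ 2 gives the claim. If nrm f = 0, which does not force f = 0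
  here, the square is affine in s and its slope must vanish.\<close>

lemma Cauchy_Schwarz:
  assumes "f \<in> V" "g \<in> V"
  shows "cmod (ip f g) \<le> nrm f * nrm g"
proof -
  let ?z = "ip f g"
  have key: "0 \<le> s\<^sup>2 * (cmod ?z)\<^sup>2 * (nrm f)\<^sup>2 - 2 * s * (cmod ?z)\<^sup>2 + (nrm g)\<^sup>2" for s :: real
  proof -
    have "0 \<le> (nrm (\<lambda>x. - (of_real s * cnj ?z) * f x + 1 * g x))\<^sup>2"
      by simp
    also have "\<dots> = s\<^sup>2 * (cmod ?z)\<^sup>2 * (nrm f)\<^sup>2 - 2 * s * (cmod ?z)\<^sup>2 + (nrm g)\<^sup>2"
    proof -
      have "Re (- (of_real s * cnj ?z) * cnj 1 * ?z) = - s * (cmod ?z)\<^sup>2"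
        unfolding cmod_power2 by (simp add: power2_eq_square algebra_simps)
      then show ?thesis
        unfolding nrm_sq_lin[OF assms] by (simp add: norm_mult power_mult_distrib)
    qed
    finally show ?thesis .
  qed
  have "(cmod ?z)\<^sup>2 \<le> (nrm f)\<^sup>2 * (nrm g)\<^sup>2"
  proof (cases "nrm f = 0")
    case True
    have "cmod ?z = 0"
    proof (rule ccontr)
      assume nz: "cmod ?z \<noteq> 0"
      \<comment> \<open>With this s the affine expression takes the value -1.\<close>
      define s where "s = ((nrm g)\<^sup>2 + 1) / (2 * (cmod ?z)\<^sup>2)"
      have "0 \<le> - 2 * (s * (cmod ?z)\<^sup>2) + (nrm g)\<^sup>2"
        using key[of s] True by simp
      also have "s * (cmod ?z)\<^sup>2 = ((nrm g)\<^sup>2 + 1) / 2"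
        using nz by (simp add: s_def)
      also have "- 2 * (((nrm g)\<^sup>2 + 1) / 2) + (nrm g)\<^sup>2 = -1"
        by argo
      finally show False by simp
    qed
    then show ?thesis by simp
  next
    case False
    then have p: "(nrm f)\<^sup>2 > 0" by simp
    have "0 \<le> (1 / (nrm f)\<^sup>2)\<^sup>2 * (cmod ?z)\<^sup>2 * (nrm f)\<^sup>2 - 2 * (1 / (nrm f)\<^sup>2) * (cmod ?z)\<^sup>2 + (nrm g)\<^sup>2"
      by (rule key)
    also have "\<dots> = (nrm g)\<^sup>2 - (cmod ?z)\<^sup>2 / (nrm f)\<^sup>2"
      using p by (simp add: field_simps power2_eq_square)
    finally show ?thesis using p by (simp add: field_simps)
  qed
  then have "(cmod ?z)\<^sup>2 \<le> (nrm f * nrm g)\<^sup>2" by (simp add: power_mult_distrib)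
  then show ?thesis
    using assms by (meson power2_le_imp_le mult_nonneg_nonneg nrm_nonneg)
qed

lemma nrm_add:
  assumes "f \<in> V" "g \<in> V"
  shows "nrm (\<lambda>x. f x + g x) \<le> nrm f + nrm g"
proof -
  have "(nrm (\<lambda>x. f x + g x))\<^sup>2 = (nrm f)\<^sup>2 + 2 * Re (ip f g) + (nrm g)\<^sup>2"
    using nrm_sq_lin[OF assms, of 1 1] by simp
  also have "\<dots> \<le> (nrm f + nrm g)\<^sup>2"
    using Cauchy_Schwarz[OF assms] complex_Re_le_cmod[of "ip f g"]
    by (simp add: power2_sum)
  finally show ?thesis
    using assms by (meson power2_le_imp_le add_nonneg_nonneg nrm_nonneg)
qed

lemma nrm_minus:
  assumes "f \<in> V" "g \<in> V"
  shows "nrm (\<lambda>x. f x - g x) = nrm (\<lambda>x. g x - f x)"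
  using assms ip_cnj[of f g]
  by (simp add: nrm_def ip_diff ip_diff2 diff_closed)

lemma nrm_triangle:
  assumes "f \<in> V" "g \<in> V" "h \<in> V"
  shows "nrm (\<lambda>x. f x - h x) \<le> nrm (\<lambda>x. f x - g x) + nrm (\<lambda>x. g x - h x)"
  using nrm_add[of "\<lambda>x. f x - g x" "\<lambda>x. g x - h x"] assms by (simp add: diff_closed)

lemma nrm_reverse_triangle:
  assumes "f \<in> V" "g \<in> V"
  shows "\<bar>nrm f - nrm g\<bar> \<le> nrm (\<lambda>x. f x - g x)"
  using nrm_add[of "\<lambda>x. f x - g x" g] nrm_add[of "\<lambda>x. g x - f x" f] nrm_minus[of f g] assms
  by (simp add: diff_closed)

definition tends :: "(nat \<Rightarrow> 'x \<Rightarrow> complex) \<Rightarrow> ('x \<Rightarrow> complex) \<Rightarrow> bool" where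
  "tends F f \<longleftrightarrow> (\<forall>n. F n \<in> V) \<and> f \<in> V \<and> (\<lambda>n. nrm (\<lambda>x. F n x - f x)) \<longlonglongrightarrow> 0"

definition cauchy :: "(nat \<Rightarrow> 'x \<Rightarrow> complex) \<Rightarrow> bool" where
  "cauchy F \<longleftrightarrow> (\<forall>n. F n \<in> V) \<and> (\<forall>e>0. \<exists>N. \<forall>m\<ge>N. \<forall>n\<ge>N. nrm (\<lambda>x. F m x - F n x) < e)"

lemma tends_nrm:
  assumes "tends F f"
  shows "(\<lambda>n. nrm (F n)) \<longlonglongrightarrow> nrm f"
proof (rule LIM_zero_cancel, rule tendsto_0_le)
  show "(\<lambda>n. nrm (\<lambda>x. F n x - f x)) \<longlonglongrightarrow> 0"
    using assms by (simp add: tends_def)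
  show "\<forall>\<^sub>F n in sequentially. norm (nrm (F n) - nrm f) \<le> norm (nrm (\<lambda>x. F n x - f x)) * 1"
    using assms nrm_reverse_triangle nrm_nonneg
    by (intro always_eventually allI) (simp add: tends_def diff_closed)
qed

lemma tends_ip:
  assumes "tends F f" "g \<in> V"
  shows "(\<lambda>n. ip (F n) g) \<longlonglongrightarrow> ip f g"
proof (rule LIM_zero_cancel, rule tendsto_0_le)
  show "(\<lambda>n. nrm (\<lambda>x. F n x - f x)) \<longlonglongrightarrow> 0"
    using assms by (simp add: tends_def)
  show "\<forall>\<^sub>F n in sequentially. norm (ip (F n) g - ip f g) \<le> norm (nrm (\<lambda>x. F n x - f x)) * nrm g"
    using assms Cauchy_Schwarz[of "\<lambda>x. F _ x - f x" g]
    by (intro always_eventually) (auto simp: tends_def nrm_nonneg diff_closed ip_diff[symmetric])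
qed

lemma tends_ip2:
  assumes "tends F f" "g \<in> V"
  shows "(\<lambda>n. ip g (F n)) \<longlonglongrightarrow> ip g f"
  using tendsto_cnj[OF tends_ip[OF assms]] assms ip_cnj[of _ g] by (simp add: tends_def)

text \<open>A bound split into a term in m and a term in n is what a triangle inequality through a
  common limit delivers, and also what subadditivity of the square root gives for minimising
  sequences.\<close>

lemma cauchy_sub_bound:
  assumes "\<And>n. F n \<in> V" "r \<longlonglongrightarrow> 0" "\<And>m n. nrm (\<lambda>x. F m x - F n x) \<le> r m + r n"
  shows "cauchy F"
  unfolding cauchy_def
proof (intro conjI allI impI)
  show "F n \<in> V" for n by fact
  fix e :: real assume "e > 0"
  then have "\<forall>\<^sub>F n in sequentially. r n < e / 2"
    using assms(2) by (metis half_gt_zero order_tendstoD(2))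
  then obtain N where N: "\<And>n. n \<ge> N \<Longrightarrow> r n < e / 2"
    by (auto simp: eventually_sequentially)
  show "\<exists>N. \<forall>m\<ge>N. \<forall>n\<ge>N. nrm (\<lambda>x. F m x - F n x) < e"
    by (intro exI[of _ N] allI impI) (smt (verit) N assms(3) field_sum_of_halves)
qed

lemma nrm_scale: "f \<in> V \<Longrightarrow> nrm (\<lambda>x. a * f x) = cmod a * nrm f"
proof -
  assume f: "f \<in> V"
  have "(\<lambda>x. a * f x) \<in> V" using lin_closed[OF f f, of a 0] by simp
  moreover have "(nrm (\<lambda>x. a * f x))\<^sup>2 = (cmod a * nrm f)\<^sup>2"
    using nrm_sq_lin[OF f f, of a 0] by (simp add: power_mult_distrib)
  ultimately show ?thesis
    using f by (auto intro: power2_eq_imp_eq[OF _ nrm_nonneg] simp: nrm_nonneg)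
qed

lemma tends_lin:
  assumes "tends F f" "tends G g"
  shows "tends (\<lambda>n x. a * F n x + b * G n x) (\<lambda>x. a * f x + b * g x)"
proof -
  have V: "F n \<in> V" "G n \<in> V" "f \<in> V" "g \<in> V" for n using assms by (auto simp: tends_def)
  have sc: "(\<lambda>x. a * h x) \<in> V" if "h \<in> V" for h a using lin_closed[OF that that, of a 0] by simp
  have "nrm (\<lambda>x. a * F n x + b * G n x - (a * f x + b * g x))
      \<le> cmod a * nrm (\<lambda>x. F n x - f x) + cmod b * nrm (\<lambda>x. G n x - g x)" for n
  proof -
    have "(\<lambda>x. a * F n x + b * G n x - (a * f x + b * g x)) = (\<lambda>x. a * (F n x - f x) + b * (G n x - g x))"
      by (auto simp: algebra_simps)
    then show ?thesis
      using nrm_add[OF sc[OF diff_closed[OF V(1,3)]] sc[OF diff_closed[OF V(2,4)]], of a n b n]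
      by (simp add: nrm_scale diff_closed V)
  qed
  moreover have "0 \<le> nrm (\<lambda>x. a * F n x + b * G n x - (a * f x + b * g x))" for n
    by (intro nrm_nonneg diff_closed lin_closed V)
  moreover have "(\<lambda>n. cmod a * nrm (\<lambda>x. F n x - f x) + cmod b * nrm (\<lambda>x. G n x - g x)) \<longlonglongrightarrow> 0"
    using assms by (auto simp: tends_def intro!: tendsto_add_zero tendsto_mult_right_zero)
  ultimately have "(\<lambda>n. nrm (\<lambda>x. a * F n x + b * G n x - (a * f x + b * g x))) \<longlonglongrightarrow> 0"
    by - (rule tendsto_0_squeeze, assumption+)
  then show ?thesis by (simp add: tends_def lin_closed V)
qed

lemma tends_const: "f \<in> V \<Longrightarrow> tends (\<lambda>n. f) f"
  using nrm_scale[of f 0] by (simp add: tends_def)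

lemma tends_close:
  assumes "tends F f" "\<And>n. G n \<in> V" "(\<lambda>n. nrm (\<lambda>x. G n x - F n x)) \<longlonglongrightarrow> 0"
  shows "tends G f"
proof -
  have V: "F n \<in> V" "f \<in> V" for n using assms by (auto simp: tends_def)
  have "(\<lambda>n. nrm (\<lambda>x. G n x - F n x) + nrm (\<lambda>x. F n x - f x)) \<longlonglongrightarrow> 0"
    using assms by (auto simp: tends_def intro!: tendsto_add_zero)
  then have "(\<lambda>n. nrm (\<lambda>x. G n x - f x)) \<longlonglongrightarrow> 0"
    by (rule tendsto_0_squeeze[OF nrm_nonneg nrm_triangle, rotated -1]) (auto intro: diff_closed assms V)
  then show ?thesis by (simp add: tends_def assms V)
qed

end

locale semi_hilbert = semi_inner +
  assumes complete: "cauchy F \<Longrightarrow> \<exists>f. tends F f"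
begin

text \<open>Minimises \<open>ip w w - 2 Re (l w)\<close> over \<open>W\<close>.  With \<open>W = V\<close> this is the Riesz representation
  theorem; with \<open>l = ip f\<close> it is the projection onto the closure of \<open>W\<close>.\<close>

lemma Riesz_limit:
  assumes WV: "W \<subseteq> V" and ne: "W \<noteq> {}"
    and Wlin: "\<And>f g a b. f \<in> W \<Longrightarrow> g \<in> W \<Longrightarrow> (\<lambda>x. a * f x + b * g x) \<in> W"
    and llin: "\<And>f g a b. f \<in> W \<Longrightarrow> g \<in> W \<Longrightarrow> l (\<lambda>x. a * f x + b * g x) = cnj a * l f + cnj b * l g"
    and lbd: "\<And>w. w \<in> W \<Longrightarrow> cmod (l w) \<le> C * nrm w"
  obtains F p where "\<And>n. F n \<in> W" "tends F p" "\<And>w. w \<in> W \<Longrightarrow> ip p w = l w"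
proof -
  define Q where "Q w = (nrm w)\<^sup>2 - 2 * Re (l w)" for w
  \<comment> \<open>Completing the square in nrm w shows that the infimum is finite.\<close>
  have Qlow: "- C\<^sup>2 \<le> Q w" if "w \<in> W" for w
  proof -
    have "Re (l w) \<le> C * nrm w"
      using lbd[OF that] complex_Re_le_cmod[of "l w"] by linarith
    moreover have "0 \<le> (nrm w - C)\<^sup>2" by simp
    ultimately show ?thesis by (simp add: Q_def power2_diff algebra_simps)
  qed
  define d where "d = Inf (Q ` W)"
  have bb: "bdd_below (Q ` W)" using Qlow by (auto intro!: bdd_belowI2)
  have dle: "d \<le> Q w" if "w \<in> W" for w
    unfolding d_def using that bb by (auto intro: cInf_lower)
  have "\<exists>w\<in>W. Q w < d + 1 / Suc n" for n
    using cInf_lessD[of "Q ` W" "d + 1 / Suc n"] ne by (auto simp: d_def)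
  then obtain F where FW: "\<And>n. F n \<in> W" and FQ: "\<And>n. Q (F n) < d + 1 / Suc n" by metis
  have FV: "F n \<in> V" for n using FW WV by auto
  \<comment> \<open>Parallelogram law: the midpoint of two near-minimisers is again in W, so its
    value cannot fall below d, which forces the two to be close.\<close>
  have est: "(nrm (\<lambda>x. F m x - F n x))\<^sup>2 \<le> 2 * (1 / Suc m + 1 / Suc n)" for m n
  proof -
    have "d \<le> Q (\<lambda>x. (1/2) * F m x + (1/2) * F n x)" by (intro dle Wlin FW)
    also have "\<dots> = (1/4) * (nrm (F m))\<^sup>2 + (1/2) * Re (ip (F m) (F n)) + (1/4) * (nrm (F n))\<^sup>2
        - (Re (l (F m)) + Re (l (F n)))"
      unfolding Q_def nrm_sq_lin[OF FV FV] llin[OF FW FW] by (simp add: power2_eq_square)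
    finally have 1: "d \<le> \<dots>" .
    have "(nrm (\<lambda>x. F m x - F n x))\<^sup>2 = (nrm (F m))\<^sup>2 - 2 * Re (ip (F m) (F n)) + (nrm (F n))\<^sup>2"
      using nrm_sq_lin[OF FV FV, of 1 m "-1" n] by simp
    with 1 FQ[of m] FQ[of n] show ?thesis unfolding Q_def by argo
  qed
  have "nrm (\<lambda>x. F m x - F n x) \<le> sqrt (2 * (1 / Suc m)) + sqrt (2 * (1 / Suc n))" for m n
  proof -
    have "nrm (\<lambda>x. F m x - F n x) \<le> sqrt (2 * (1 / Suc m) + 2 * (1 / Suc n))"
      using real_le_rsqrt[OF est] by (simp only: distrib_left)
    also have "\<dots> \<le> sqrt (2 * (1 / Suc m)) + sqrt (2 * (1 / Suc n))"
      by (rule sqrt_add_le_add_sqrt) auto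
    finally show ?thesis .
  qed
  moreover have "(\<lambda>n. sqrt (2 * (1 / real (Suc n)))) \<longlonglongrightarrow> sqrt (2 * 0)"
    using LIMSEQ_inverse_real_of_nat
    by (intro tendsto_real_sqrt tendsto_mult tendsto_const) (simp add: inverse_eq_divide)
  ultimately have "cauchy F"
    using FV by (intro cauchy_sub_bound[of F "\<lambda>n. sqrt (2 * (1 / Suc n))"]) auto
  then obtain p where p: "tends F p" using complete by blast
  have "ip p w = l w" if w: "w \<in> W" for w
  proof (rule ccontr)
    assume neq: "ip p w \<noteq> l w"
    have wV: "w \<in> V" using w WV by auto
    define z where "z = ip p w - l w"
    have z0: "(cmod z)\<^sup>2 > 0" using neq by (simp add: z_def)
    \<comment> \<open>Perturbing \<open>F n\<close> by t w lowers Q by less than 1 / Suc n. In the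
      limit this is the minimality condition at p, although p itself need not lie in W.\<close>
    have ineq: "0 \<le> 2 * Re (cnj t * z) + (cmod t)\<^sup>2 * (nrm w)\<^sup>2" for t
    proof (rule LIMSEQ_le_const)
      show "(\<lambda>n. 1 / real (Suc n) + 2 * Re (cnj t * (ip (F n) w - l w)) + (cmod t)\<^sup>2 * (nrm w)\<^sup>2)
          \<longlonglongrightarrow> 2 * Re (cnj t * z) + (cmod t)\<^sup>2 * (nrm w)\<^sup>2"
        using tendsto_add[OF tendsto_add[OF LIMSEQ_inverse_real_of_nat tendsto_mult[OF
          tendsto_const[of 2] tendsto_Re[OF tendsto_mult[OF tendsto_const[of "cnj t"]
          tendsto_diff[OF tends_ip[OF p wV] tendsto_const[of "l w"]]]]]] tendsto_const]
        unfolding z_def inverse_eq_divide by simp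
      have "0 \<le> 1 / real (Suc n) + 2 * Re (cnj t * (ip (F n) w - l w)) + (cmod t)\<^sup>2 * (nrm w)\<^sup>2" for n
      proof -
        have "d \<le> Q (\<lambda>x. 1 * F n x + t * w x)" by (intro dle Wlin FW w)
        also have "\<dots> = Q (F n) + 2 * Re (cnj t * (ip (F n) w - l w)) + (cmod t)\<^sup>2 * (nrm w)\<^sup>2"
          unfolding Q_def nrm_sq_lin[OF FV wV] llin[OF FW w] by (simp add: algebra_simps)
        finally show ?thesis using FQ[of n] by simp
      qed
      then show "\<exists>N. \<forall>n\<ge>N. 0 \<le> 1 / real (Suc n) + 2 * Re (cnj t * (ip (F n) w - l w))
          + (cmod t)\<^sup>2 * (nrm w)\<^sup>2" by blast
    qed
    \<comment> \<open>With t = - s z the linear term outweighs the quadratic one as soon as s * nrm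
      w ^ 2 < 2; the added 1 covers nrm w = 0.\<close>
    define s where "s = 1 / ((nrm w)\<^sup>2 + 1)"
    have "0 < (nrm w)\<^sup>2 + 1" by (simp add: add_nonneg_pos)
    then have s: "0 < s" "s * (nrm w)\<^sup>2 < 1" by (simp_all add: s_def divide_simps)
    have "0 \<le> 2 * Re (cnj (- of_real s * z) * z) + (cmod (- of_real s * z))\<^sup>2 * (nrm w)\<^sup>2"
      by (rule ineq)
    also have "\<dots> = s * (cmod z)\<^sup>2 * (s * (nrm w)\<^sup>2 - 2)"
    proof -
      have "Re (cnj (- of_real s * z) * z) = - s * (cmod z)\<^sup>2"
        unfolding cmod_power2 by (simp add: power2_eq_square algebra_simps)
      moreover have "(cmod (- of_real s * z))\<^sup>2 = s\<^sup>2 * (cmod z)\<^sup>2"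
        by (simp add: norm_mult power_mult_distrib)
      ultimately show ?thesis by (simp add: power2_eq_square algebra_simps del: complex_cnj_mult complex_cnj_minus)
    qed
    also have "\<dots> < 0"
      using s(2) by (intro mult_pos_neg mult_pos_pos s(1) z0) simp
    finally show False by simp
  qed
  then show thesis using that FW p by blast
qed

lemma Riesz:
  assumes "V \<noteq> {}"
    and "\<And>f g a b. f \<in> V \<Longrightarrow> g \<in> V \<Longrightarrow> l (\<lambda>x. a * f x + b * g x) = cnj a * l f + cnj b * l g"
    and "\<And>w. w \<in> V \<Longrightarrow> cmod (l w) \<le> C * nrm w"
  shows "\<exists>p\<in>V. \<forall>w\<in>V. ip p w = l w"
proof (rule Riesz_limit[of V l C])
  show "\<exists>p\<in>V. \<forall>w\<in>V. ip p w = l w" if "tends F p" "\<And>w. w \<in> V \<Longrightarrow> ip p w = l w" for F p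
    using that unfolding tends_def by blast
qed (use assms lin_closed in auto)

text \<open>The sequence in W converging to the projection p of f does the job: p - f is orthogonal
  to W, hence has norm 0, so the sequence converges to f as well, even if p and f differ as
  functions.\<close>

lemma dense_if_orthogonal_trivial:
  assumes WV: "W \<subseteq> V" and ne: "W \<noteq> {}"
    and Wlin: "\<And>f g a b. f \<in> W \<Longrightarrow> g \<in> W \<Longrightarrow> (\<lambda>x. a * f x + b * g x) \<in> W"
    and orth: "\<And>v. v \<in> V \<Longrightarrow> (\<And>w. w \<in> W \<Longrightarrow> ip v w = 0) \<Longrightarrow> nrm v = 0"
    and f: "f \<in> V"
  obtains F where "\<And>n. F n \<in> W" "tends F f"
proof (rule Riesz_limit[of W "ip f" "nrm f"])
  fix F p assume F: "\<And>n. F n \<in> W" "tends F p" "\<And>w. w \<in> W \<Longrightarrow> ip p w = ip f w"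
  have pV: "p \<in> V" using F by (simp add: tends_def)
  have "nrm (\<lambda>x. p x - f x) = 0"
    using F(3) WV f pV by (intro orth diff_closed) (auto simp: ip_diff subset_eq)
  moreover have "nrm (\<lambda>x. F n x - f x) \<le> nrm (\<lambda>x. F n x - p x) + nrm (\<lambda>x. p x - f x)" for n
    using F WV f pV by (intro nrm_triangle) auto
  ultimately have "norm (nrm (\<lambda>x. F n x - f x)) \<le> norm (nrm (\<lambda>x. F n x - p x)) * 1" for n
    using nrm_nonneg[OF diff_closed[OF subsetD[OF WV F(1)[of n]] f]] by simp (meson abs_ge_self order_trans)
  then have "(\<lambda>n. nrm (\<lambda>x. F n x - f x)) \<longlonglongrightarrow> 0"
    using F(2) unfolding tends_def by (blast intro: tendsto_0_le always_eventually)
  then show thesis using that[of F] F f by (simp add: tends_def)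
next
  show "ip f (\<lambda>x. a * g x + b * h x) = cnj a * ip f g + cnj b * ip f h" if "g \<in> W" "h \<in> W" for g h a b
    using that WV f by (intro ip_lin2) auto
  show "cmod (ip f w) \<le> nrm f * nrm w" if "w \<in> W" for w
    using that WV f by (intro Cauchy_Schwarz) auto
qed (use WV ne Wlin in auto)

end

section \<open>Completeness of \<open>L\<^sup>2\<close>\<close>

lemma borel_measurable_cnj [measurable (raw)]:
  "f \<in> borel_measurable M \<Longrightarrow> (\<lambda>x. cnj (f x)) \<in> borel_measurable M"
  by (rule measurable_compose[OF _ borel_measurable_continuous_onI]) (auto intro: continuous_intros)

lemma L2_measurable [measurable_dest]: "f \<in> L2 M \<Longrightarrow> f \<in> borel_measurable M"
  by (simp add: L2_def)

lemma L2_integrable: "f \<in> L2 M \<Longrightarrow> integrable M (\<lambda>x. (cmod (f x))\<^sup>2)"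
  by (simp add: L2_def)

lemma integrable_L2_mult:
  assumes "f \<in> L2 M" "g \<in> L2 M"
  shows "integrable M (\<lambda>x. f x * g x)"
proof (rule Bochner_Integration.integrable_bound)
  show "integrable M (\<lambda>x. (cmod (f x))\<^sup>2 + (cmod (g x))\<^sup>2)"
    using assms by (simp add: L2_def)
  show "(\<lambda>x. f x * g x) \<in> borel_measurable M"
    using assms by (auto simp: L2_def)
  have "cmod a * cmod b \<le> (cmod a)\<^sup>2 + (cmod b)\<^sup>2" for a b
    using sum_squares_bound[of "cmod a" "cmod b"]
      mult_nonneg_nonneg[OF norm_ge_zero[of a] norm_ge_zero[of b]] by linarith
  then show "AE x in M. norm (f x * g x) \<le> norm ((cmod (f x))\<^sup>2 + (cmod (g x))\<^sup>2)"
    by (simp add: norm_mult)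
qed

lemma L2_cnj: "f \<in> L2 M \<Longrightarrow> (\<lambda>x. cnj (f x)) \<in> L2 M"
  by (auto simp: L2_def)

lemma integrable_L2_inner:
  "f \<in> L2 M \<Longrightarrow> g \<in> L2 M \<Longrightarrow> integrable M (\<lambda>x. f x * cnj (g x))"
  by (intro integrable_L2_mult L2_cnj)

lemma L2_lin:
  assumes "f \<in> L2 M" "g \<in> L2 M"
  shows "(\<lambda>x. a * f x + b * g x) \<in> L2 M"
proof -
  have m: "(\<lambda>x. a * f x + b * g x) \<in> borel_measurable M"
    using assms by (auto simp: L2_def)
  have "integrable M (\<lambda>x. (cmod (a * f x + b * g x))\<^sup>2)"
  proof (rule Bochner_Integration.integrable_bound)
    show "integrable M (\<lambda>x. 2 * (cmod a)\<^sup>2 * (cmod (f x))\<^sup>2 + 2 * (cmod b)\<^sup>2 * (cmod (g x))\<^sup>2)"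
      using assms by (simp add: L2_def)
    show "(\<lambda>x. (cmod (a * f x + b * g x))\<^sup>2) \<in> borel_measurable M"
      using m by measurable
    have "(cmod (u + v))\<^sup>2 \<le> 2 * (cmod u)\<^sup>2 + 2 * (cmod v)\<^sup>2" for u v :: complex
    proof -
      have "(cmod (u + v))\<^sup>2 \<le> (cmod u + cmod v)\<^sup>2"
        by (simp add: norm_triangle_ineq power_mono)
      then show ?thesis
        using sum_squares_bound[of "cmod u" "cmod v"] by (simp add: power2_sum)
    qed
    from this[of "a * f x" "b * g x" for x]
    show "AE x in M. norm ((cmod (a * f x + b * g x))\<^sup>2)
        \<le> norm (2 * (cmod a)\<^sup>2 * (cmod (f x))\<^sup>2 + 2 * (cmod b)\<^sup>2 * (cmod (g x))\<^sup>2)"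
      by (intro AE_I2) (simp add: norm_mult power_mult_distrib mult.assoc)
  qed
  with m show ?thesis by (simp add: L2_def)
qed

lemma L2_zero: "(\<lambda>x. 0) \<in> L2 M"
  by (simp add: L2_def)

lemma L2_inner_self: "L2_inner M f f = complex_of_real ((L2_norm M f)\<^sup>2)"
  by (simp add: L2_inner_def L2_norm_def complex_mult_cnj cmod_power2 flip: of_real_power of_real_add)

interpretation L2: semi_inner "L2 M" "L2_inner M" for M :: "'x measure"
proof
  fix f g h :: "'x \<Rightarrow> complex" and a b
  show "f \<in> L2 M \<Longrightarrow> g \<in> L2 M \<Longrightarrow> (\<lambda>x. a * f x + b * g x) \<in> L2 M"
    by (rule L2_lin)
  show "L2_inner M (\<lambda>x. a * f x + b * g x) h = a * L2_inner M f h + b * L2_inner M g h"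
    if "f \<in> L2 M" "g \<in> L2 M" "h \<in> L2 M"
    using integrable_L2_inner[OF that(1,3)] integrable_L2_inner[OF that(2,3)]
    by (simp add: L2_inner_def ring_distribs mult.assoc)
  show "L2_inner M g f = cnj (L2_inner M f g)"
    by (simp add: L2_inner_def mult.commute flip: Bochner_Integration.integral_cnj)
  show "0 \<le> Re (L2_inner M f f)"
    by (simp add: L2_inner_self)
qed

lemma L2_norm_nonneg [simp]: "0 \<le> L2_norm M f"
  by (simp add: L2_norm_def)

lemma L2_nrm_eq: "L2.nrm M f = L2_norm M f"
  by (simp add: L2.nrm_def L2_inner_self)

lemma L2_norm_sq: "(L2_norm M f)\<^sup>2 = (LINT x|M. (cmod (f x))\<^sup>2)"
  by (simp add: L2_norm_def)

lemma L2_norm_zero_iff: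
  assumes "f \<in> L2 M"
  shows "L2_norm M f = 0 \<longleftrightarrow> (AE x in M. f x = 0)"
  using assms integral_nonneg_eq_0_iff_AE[of M "\<lambda>x. (cmod (f x))\<^sup>2"]
  by (simp add: L2_norm_def L2_integrable)

lemma L2_norm_cong_L2:
  assumes "f \<in> L2 M" "f' \<in> L2 M" "AE x in M. f x = f' x"
  shows "L2_norm M f = L2_norm M f'"
  unfolding L2_norm_def using assms
  by (auto simp: L2_def intro!: arg_cong[of _ _ sqrt] integral_cong_AE)

lemma L2_inner_cong_L2:
  assumes "f \<in> L2 M" "g \<in> L2 M" "f' \<in> L2 M" "g' \<in> L2 M" "AE x in M. f x = f' x" "AE x in M. g x = g' x"
  shows "L2_inner M f g = L2_inner M f' g'"
  unfolding L2_inner_def using assms by (intro integral_cong_AE) (auto simp: L2_def)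

lemma L2_cong_AE:
  assumes "f \<in> L2 M" "AE x in M. f x = g x" "g \<in> borel_measurable M"
  shows "g \<in> L2 M"
proof -
  have "integrable M (\<lambda>x. (cmod (g x))\<^sup>2)"
    using assms by (subst integrable_cong_AE[of _ _ "\<lambda>x. (cmod (f x))\<^sup>2"]) (auto simp: L2_def)
  with assms show ?thesis by (simp add: L2_def)
qed

text \<open>The pointwise half of the Riesz-Fischer theorem: geometric decay of the increments in
  norm gives geometric decay at almost every point, with a constant depending on the point.\<close>

lemma L2_complete_aux:
  assumes F: "\<And>n. F n \<in> L2 M" and s: "\<And>n. L2_norm M (\<lambda>x. F (Suc n) x - F n x) \<le> (1/3)^n"
  shows "AE x in M. convergent (\<lambda>n. F n x)"
proof -
  have [measurable]: "F n \<in> borel_measurable M" for n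
    using F by (simp add: L2_def)
  \<comment> \<open>The weight 4^n is small enough for the integrals, at most (4/9)^n, to be
    summable, and large enough for a finite sum at x to force increments of order (1/2)^n
    there.\<close>
  define G where "G n x = 4^n * (cmod (F (Suc n) x - F n x))\<^sup>2" for n x
  have [measurable]: "G n \<in> borel_measurable M" for n by (simp add: G_def[abs_def])
  have "(\<integral>\<^sup>+x. ennreal (G n x) \<partial>M) \<le> ennreal ((4/9)^n)" for n
  proof -
    have i: "integrable M (\<lambda>x. (cmod (F (Suc n) x - F n x))\<^sup>2)"
      using L2.diff_closed[OF F[of "Suc n"] F[of n]] by (rule L2_integrable)
    have "(\<integral>\<^sup>+x. ennreal (G n x) \<partial>M) = ennreal (LINT x|M. G n x)"
      unfolding G_def using i by (intro nn_integral_eq_integral) auto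
    also have "(LINT x|M. G n x) = 4^n * (L2_norm M (\<lambda>x. F (Suc n) x - F n x))\<^sup>2"
      by (simp add: G_def L2_norm_sq)
    also have "\<dots> \<le> 4^n * ((1/3)^n)\<^sup>2"
      using s[of n] by (intro mult_left_mono power_mono) auto
    also have "\<dots> = (4/9)^n"
      by (simp add: power2_eq_square flip: power_mult_distrib)
    finally show ?thesis by (simp add: ennreal_leI)
  qed
  then have "(\<integral>\<^sup>+x. (\<Sum>n. ennreal (G n x)) \<partial>M) \<le> (\<Sum>n. ennreal ((4/9)^n))"
    by (subst nn_integral_suminf) (auto intro!: suminf_le)
  also have "\<dots> < \<infinity>"
    using geometric_sums[of "4/9 :: real"] by (subst suminf_ennreal_eq[of _ "9/5"]) auto
  finally have "(\<integral>\<^sup>+x. (\<Sum>n. ennreal (G n x)) \<partial>M) \<noteq> \<infinity>" by simp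
  then have "AE x in M. (\<Sum>n. ennreal (G n x)) \<noteq> \<infinity>"
    by (intro nn_integral_PInf_AE) auto
  then show ?thesis
  proof eventually_elim
    case (elim x)
    define C where "C = enn2real (\<Sum>n. ennreal (G n x))"
    have GC: "G n x \<le> C" for n
    proof -
      have "ennreal (G n x) \<le> (\<Sum>n. ennreal (G n x))"
        using sum_le_suminf[of "\<lambda>n. ennreal (G n x)" "{n}"] by simp
      also have "\<dots> = ennreal C" unfolding C_def using elim by (simp add: less_top)
      finally show ?thesis
        by (subst (asm) ennreal_le_iff) (simp_all add: C_def)
    qed
    have nb: "norm (F (Suc n) x - F n x) \<le> sqrt C * (1/2)^n" for n
    proof -
      have "(2^n * cmod (F (Suc n) x - F n x))\<^sup>2 \<le> C"
        using GC[of n] by (simp add: G_def power_mult_distrib power2_eq_square[of "2^n"] flip: power_mult_distrib[of 2 2])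
      then have "2^n * cmod (F (Suc n) x - F n x) \<le> sqrt C"
        by (rule real_le_rsqrt)
      then show ?thesis by (simp add: field_simps)
    qed
    have "summable (\<lambda>n. sqrt C * (1/2)^n)"
      by (intro summable_mult summable_geometric) simp
    from summable_comparison_test'[OF this nb] have "summable (\<lambda>n. F (Suc n) x - F n x)" .
    then obtain L where "(\<lambda>n. \<Sum>i<n. F (Suc i) x - F i x) \<longlonglongrightarrow> L"
      by (auto simp: summable_def sums_def)
    then have "(\<lambda>n. F n x - F 0 x) \<longlonglongrightarrow> L"
      by (simp only: sum_lessThan_telescope[of "\<lambda>n. F n x"])
    from tendsto_add[OF this tendsto_const[of "F 0 x"]]
    show ?case by (auto simp: convergent_def)
  qed
qed

lemma L2_complete:
  assumes "L2.cauchy M F"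
  shows "\<exists>f. L2.tends M F f"
proof -
  have FL: "F n \<in> L2 M" for n using assms by (simp add: L2.cauchy_def)
  have "\<exists>N. \<forall>m\<ge>N. \<forall>n\<ge>N. L2_norm M (\<lambda>x. F m x - F n x) < (1/3)^k" for k :: nat
    using assms by (simp add: L2.cauchy_def L2_nrm_eq)
  then obtain N where N: "\<And>k m n. m \<ge> N k \<Longrightarrow> n \<ge> N k \<Longrightarrow> L2_norm M (\<lambda>x. F m x - F n x) < (1/3)^k"
    by metis
  \<comment> \<open>Partial sums make the indices monotone in k while keeping them above every
    \<open>N j\<close> with j \<le> k.\<close>
  define r where "r k = (\<Sum>i\<le>k. N i)" for k
  have rS: "r k \<le> r (Suc k)" for k
    by (simp add: r_def)
  have rN: "N j \<le> r k" if "j \<le> k" for j k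
    unfolding r_def using that by (intro member_le_sum) auto
  have [measurable]: "F n \<in> borel_measurable M" for n
    using FL by (simp add: L2_def)
  have conv: "AE x in M. convergent (\<lambda>k. F (r k) x)"
  proof (rule L2_complete_aux)
    show "F (r k) \<in> L2 M" for k by (rule FL)
    show "L2_norm M (\<lambda>x. F (r (Suc k)) x - F (r k) x) \<le> (1/3)^k" for k
      using N[of k "r (Suc k)" "r k"] rN[of k k] rS[of k] by simp
  qed
  define f where "f x = lim (\<lambda>k. F (r k) x)" for x
  have [measurable]: "f \<in> borel_measurable M"
    unfolding f_def[abs_def] by (rule borel_measurable_lim_metric) simp
  have lim: "AE x in M. (\<lambda>k. F (r k) x) \<longlonglongrightarrow> f x"
    using conv by eventually_elim (simp add: f_def convergent_LIMSEQ_iff)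
  \<comment> \<open>Fatou's lemma along the subsequence transfers the Cauchy bound to the distance
    from the pointwise limit. It controls every member of the full sequence, so no separate passage
    from the subsequence is needed.\<close>
  have bd: "(\<integral>\<^sup>+x. ennreal ((cmod (F m x - f x))\<^sup>2) \<partial>M) \<le> ennreal (((1/3)^j)\<^sup>2)" if m: "m \<ge> N j" for m j
  proof -
    have "(\<integral>\<^sup>+x. ennreal ((cmod (F m x - f x))\<^sup>2) \<partial>M)
        = (\<integral>\<^sup>+x. liminf (\<lambda>k. ennreal ((cmod (F m x - F (r k) x))\<^sup>2)) \<partial>M)"
    proof (rule nn_integral_cong_AE)
      show "AE x in M. ennreal ((cmod (F m x - f x))\<^sup>2)
          = liminf (\<lambda>k. ennreal ((cmod (F m x - F (r k) x))\<^sup>2))"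
        using lim
      proof eventually_elim
        case (elim x)
        have "(\<lambda>k. ennreal ((cmod (F m x - F (r k) x))\<^sup>2)) \<longlonglongrightarrow> ennreal ((cmod (F m x - f x))\<^sup>2)"
          by (intro tendsto_ennrealI tendsto_power tendsto_norm tendsto_diff tendsto_const elim)
        then show ?case
          by (metis lim_imp_Liminf trivial_limit_sequentially)
      qed
    qed
    also have "\<dots> \<le> liminf (\<lambda>k. \<integral>\<^sup>+x. ennreal ((cmod (F m x - F (r k) x))\<^sup>2) \<partial>M)"
      by (rule nn_integral_liminf) measurable
    also have "\<dots> \<le> ennreal (((1/3)^j)\<^sup>2)"
    proof (rule Liminf_le)
      show "\<forall>\<^sub>F k in sequentially. (\<integral>\<^sup>+x. ennreal ((cmod (F m x - F (r k) x))\<^sup>2) \<partial>M)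
          \<le> ennreal (((1/3)^j)\<^sup>2)"
        using eventually_ge_at_top[of j]
      proof eventually_elim
        case (elim k)
        have "(\<integral>\<^sup>+x. ennreal ((cmod (F m x - F (r k) x))\<^sup>2) \<partial>M)
            = ennreal ((L2_norm M (\<lambda>x. F m x - F (r k) x))\<^sup>2)"
          unfolding L2_norm_sq
          by (intro nn_integral_eq_integral L2_integrable L2.diff_closed FL) auto
        also have "\<dots> \<le> ennreal (((1/3)^j)\<^sup>2)"
          using N[OF m rN[OF elim]] by (intro ennreal_leI power_mono) auto
        finally show ?case .
      qed
    qed simp
    finally show ?thesis .
  qed
  have diffL2: "(\<lambda>x. F m x - f x) \<in> L2 M" if "m \<ge> N j" for m j
  proof -
    have "integrable M (\<lambda>x. (cmod (F m x - f x))\<^sup>2)"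
      by (rule integrableI_bounded) (use bd[OF that] in \<open>auto simp: le_less_trans\<close>)
    then show ?thesis by (simp add: L2_def)
  qed
  have fL2: "f \<in> L2 M"
    using L2.diff_closed[OF FL[of "N 0"] diffL2[of 0 "N 0"]] by simp
  have nb: "L2_norm M (\<lambda>x. F m x - f x) \<le> (1/3)^j" if m: "m \<ge> N j" for m j
  proof -
    have "ennreal ((L2_norm M (\<lambda>x. F m x - f x))\<^sup>2) \<le> ennreal (((1/3)^j)\<^sup>2)"
      using bd[OF m] nn_integral_eq_integral[OF L2_integrable[OF diffL2[OF m]]]
      by (simp add: L2_norm_sq)
    then have "(L2_norm M (\<lambda>x. F m x - f x))\<^sup>2 \<le> ((1/3)^j)\<^sup>2"
      by (subst (asm) ennreal_le_iff) auto
    then show ?thesis by (rule power2_le_imp_le) simp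
  qed
  have "(\<lambda>m. L2_norm M (\<lambda>x. F m x - f x)) \<longlonglongrightarrow> 0"
  proof (rule LIMSEQ_I)
    fix e :: real assume "0 < e"
    then obtain j where j: "(1/3::real)^j < e"
      using real_arch_pow_inv[of e "1/3"] by auto
    have "norm (L2_norm M (\<lambda>x. F m x - f x) - 0) < e" if "m \<ge> N j" for m
      using nb[OF that] j by simp
    then show "\<exists>no. \<forall>m\<ge>no. norm (L2_norm M (\<lambda>x. F m x - f x) - 0) < e" by blast
  qed
  then show ?thesis
    using FL fL2 by (auto simp: L2.tends_def L2_nrm_eq)
qed

interpretation L2: semi_hilbert "L2 M" "L2_inner M" for M :: "'x measure"
  by unfold_locales (rule L2_complete)

section \<open>Test functions\<close>

lemma partial_eq: "(f has_derivative f') (at x) \<Longrightarrow> partial i f x = f' (axis i 1)"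
  unfolding partial_def using frechet_derivative_at by metis

lemma partial_has_vector_derivative:
  assumes "f differentiable (at (x + t *\<^sub>R axis i 1))"
  shows "((\<lambda>s. f (x + s *\<^sub>R axis i 1)) has_vector_derivative partial i f (x + t *\<^sub>R axis i 1)) (at t)"
proof -
  have 1: "(f has_derivative frechet_derivative f (at (x + t *\<^sub>R axis i 1))) (at (x + t *\<^sub>R axis i 1))"
    using assms frechet_derivative_works by blast
  then interpret bounded_linear "frechet_derivative f (at (x + t *\<^sub>R axis i 1))"
    by (rule has_derivative_bounded_linear)
  have "((\<lambda>s. x + s *\<^sub>R axis i 1) has_derivative (\<lambda>s. s *\<^sub>R axis i 1)) (at t)"
    by (auto intro!: derivative_eq_intros)
  from diff_chain_at[OF this 1] show ?thesis
    by (simp add: has_vector_derivative_def partial_def o_def scaleR)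
qed

lemma Ck_continuous: "Ck k f \<Longrightarrow> continuous_on UNIV f"
  by (cases k) (auto simp: continuous_on_eq_continuous_at intro: differentiable_imp_continuous_within)

lemma Ck_SucD: "Ck (Suc k) f \<Longrightarrow> Ck k f"
proof (induction k arbitrary: f)
  case 0
  then show ?case using Ck_continuous by (simp only: Ck.simps(1))
next
  case (Suc k)
  then show ?case by (metis Ck.simps(2))
qed

lemma Ck_const: "Ck k (\<lambda>x. c)"
proof (induction k arbitrary: c)
  case (Suc k)
  have "partial i (\<lambda>x::real^'a. c) = (\<lambda>x. 0)" for i
    by (rule ext, rule trans, rule partial_eq) (auto intro!: derivative_eq_intros)
  with Suc show ?case by simp
qed simp

lemma partial_lin:
  assumes "f differentiable (at x)" "g differentiable (at x)"
  shows "partial i (\<lambda>x. a * f x + b * g x) x = a * partial i f x + b * partial i g x"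
  unfolding partial_def[of i f] partial_def[of i g] using assms
  by (intro partial_eq) (auto intro!: derivative_eq_intros simp: frechet_derivative_works[symmetric])

lemma partial_mult:
  assumes "f differentiable (at x)" "g differentiable (at x)"
  shows "partial i (\<lambda>x. f x * g x) x = f x * partial i g x + partial i f x * g x"
  unfolding partial_def[of i f] partial_def[of i g] using assms
  by (intro partial_eq has_derivative_mult) (auto simp: frechet_derivative_works[symmetric])

lemma Ck_lin: "Ck k f \<Longrightarrow> Ck k g \<Longrightarrow> Ck k (\<lambda>x. a * f x + b * g x)"
proof (induction k arbitrary: f g a b)
  case 0
  then show ?case by (auto intro!: continuous_intros)
next
  case (Suc k)
  then have "partial i (\<lambda>x. a * f x + b * g x) = (\<lambda>x. a * partial i f x + b * partial i g x)" for i
    by (auto simp: partial_lin)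
  with Suc show ?case by (auto intro!: derivative_intros)
qed

lemma Ck_mult: "Ck k f \<Longrightarrow> Ck k g \<Longrightarrow> Ck k (\<lambda>x. f x * g x)"
proof (induction k arbitrary: f g)
  case 0
  then show ?case by (auto intro!: continuous_intros)
next
  case (Suc k)
  have "partial i (\<lambda>x. f x * g x) = (\<lambda>x. 1 * (f x * partial i g x) + 1 * (partial i f x * g x))" for i
    using Suc.prems by (auto simp: partial_mult)
  moreover have "Ck k (\<lambda>x. 1 * (f x * partial i g x) + 1 * (partial i f x * g x))" for i
    using Suc.prems by (intro Ck_lin Suc.IH Ck_SucD[of k f] Ck_SucD[of k g]) auto
  ultimately show ?case using Suc.prems by (auto intro!: derivative_intros)
qed

lemma Ck_prod: "finite I \<Longrightarrow> (\<And>i. i \<in> I \<Longrightarrow> Ck k (f i)) \<Longrightarrow> Ck k (\<lambda>x. \<Prod>i\<in>I. f i x)"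
  by (induction I rule: finite_induct) (auto intro: Ck_const Ck_mult)

lemma Ck_cnj: "Ck k f \<Longrightarrow> Ck k (\<lambda>x. cnj (f x))"
proof (induction k arbitrary: f)
  case 0
  then show ?case by (auto intro!: continuous_intros)
next
  case (Suc k)
  have d: "((\<lambda>x. cnj (f x)) has_derivative (\<lambda>h. cnj (frechet_derivative f (at x) h))) (at x)" for x
    using Suc.prems by (intro has_derivative_cnj) (auto simp: frechet_derivative_works[symmetric])
  then have "partial i (\<lambda>x. cnj (f x)) = (\<lambda>x. cnj (partial i f x))" for i
    using partial_eq[OF d] by (auto simp: partial_def)
  with Suc d show ?case by (auto simp: differentiable_def)
qed

lemma partial_cnj:
  assumes "f differentiable (at x)"
  shows "partial i (\<lambda>x. cnj (f x)) x = cnj (partial i f x)"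
  unfolding partial_def[of i f] using assms
  by (intro partial_eq has_derivative_cnj) (auto simp: frechet_derivative_works[symmetric])

lemma shift_has_derivative:
  fixes f :: "real ^ 'd::finite \<Rightarrow> complex"
  assumes "f differentiable (at (x + h))"
  shows "((\<lambda>x. f (x + h)) has_derivative frechet_derivative f (at (x + h))) (at x)"
proof -
  have "((\<lambda>x. x + h) has_derivative (\<lambda>x. x)) (at x)"
    by (auto intro!: derivative_eq_intros)
  from diff_chain_at[OF this] assms show ?thesis
    by (simp add: o_def frechet_derivative_works)
qed

lemma partial_shift:
  assumes "f differentiable (at (x + h))"
  shows "partial i (\<lambda>x. f (x + h)) x = partial i f (x + h)"
  using partial_eq[OF shift_has_derivative[OF assms]] by (simp add: partial_def)

lemma Ck_shift: "Ck k f \<Longrightarrow> Ck k (\<lambda>x. f (x + h))"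
proof (induction k arbitrary: f)
  case 0
  then show ?case by (auto intro!: continuous_intros continuous_on_compose2[of UNIV f])
next
  case (Suc k)
  then have "partial i (\<lambda>x. f (x + h)) = (\<lambda>x. partial i f (x + h))" for i
    by (auto simp: partial_shift)
  with Suc show ?case using shift_has_derivative differentiable_def by fastforce
qed

text \<open>\<open>G\<close> lists a function together with all its derivatives. Each partial
  derivative of \<open>G j\<close> composed with q is \<open>G (Suc j)\<close> composed with q times
  a smooth factor, so the induction on k runs for all j at once.\<close>

lemma Ck_of_real_compose:
  fixes q :: "real ^ 'd::finite \<Rightarrow> real"
  assumes G: "\<And>j t. (G j has_real_derivative G (Suc j) t) (at t)"
    and q: "\<And>x. (q has_derivative q' x) (at x)"
    and qC: "\<And>k i. Ck k (\<lambda>x. complex_of_real (q' x (axis i 1)))"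
  shows "Ck k (\<lambda>x. complex_of_real (G j (q x)))"
proof (induction k arbitrary: j)
  have d: "((\<lambda>x. complex_of_real (G j (q x))) has_derivative
      (\<lambda>h. complex_of_real (G (Suc j) (q x) * q' x h))) (at x)" for j x
  proof -
    have "(G j has_derivative (*) (G (Suc j) (q x))) (at (q x))"
      using G by (simp add: has_field_derivative_def)
    from diff_chain_at[OF q this] show ?thesis
      by (intro has_derivative_of_real) (simp add: o_def)
  qed
  {
    case 0
    show ?case
      unfolding Ck.simps by (intro continuous_at_imp_continuous_on ballI has_derivative_continuous[OF d])
  next
    case (Suc k)
    have "partial i (\<lambda>x. complex_of_real (G j (q x))) =
        (\<lambda>x. complex_of_real (G (Suc j) (q x)) * complex_of_real (q' x (axis i 1)))" for i
      using partial_eq[OF d] by auto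
    then show ?case
      using d[of j] Suc qC by (auto simp: differentiable_def intro!: Ck_mult)
  }
qed

text \<open>Functions p(1/t) exp(-1/t), extended by 0 to t \<le> 0, form a class closed under
  differentiation: the derivative replaces p(s) by s^2 (p(s) - p'(s)). Hence exp(-1/t) is smooth,
  including at 0.\<close>

definition bump :: "real poly \<Rightarrow> real \<Rightarrow> real" where
  "bump p t = (if t > 0 then poly p (1 / t) * exp (- (1 / t)) else 0)"

lemma poly_times_exp_tendsto_0: "((\<lambda>s. poly p s * exp (- s)) \<longlongrightarrow> (0::real)) at_top"
proof -
  have "((\<lambda>s. \<Sum>i\<le>degree p. coeff p i * (s ^ i / exp s)) \<longlongrightarrow> (\<Sum>i\<le>degree p. coeff p i * 0)) at_top"
    by (intro tendsto_intros tendsto_power_div_exp_0)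
  then show ?thesis
    by (simp add: poly_altdef sum_distrib_right exp_minus divide_inverse mult.assoc)
qed

lemma bump_has_derivative:
  "(bump p has_real_derivative bump ([:0, 0, 1:] * (p - pderiv p)) t) (at t)"
proof -
  consider "t > 0" | "t < 0" | "t = 0" by linarith
  then show ?thesis
  proof cases
    case 1
    have "((\<lambda>t. poly p (1 / t) * exp (- (1 / t))) has_real_derivative
        bump ([:0, 0, 1:] * (p - pderiv p)) t) (at t)"
      using 1 by (auto intro!: derivative_eq_intros poly_DERIV[THEN DERIV_chain2]
        simp: bump_def field_simps power2_eq_square)
    then show ?thesis
      by (rule has_field_derivative_transform_within_open[of _ _ _ "{0<..}"]) (use 1 in \<open>auto simp: bump_def\<close>)
  next
    case 2
    have "((\<lambda>t. 0) has_real_derivative bump ([:0, 0, 1:] * (p - pderiv p)) t) (at t)"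
      using 2 by (auto simp: bump_def)
    then show ?thesis
      by (rule has_field_derivative_transform_within_open[of _ _ _ "{..<0}"]) (use 2 in \<open>auto simp: bump_def\<close>)
  next
    case 3
    have "((\<lambda>h. bump p h / h) \<longlongrightarrow> 0) (at_right 0)"
    proof (rule Lim_transform_eventually)
      \<comment> \<open>With s = 1/h the difference quotient at 0 is s p(s) exp(-s), and the
        exponential beats the polynomial.\<close>
      have "filterlim (\<lambda>h::real. inverse h) at_top (at_right 0)"
        by (rule filterlim_inverse_at_top_right)
      from filterlim_compose[OF poly_times_exp_tendsto_0[of "[:0,1:] * p"] this]
      show "((\<lambda>h. poly ([:0, 1:] * p) (inverse h) * exp (- inverse h)) \<longlongrightarrow> 0) (at_right 0)" .
      show "\<forall>\<^sub>F h in at_right 0. poly ([:0, 1:] * p) (inverse h) * exp (- inverse h) = bump p h / h"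
        by (auto simp: eventually_at_right_less bump_def divide_inverse eventually_at intro!: exI[of _ 1])
    qed
    moreover have "((\<lambda>h. bump p h / h) \<longlongrightarrow> 0) (at_left 0)"
      by (rule Lim_transform_eventually[of "\<lambda>_. 0"])
        (auto simp: bump_def eventually_at intro!: exI[of _ 1])
    ultimately have "((\<lambda>h. bump p h / h) \<longlongrightarrow> 0) (at 0)"
      using filterlim_split_at by blast
    then show ?thesis
      using 3 by (simp add: DERIV_def bump_def)
  qed
qed

lemma bump_sequence:
  obtains G :: "nat \<Rightarrow> real \<Rightarrow> real" where
    "\<And>j t. (G j has_real_derivative G (Suc j) t) (at t)"
    "G 0 = (\<lambda>t. if t > 0 then exp (- (1 / t)) else 0)"
proof
  define P where "P j = ((\<lambda>p :: real poly. [:0, 0, 1:] * (p - pderiv p)) ^^ j) 1" for j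
  show "(bump (P j) has_real_derivative bump (P (Suc j)) t) (at t)" for j t
    using bump_has_derivative[of "P j" t] by (simp add: P_def)
  show "bump (P 0) = (\<lambda>t. if t > 0 then exp (- (1 / t)) else 0)"
    by (auto simp: P_def bump_def)
qed

section \<open>Closure properties of the space of test functions\<close>

lemma test_functionsI:
  assumes "\<And>k. Ck k f" "\<And>x. f x \<noteq> 0 \<Longrightarrow> norm x \<le> r"
  shows "f \<in> test_functions"
proof -
  have "closure {x. f x \<noteq> 0} \<subseteq> cball 0 r"
    using assms(2) by (intro closure_minimal) auto
  then have "compact (closure {x. f x \<noteq> 0})"
    using bounded_cball bounded_subset closed_closure compact_eq_bounded_closed by blast
  with assms(1) show ?thesis by (simp add: test_functions_def)
qed

lemma test_support:
  assumes "f \<in> test_functions"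
  obtains r where "r > 0" "\<And>x. norm x \<ge> r \<Longrightarrow> f x = 0"
proof -
  have "bounded {x. f x \<noteq> 0}"
    using assms unfolding test_functions_def
    by (auto intro: bounded_subset[OF compact_imp_bounded closure_subset])
  then obtain r where r: "\<And>x. f x \<noteq> 0 \<Longrightarrow> norm x \<le> r" by (auto simp: bounded_iff)
  show thesis by (rule that[of "\<bar>r\<bar> + 1"]) (use r in force)+
qed

lemma test_Ck: "f \<in> test_functions \<Longrightarrow> Ck k f"
  by (simp add: test_functions_def)

lemma test_differentiable: "f \<in> test_functions \<Longrightarrow> f differentiable (at x)"
  using test_Ck[of f 1] by simp

lemma test_zero: "(\<lambda>x. 0) \<in> test_functions"
  by (rule test_functionsI[where r = 0]) (auto intro: Ck_const)

lemma test_lin: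
  assumes "f \<in> test_functions" "g \<in> test_functions"
  shows "(\<lambda>x. a * f x + b * g x) \<in> test_functions"
proof -
  obtain r s where "\<And>x. norm x \<ge> r \<Longrightarrow> f x = 0" "\<And>x. norm x \<ge> s \<Longrightarrow> g x = 0"
    using test_support assms by metis
  then have "norm x \<le> max r s" if "a * f x + b * g x \<noteq> 0" for x
    using that by (metis add_0 linorder_le_cases max.cobounded1 max.cobounded2 mult_zero_right order_trans)
  then show ?thesis
    using assms[THEN test_Ck] by (intro test_functionsI[where r = "max r s"] Ck_lin)
qed

lemma test_mult:
  assumes "f \<in> test_functions" "g \<in> test_functions"
  shows "(\<lambda>x. f x * g x) \<in> test_functions"
proof -
  obtain r where "\<And>x. norm x \<ge> r \<Longrightarrow> f x = 0"
    using test_support assms by metis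
  then have "norm x \<le> r" if "f x * g x \<noteq> 0" for x
    using that by (metis linorder_le_cases mult_zero_left)
  then show ?thesis
    using assms[THEN test_Ck] by (intro test_functionsI[where r = r] Ck_mult)
qed

lemma test_cnj: "f \<in> test_functions \<Longrightarrow> (\<lambda>x. cnj (f x)) \<in> test_functions"
  by (auto simp: test_functions_def Ck_cnj)

lemma test_shift:
  assumes "f \<in> test_functions"
  shows "(\<lambda>x. f (x + h)) \<in> test_functions"
proof -
  obtain r where r: "\<And>x. norm x \<ge> r \<Longrightarrow> f x = 0"
    using test_support assms by metis
  have "norm x \<le> r + norm h" if "f (x + h) \<noteq> 0" for x
  proof -
    have "norm (x + h) < r" using r[of "x + h"] that by force
    then show ?thesis using norm_triangle_ineq4[of "x + h" h] by simp
  qed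
  then show ?thesis
    using assms[THEN test_Ck] by (intro test_functionsI[where r = "r + norm h"] Ck_shift)
qed

lemma test_partial:
  assumes "f \<in> test_functions"
  shows "partial i f \<in> test_functions"
proof -
  obtain r where r: "\<And>x. norm x \<ge> r \<Longrightarrow> f x = 0"
    using test_support assms by metis
  have "partial i f x = 0" if "norm x > r" for x
  proof -
    have "((\<lambda>x. 0) has_derivative (\<lambda>h. 0)) (at x)" by simp
    then have "(f has_derivative (\<lambda>h. 0)) (at x)"
      by (rule has_derivative_transform_within_open[of _ _ _ _ "- cball 0 r"])
        (use that r in \<open>auto simp: closed_def[symmetric]\<close>)
    then show ?thesis by (rule partial_eq)
  qed
  moreover have "Ck k (partial i f)" for k
    using test_Ck[OF assms, of "Suc k"] by simp
  ultimately show ?thesis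
    by (intro test_functionsI[where r = r]) (auto intro: leI)
qed

lemma test_bounded:
  assumes "f \<in> test_functions"
  obtains C where "C \<ge> 0" "\<And>x. norm (f x) \<le> C"
proof -
  obtain r where r: "r > 0" "\<And>x. norm x \<ge> r \<Longrightarrow> f x = 0"
    using test_support assms by metis
  have "compact (f ` cball 0 r)"
    using Ck_continuous[OF test_Ck[OF assms]]
    by (intro compact_continuous_image) (auto intro: continuous_on_subset)
  then have "bounded (f ` cball 0 r)" by (rule compact_imp_bounded)
  then obtain C where "\<forall>y \<in> f ` cball 0 r. norm y \<le> C"
    unfolding bounded_iff by blast
  then have C: "\<And>x. norm x \<le> r \<Longrightarrow> norm (f x) \<le> C"
    by auto
  have "norm (f x) \<le> \<bar>C\<bar>" for x
    using C[of x] r(2)[of x] by (cases "norm x \<le> r") auto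
  then show thesis using that[of "\<bar>C\<bar>"] by simp
qed

lemma test_measurable: "f \<in> test_functions \<Longrightarrow> f \<in> borel_measurable borel"
  using Ck_continuous[OF test_Ck] by (intro borel_measurable_continuous_onI)

lemma test_L2:
  fixes M :: "(real ^ 'd::finite) measure"
  assumes f: "f \<in> test_functions" and M: "radon_measure M"
  shows "f \<in> L2 M"
proof -
  have sM[measurable_cong]: "sets M = sets borel" using M by (simp add: radon_measure_def)
  obtain r where r: "r > 0" "\<And>x. norm x \<ge> r \<Longrightarrow> f x = 0"
    using test_support f by metis
  obtain C where C: "C \<ge> 0" "\<And>x. norm (f x) \<le> C"
    using test_bounded f by metis
  have [measurable]: "f \<in> borel_measurable borel" by (rule test_measurable[OF f])
  have [measurable]: "f \<in> borel_measurable M" by measurable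
  have "integrable M (\<lambda>x. (cmod (f x))\<^sup>2)"
  proof (rule Bochner_Integration.integrable_bound)
    have "emeasure M (cball 0 r) < \<infinity>" using M by (simp add: radon_measure_def)
    then show "integrable M (\<lambda>x. C\<^sup>2 * indicator (cball 0 r) x :: real)"
      by (intro integrable_mult_right integrable_real_indicator) (auto simp: sM)
    show "AE x in M. norm ((cmod (f x))\<^sup>2) \<le> norm (C\<^sup>2 * indicator (cball 0 r) x :: real)"
      using r(2) C by (intro AE_I2) (auto simp: indicator_def intro!: power_mono)
  qed measurable
  then show ?thesis by (simp add: L2_def)
qed

lemma radon_measure_lborel: "radon_measure lborel"
  unfolding radon_measure_def using emeasure_bounded_finite[OF compact_imp_bounded] by auto

lemmas test_L2_lborel = test_L2[OF _ radon_measure_lborel]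

section \<open>Integration by parts and the fundamental lemma\<close>

text \<open>It only approaches 1 at infinity instead of reaching a plateau. This suffices, since
  evaluating it at n t with n growing yields the indicator of t > 0 in the limit.\<close>

definition smooth_step :: "real \<Rightarrow> real" where
  "smooth_step t = (if t > 0 then exp (- (1 / t)) else 0)"

lemma smooth_step_bounds: "0 \<le> smooth_step t" "smooth_step t \<le> 1"
  by (auto simp: smooth_step_def)

lemma Ck_smooth_step: "Ck k (\<lambda>x. complex_of_real (smooth_step (a + b * x $ i)))"
proof -
  obtain G where G: "\<And>j t. (G j has_real_derivative G (Suc j) t) (at t)"
    and G0: "G 0 = (\<lambda>t. if t > 0 then exp (- (1 / t)) else 0)"
    using bump_sequence by blast
  have "Ck k (\<lambda>x. complex_of_real (G 0 (a + b * x $ i)))"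
  proof (rule Ck_of_real_compose[of G "\<lambda>x. a + b * x $ i" "\<lambda>x h. b * h $ i"])
    show "((\<lambda>x. a + b * x $ i) has_derivative (\<lambda>h. b * h $ i)) (at x)" for x
      by (auto intro!: derivative_eq_intros bounded_linear.has_derivative[OF bounded_linear_vec_nth])
  qed (auto simp: Ck_const G)
  then show ?thesis by (simp add: G0 smooth_step_def[abs_def])
qed

text \<open>One factor for each of the two bounding hyperplanes in every coordinate. The profile
  sharpens with n without leaving the open box, so the indicator of the box is a bounded pointwise
  limit of test functions with common bounded support.\<close>

definition box_bump :: "real ^ 'd::finite \<Rightarrow> real ^ 'd \<Rightarrow> nat \<Rightarrow> real ^ 'd \<Rightarrow> real" where
  "box_bump a b n x = (\<Prod>i\<in>UNIV. smooth_step (n * (x $ i - a $ i)) * smooth_step (n * (b $ i - x $ i)))"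

lemma box_bump_support: "x \<notin> box a b \<Longrightarrow> box_bump a b n x = 0"
proof -
  assume "x \<notin> box a b"
  then obtain i where "\<not> (a $ i < x $ i \<and> x $ i < b $ i)" by (auto simp: mem_box_cart)
  then have "smooth_step (n * (x $ i - a $ i)) * smooth_step (n * (b $ i - x $ i)) = 0"
    by (auto simp: smooth_step_def zero_less_mult_iff)
  then show ?thesis unfolding box_bump_def by (intro prod_zero) auto
qed

lemma box_bump_bounds: "0 \<le> box_bump a b n x" "box_bump a b n x \<le> 1"
  unfolding box_bump_def by (auto intro!: prod_nonneg prod_le_1 mult_nonneg_nonneg mult_le_one smooth_step_bounds)

lemma box_bump_tendsto: "(\<lambda>n. box_bump a b n x) \<longlonglongrightarrow> indicator (box a b) x"
proof (cases "x \<in> box a b")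
  case True
  have s: "(\<lambda>n. smooth_step (real n * s)) \<longlonglongrightarrow> 1" if "s > 0" for s
  proof -
    have "(\<lambda>n. exp (- (inverse s * (1 / real n)))) \<longlonglongrightarrow> exp (- (inverse s * 0))"
      by (intro tendsto_intros lim_1_over_n)
    moreover have "\<forall>\<^sub>F n in sequentially. exp (- (inverse s * (1 / real n))) = smooth_step (real n * s)"
      using eventually_gt_at_top[of 0] by eventually_elim (use that in \<open>auto simp: smooth_step_def field_simps\<close>)
    ultimately show ?thesis
      using Lim_transform_eventually by fastforce
  qed
  have "(\<lambda>n. box_bump a b n x) \<longlonglongrightarrow> (\<Prod>i\<in>(UNIV :: 'a set). 1 * 1)"
    unfolding box_bump_def using True by (intro tendsto_prod tendsto_mult s) (auto simp: mem_box_cart)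
  with True show ?thesis by simp
qed (simp add: box_bump_support)

lemma box_bump_test: "(\<lambda>x. complex_of_real (box_bump a b n x)) \<in> test_functions"
proof -
  have *: "(\<lambda>x. complex_of_real (box_bump a b n x)) = (\<lambda>x. \<Prod>i\<in>UNIV.
      complex_of_real (smooth_step (- (n * a $ i) + n * x $ i)) *
      complex_of_real (smooth_step (n * b $ i + (- n) * x $ i)))"
    by (auto simp: box_bump_def algebra_simps)
  obtain r where "\<And>x. x \<in> box a b \<Longrightarrow> norm x \<le> r"
    using bounded_box[of a b] by (auto simp: bounded_iff)
  then have "norm x \<le> r" if "complex_of_real (box_bump a b n x) \<noteq> 0" for x
    using that box_bump_support[of x a b n] by auto
  moreover have "Ck k (\<lambda>x. complex_of_real (box_bump a b n x))" for k
    unfolding * by (intro Ck_prod Ck_mult Ck_smooth_step) auto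
  ultimately show ?thesis by (intro test_functionsI[where r = r]) auto
qed

lemma indicator_L2: "A \<in> sets M \<Longrightarrow> emeasure M A < \<infinity> \<Longrightarrow> (\<lambda>x. complex_of_real (indicator A x)) \<in> L2 M"
proof -
  assume A: "A \<in> sets M" "emeasure M A < \<infinity>"
  have "(\<lambda>x. (cmod (complex_of_real (indicator A x)))\<^sup>2) = indicat_real A"
    by (auto simp: indicator_def)
  with A show ?thesis by (simp add: L2_def)
qed

lemma L2_locally_integrable:
  assumes "v \<in> L2 lborel" "bounded A" "A \<in> sets borel"
  shows "integrable lborel (\<lambda>x. indicator A x *\<^sub>R v x)"
proof -
  have "(\<lambda>x. complex_of_real (indicator A x)) \<in> L2 lborel"
    using assms emeasure_bounded_finite by (intro indicator_L2) auto
  from integrable_L2_mult[OF this assms(1)] show ?thesis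
    by (simp add: scaleR_conv_of_real)
qed

text \<open>Open boxes are stable under intersection and generate the Borel sets, so the integral
  vanishes over every Borel set. The total integral is a separate assumption because complements
  need it and the whole space is not a box.\<close>

lemma zero_AE_if_box_integrals_zero:
  fixes v :: "real ^ 'd::finite \<Rightarrow> complex"
  assumes int: "integrable lborel v" and tot: "(LINT x|lborel. v x) = 0"
    and box: "\<And>a b. (LINT x:box a b|lborel. v x) = 0"
  shows "AE x in lborel. v x = 0"
proof (rule sigma_finite_measure.density_zero[OF sigma_finite_lborel int])
  have si: "set_integrable lborel S v" if "S \<in> sets borel" for S
    unfolding set_integrable_def using int that by (intro integrable_mult_indicator) auto
  fix A :: "(real ^ 'd) set" assume A: "A \<in> sets lborel"
  have "Int_stable (range (\<lambda>(a, b). box a b :: (real ^ 'd) set))"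
    by (auto simp: Int_stable_def box_Int_box)
  moreover have "range (\<lambda>(a, b). box a b :: (real ^ 'd) set) \<subseteq> Pow UNIV"
    by auto
  moreover have "A \<in> sigma_sets UNIV (range (\<lambda>(a, b). box a b))"
  proof -
    have "A \<in> sets borel" using A by simp
    then show ?thesis unfolding borel_eq_box by simp
  qed
  ultimately show "(LINT x:A|lborel. v x) = 0"
  proof (induction rule: sigma_sets_induct_disjoint)
    case (basic A)
    then show ?case using box by auto
  next
    case empty
    show ?case by (simp add: set_lebesgue_integral_def)
  next
    case (compl A)
    then have A: "A \<in> sets borel" by (simp add: borel_eq_box)
    have "(LINT x:A \<union> (UNIV - A)|lborel. v x) = (LINT x:A|lborel. v x) + (LINT x:UNIV - A|lborel. v x)"
      using A by (intro set_integral_Un si) auto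
    then show ?case
      using compl tot by (simp add: set_lebesgue_integral_def)
  next
    case (union A)
    then have A: "A i \<in> sets borel" for i by (auto simp: borel_eq_box)
    have "(LINT x:(\<Union>i. A i)|lborel. v x) = (\<Sum>i. (LINT x:A i|lborel. v x))"
      using A union(1) by (intro lebesgue_integral_countable_add si) (auto simp: disjoint_family_on_def)
    then show ?case using union by simp
  qed
qed

text \<open>Dominated convergence along \<open>box_bump\<close> turns orthogonality to test
  functions into vanishing integrals over boxes.\<close>

lemma zero_AE_if_orthogonal_to_test:
  fixes v :: "real ^ 'd::finite \<Rightarrow> complex"
  assumes v: "v \<in> L2 lborel"
    and orth: "\<And>\<phi>. \<phi> \<in> test_functions \<Longrightarrow> (LINT x|lborel. v x * \<phi> x) = 0"
  shows "AE x in lborel. v x = 0"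
proof -
  have [measurable]: "v \<in> borel_measurable borel" using v by (simp add: L2_def)
  have [measurable]: "box a b \<in> sets borel" for a b :: "real ^ 'd" by simp
  have box: "(LINT x:box a b|lborel. v x) = 0" for a b
  proof -
    have i: "integrable lborel (\<lambda>x. indicator (box a b) x *\<^sub>R v x)"
      by (intro L2_locally_integrable v bounded_box) auto
    have "(\<lambda>n. LINT x|lborel. v x * complex_of_real (box_bump a b n x)) \<longlonglongrightarrow> (LINT x:box a b|lborel. v x)"
      unfolding set_lebesgue_integral_def
    proof (rule integral_dominated_convergence)
      show "integrable lborel (\<lambda>x. norm (indicator (box a b) x *\<^sub>R v x))"
        using i by (rule integrable_norm)
      show "(\<lambda>x. v x * complex_of_real (box_bump a b n x)) \<in> borel_measurable lborel" for n
        using test_measurable[OF box_bump_test[of a b n]] by measurable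
      have "(\<lambda>n. v x * complex_of_real (box_bump a b n x)) \<longlonglongrightarrow> v x * complex_of_real (indicator (box a b) x)" for x
        by (intro tendsto_mult tendsto_const tendsto_of_real box_bump_tendsto)
      then show "AE x in lborel. (\<lambda>n. v x * complex_of_real (box_bump a b n x)) \<longlonglongrightarrow> indicator (box a b) x *\<^sub>R v x"
        by (simp add: scaleR_conv_of_real mult.commute)
      show "AE x in lborel. norm (v x * complex_of_real (box_bump a b n x)) \<le> norm (indicator (box a b) x *\<^sub>R v x)" for n
      proof (rule AE_I2)
        fix x
        show "norm (v x * complex_of_real (box_bump a b n x)) \<le> norm (indicator (box a b) x *\<^sub>R v x)"
          using box_bump_bounds[of a b n x] box_bump_support[of x a b n]
          by (cases "x \<in> box a b") (auto simp: norm_mult mult_left_le)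
      qed
    qed measurable
    then show ?thesis
      using orth[OF box_bump_test] by (simp add: LIMSEQ_const_iff)
  qed
  \<comment> \<open>An \<open>L2\<close> function need not be integrable, so v is cut off to growing
    cubes. A box intersected with a cube is a box, hence the cut-off function also has vanishing box
    integrals.\<close>
  let ?K = "\<lambda>k::nat. box (\<chi> i. - real k) (\<chi> i. real k) :: (real ^ 'd) set"
  have "AE x in lborel. indicator (?K k) x *\<^sub>R v x = 0" for k
  proof (rule zero_AE_if_box_integrals_zero)
    show "integrable lborel (\<lambda>x. indicator (?K k) x *\<^sub>R v x)"
      by (intro L2_locally_integrable v bounded_box) auto
    show "(LINT x|lborel. indicator (?K k) x *\<^sub>R v x) = 0"
      using box by (simp add: set_lebesgue_integral_def)
    show "(LINT x:box a b|lborel. indicator (?K k) x *\<^sub>R v x) = 0" for a b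
    proof -
      obtain a' b' where "box a b \<inter> ?K k = box a' b'"
        unfolding box_Int_box by blast
      then show ?thesis
        using box[of a' b'] by (simp add: set_lebesgue_integral_def indicator_inter_arith[symmetric])
    qed
  qed
  then have "AE x in lborel. \<forall>k. indicator (?K k) x *\<^sub>R v x = 0"
    unfolding AE_all_countable by blast
  then show ?thesis
  proof eventually_elim
    case (elim x)
    obtain k :: nat where "norm x < real k" using reals_Archimedean2 by blast
    then have "\<bar>x $ i\<bar> < real k" for i
      using component_le_norm_cart[of x i] by linarith
    then have "x \<in> ?K k" by (auto simp: mem_box_cart abs_less_iff) (smt (verit))
    with elim[rule_format, of k] show ?case by simp
  qed
qed

section \<open>Correlations with test functions and their derivatives\<close>

lemma test_diff_bound:
  assumes "f \<in> test_functions"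
  obtains C where "C \<ge> 0" "\<And>x t. norm (f (x + t *\<^sub>R axis i 1) - f x) \<le> C * \<bar>t\<bar>"
proof -
  obtain C where C: "C \<ge> 0" "\<And>x. norm (partial i f x) \<le> C"
    using test_bounded[OF test_partial[OF assms]] by metis
  have "norm (f (x + t *\<^sub>R axis i 1) - f (x + 0 *\<^sub>R axis i 1)) \<le> C * norm (t - 0)" for x and t :: real
  proof (rule differentiable_bound[where S = UNIV and f = "\<lambda>t. f (x + t *\<^sub>R axis i 1)"
        and f' = "\<lambda>t s. s *\<^sub>R partial i f (x + t *\<^sub>R axis i 1)"])
    show "((\<lambda>t. f (x + t *\<^sub>R axis i 1)) has_derivative (\<lambda>s. s *\<^sub>R partial i f (x + t *\<^sub>R axis i 1))) (at t)" for t
      using partial_has_vector_derivative[OF test_differentiable[OF assms]]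
      by (simp add: has_vector_derivative_def)
    show "onorm (\<lambda>s. s *\<^sub>R partial i f (x + t *\<^sub>R axis i 1)) \<le> C" for t
      using C by (intro onorm_bound) (auto simp: mult.commute[of C] intro: mult_left_mono)
  qed auto
  then show thesis using that[OF C(1)] by simp
qed

text \<open>Dominated convergence is a statement about sequences; this brings derivatives of
  integrals into its reach.\<close>

lemma has_vector_derivative_sequentially:
  fixes f :: "real \<Rightarrow> 'a::real_normed_vector"
  assumes "\<And>S. (\<And>n. S n \<noteq> 0) \<Longrightarrow> S \<longlonglongrightarrow> 0 \<Longrightarrow> (\<lambda>n. (f (S n) - f 0) /\<^sub>R S n) \<longlonglongrightarrow> D"
  shows "(f has_vector_derivative D) (at 0)"
proof -
  have "((\<lambda>h. (f h - f 0) /\<^sub>R h) \<longlongrightarrow> D) (at 0)"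
    unfolding LIMSEQ_SEQ_conv[symmetric] using assms by (auto simp: o_def)
  then have "((\<lambda>h. (f h - f 0) /\<^sub>R h - D) \<longlongrightarrow> 0) (at 0)"
    by (rule LIM_zero)
  then have "((\<lambda>h. norm ((f h - f 0) /\<^sub>R h - D)) \<longlongrightarrow> 0) (at 0)"
    by (rule tendsto_norm_zero)
  moreover have "\<forall>\<^sub>F h in at 0. norm ((f h - f 0) /\<^sub>R h - D) = norm (f (0 + h) - f 0 - h *\<^sub>R D) / norm h"
    unfolding eventually_at_filter
  proof (intro always_eventually allI impI)
    fix h :: real assume h: "h \<noteq> 0"
    have "(f h - f 0) /\<^sub>R h - D = (f (0 + h) - f 0 - h *\<^sub>R D) /\<^sub>R h"
      using h by (simp add: scaleR_diff_right)
    then show "norm ((f h - f 0) /\<^sub>R h - D) = norm (f (0 + h) - f 0 - h *\<^sub>R D) / norm h"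
      by (simp add: divide_inverse mult.commute)
  qed
  ultimately have "((\<lambda>h. norm (f (0 + h) - f 0 - h *\<^sub>R D) / norm h) \<longlongrightarrow> 0) (at 0)"
    by (rule Lim_transform_eventually)
  then show ?thesis
    by (simp add: has_vector_derivative_def has_derivative_at bounded_linear_scaleR_left)
qed

text \<open>Wide enough for \<open>L2\<close> functions and also for the constant 1. The constant is
  what makes the integral of a derivative accessible in
  \<open>integral_partial_zero\<close>.\<close>

definition locally_integrable :: "(real ^ 'd::finite \<Rightarrow> complex) \<Rightarrow> bool" where
  "locally_integrable v \<longleftrightarrow> v \<in> borel_measurable borel \<and>
     (\<forall>R. integrable lborel (\<lambda>x. indicator (cball 0 R) x *\<^sub>R v x))"

lemma locally_integrable_L2: "v \<in> L2 lborel \<Longrightarrow> locally_integrable v"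
  unfolding locally_integrable_def using L2_locally_integrable[of v "cball 0 _"] by (auto simp: L2_def)

lemma locally_integrable_const: "locally_integrable (\<lambda>x. c)"
  using emeasure_bounded_finite[of "cball (0 :: real ^ 'a) _"]
  by (auto simp: locally_integrable_def intro!: integrable_scaleR_left integrable_real_indicator)

lemma locally_integrable_bound:
  assumes v: "locally_integrable v"
  shows "integrable lborel (\<lambda>x. C * norm (indicator (cball 0 R) x *\<^sub>R v x) :: real)"
  using v by (intro integrable_mult_right integrable_norm) (simp add: locally_integrable_def)

lemma locally_integrable_mult_test:
  assumes v: "locally_integrable v" and f: "f \<in> test_functions"
  shows "integrable lborel (\<lambda>x. v x * f x)"
proof -
  obtain r where r: "r > 0" "\<And>x. norm x \<ge> r \<Longrightarrow> f x = 0"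
    using test_support f by metis
  obtain C where C: "C \<ge> 0" "\<And>x. norm (f x) \<le> C"
    using test_bounded f by metis
  show ?thesis
  proof (rule Bochner_Integration.integrable_bound[OF locally_integrable_bound[OF v, of C r]])
    show "(\<lambda>x. v x * f x) \<in> borel_measurable lborel"
      using v test_measurable[OF f] by (auto simp: locally_integrable_def)
    show "AE x in lborel. norm (v x * f x) \<le> norm (C * norm (indicator (cball 0 r) x *\<^sub>R v x))"
    proof (rule AE_I2)
      fix x
      show "norm (v x * f x) \<le> norm (C * norm (indicator (cball 0 r) x *\<^sub>R v x))"
        using r(2)[of x] C mult_right_mono[OF C(2)[of x] norm_ge_zero[of "v x"]]
        by (cases "norm x \<le> r") (auto simp: norm_mult mult.commute)
    qed
  qed
qed

lemma correlation_tendsto: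
  assumes v: "locally_integrable v" and f: "f \<in> test_functions" and h: "h \<longlonglongrightarrow> h0"
  shows "(\<lambda>n. LINT y|lborel. v y * f (y + h n)) \<longlonglongrightarrow> (LINT y|lborel. v y * f (y + h0))"
proof -
  obtain r where r: "r > 0" "\<And>x. norm x \<ge> r \<Longrightarrow> f x = 0"
    using test_support f by metis
  obtain C where C: "C \<ge> 0" "\<And>x. norm (f x) \<le> C"
    using test_bounded f by metis
  \<comment> \<open>A bounded sequence of shifts keeps all translated supports inside one ball of
    radius r + K, on which v has an integrable dominating function.\<close>
  obtain K where K: "\<And>n. norm (h n) \<le> K"
    using convergent_imp_Bseq[OF convergentI[OF h]] by (auto simp: Bseq_def)
  have [measurable]: "v \<in> borel_measurable borel" "f \<in> borel_measurable borel"
    using v test_measurable[OF f] by (auto simp: locally_integrable_def)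
  show ?thesis
  proof (rule integral_dominated_convergence[OF _ _ locally_integrable_bound[OF v, of C "r + K"]])
    show "AE y in lborel. (\<lambda>n. v y * f (y + h n)) \<longlonglongrightarrow> v y * f (y + h0)"
      using Ck_continuous[OF test_Ck[OF f]] h
      by (intro AE_I2 tendsto_mult tendsto_const continuous_on_tendsto_compose[of UNIV f] tendsto_add) auto
    show "AE y in lborel. norm (v y * f (y + h n)) \<le> C * norm (indicator (cball 0 (r + K)) y *\<^sub>R v y)" for n
    proof (rule AE_I2)
      fix y
      show "norm (v y * f (y + h n)) \<le> C * norm (indicator (cball 0 (r + K)) y *\<^sub>R v y)"
      proof (cases "norm y \<le> r + K")
        case True
        then show ?thesis
          using mult_right_mono[OF C(2)[of "y + h n"] norm_ge_zero[of "v y"]]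
          by (simp add: norm_mult mult.commute)
      next
        case False
        then have "norm (y + h n) \<ge> r"
          using norm_triangle_ineq4[of "y + h n" "h n"] K[of n] by simp
        then show ?thesis using r(2)[of "y + h n"] C(1) by simp
      qed
    qed
  qed measurable
qed

text \<open>The derivative falls on f alone, so v needs no regularity. Difference quotients of f are
  bounded uniformly by \<open>test_diff_bound\<close> and supported in a common ball, which gives
  the dominating function.\<close>

lemma correlation_has_derivative_0:
  fixes f :: "real ^ 'd::finite \<Rightarrow> complex"
  assumes v: "locally_integrable v" and f: "f \<in> test_functions"
  shows "((\<lambda>t. LINT y|lborel. v y * f (y + t *\<^sub>R axis i 1)) has_vector_derivative
     (LINT y|lborel. v y * partial i f y)) (at 0)"
proof (rule has_vector_derivative_sequentially)
  fix S :: "nat \<Rightarrow> real" assume S: "\<And>n. S n \<noteq> 0" "S \<longlonglongrightarrow> 0"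
  let ?q = "\<lambda>n y. (f (y + S n *\<^sub>R axis i 1) - f y) /\<^sub>R S n"
  obtain r where r: "r > 0" "\<And>x. norm x \<ge> r \<Longrightarrow> f x = 0"
    using test_support f by metis
  obtain C where C: "C \<ge> 0" "\<And>x t. norm (f (x + t *\<^sub>R axis i 1) - f x) \<le> C * \<bar>t\<bar>"
    using test_diff_bound[OF f] by metis
  obtain K where K: "K > 0" "\<And>n. \<bar>S n\<bar> \<le> K"
    using convergent_imp_Bseq[OF convergentI[OF S(2)]] by (auto simp: Bseq_def)
  have [measurable]: "v \<in> borel_measurable borel" "f \<in> borel_measurable borel"
      "partial i f \<in> borel_measurable borel"
    using v test_measurable[OF f] test_measurable[OF test_partial[OF f]]
    by (auto simp: locally_integrable_def)
  have "(\<lambda>n. LINT y|lborel. v y * ?q n y)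
      \<longlonglongrightarrow> (LINT y|lborel. v y * partial i f y)"
  proof (rule integral_dominated_convergence[OF _ _ locally_integrable_bound[OF v, of C "r + K"]])
    have "(\<lambda>n. ?q n y) \<longlonglongrightarrow> partial i f y" for y
    proof -
      have "((\<lambda>t. f (y + t *\<^sub>R axis i 1)) has_vector_derivative partial i f y) (at 0)"
        using partial_has_vector_derivative[of f y 0 i] test_differentiable[OF f] by simp
      then have "((\<lambda>h. norm (f (y + h *\<^sub>R axis i 1) - f y - h *\<^sub>R partial i f y) / norm h) \<longlongrightarrow> 0) (at 0)"
        by (simp add: has_vector_derivative_def has_derivative_at)
      then have "(\<lambda>n. norm (f (y + S n *\<^sub>R axis i 1) - f y - S n *\<^sub>R partial i f y) / norm (S n)) \<longlonglongrightarrow> 0"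
        using S unfolding LIMSEQ_SEQ_conv[symmetric] by (auto simp: o_def)
      moreover have "norm (f (y + S n *\<^sub>R axis i 1) - f y - S n *\<^sub>R partial i f y) / norm (S n)
          = norm (?q n y - partial i f y)" for n
      proof -
        have "?q n y - partial i f y
            = (f (y + S n *\<^sub>R axis i 1) - f y - S n *\<^sub>R partial i f y) /\<^sub>R S n"
          using S(1)[of n] by (simp add: scaleR_diff_right)
        then show ?thesis by (simp add: divide_inverse mult.commute)
      qed
      ultimately have "(\<lambda>n. norm (?q n y - partial i f y)) \<longlonglongrightarrow> 0"
        by simp
      then show ?thesis
        by (rule LIM_zero_cancel[OF tendsto_norm_zero_cancel])
    qed
    then show "AE y in lborel. (\<lambda>n. v y * ?q n y) \<longlonglongrightarrow> v y * partial i f y"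
      by (intro AE_I2 tendsto_mult tendsto_const)
    show "AE y in lborel. norm (v y * ?q n y)
        \<le> C * norm (indicator (cball 0 (r + K)) y *\<^sub>R v y)" for n
    proof (rule AE_I2)
      fix y
      have *: "norm (?q n y) \<le> C"
        using C(2)[of y "S n"] S(1)[of n] by (simp add: divide_simps mult.commute flip: divide_inverse)
      show "norm (v y * ?q n y)
          \<le> C * norm (indicator (cball 0 (r + K)) y *\<^sub>R v y)"
      proof (cases "norm y \<le> r + K")
        case True
        then show ?thesis
          using mult_right_mono[OF * norm_ge_zero[of "v y"]]
          by (simp add: norm_mult mult.commute mult.left_commute)
      next
        case False
        have "norm (S n *\<^sub>R axis i 1 :: real ^ 'd) \<le> K" using K(2)[of n] by simp
        then have "norm (y + S n *\<^sub>R axis i 1) \<ge> r"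
          using norm_triangle_ineq4[of "y + S n *\<^sub>R axis i 1" "S n *\<^sub>R axis i 1"] False by simp
        then show ?thesis using r(2)[of "y + S n *\<^sub>R axis i 1"] r(2)[of y] K(1) False C(1) by simp
      qed
    qed
  qed measurable
  moreover have "(LINT y|lborel. v y * ?q n y) =
      ((LINT y|lborel. v y * f (y + S n *\<^sub>R axis i 1)) - (LINT y|lborel. v y * f (y + 0 *\<^sub>R axis i 1))) /\<^sub>R S n" for n
    using locally_integrable_mult_test[OF v f] locally_integrable_mult_test[OF v test_shift[OF f]]
    by (simp add: right_diff_distrib)
  ultimately show "(\<lambda>n. ((LINT y|lborel. v y * f (y + S n *\<^sub>R axis i 1))
      - (LINT y|lborel. v y * f (y + 0 *\<^sub>R axis i 1))) /\<^sub>R S n) \<longlonglongrightarrow> (LINT y|lborel. v y * partial i f y)"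
    by (simp only:)
qed

lemma correlation_has_derivative:
  assumes v: "locally_integrable v" and f: "f \<in> test_functions"
  shows "((\<lambda>t. LINT y|lborel. v y * f (y + (x + t *\<^sub>R axis i 1))) has_vector_derivative
     (LINT y|lborel. v y * partial i f (y + (x + t *\<^sub>R axis i 1)))) (at t)"
proof -
  let ?z = "x + t *\<^sub>R axis i 1"
  have "((\<lambda>s. LINT y|lborel. v y * f (y + s *\<^sub>R axis i 1 + ?z)) has_vector_derivative
     (LINT y|lborel. v y * partial i (\<lambda>y. f (y + ?z)) y)) (at 0)"
    by (rule correlation_has_derivative_0[OF v test_shift[OF f]])
  moreover have "partial i (\<lambda>y. f (y + ?z)) y = partial i f (y + ?z)" for y
    by (intro partial_shift test_differentiable f)
  moreover have "y + s *\<^sub>R axis i 1 + ?z = y + (x + (t + s) *\<^sub>R axis i 1)" for y s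
    by (simp add: algebra_simps)
  ultimately have "((\<lambda>s. LINT y|lborel. v y * f (y + (x + (t + s) *\<^sub>R axis i 1))) has_vector_derivative
     (LINT y|lborel. v y * partial i f (y + ?z))) (at 0)"
    by simp
  then have "((\<lambda>s. LINT y|lborel. v y * f (y + (x + (t + s) *\<^sub>R axis i 1))) has_derivative
     (\<lambda>h. h *\<^sub>R (LINT y|lborel. v y * partial i f (y + ?z)))) (at (t - t))"
    by (simp add: has_vector_derivative_def)
  moreover have "((\<lambda>s. s - t) has_derivative (\<lambda>h. h)) (at t)"
    by (auto intro!: derivative_eq_intros)
  ultimately show ?thesis
    using diff_chain_at[of "\<lambda>s. s - t" "\<lambda>h. h" t]
    by (fastforce simp: has_vector_derivative_def o_def)
qed

lemma integral_shift:
  fixes f :: "real ^ 'd::finite \<Rightarrow> 'b::{banach, second_countable_topology}"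
  assumes "f \<in> borel_measurable borel"
  shows "(LINT y|lborel. f (y + h)) = (LINT y|lborel. f y)"
proof -
  have "(LINT y|lborel. f y) = (LINT y|distr lborel borel ((+) h). f y)"
    by (simp add: lborel_distr_plus)
  also have "\<dots> = (LINT y|lborel. f (h + y))"
    using assms by (intro integral_distr) auto
  finally show ?thesis by (simp add: add.commute)
qed

text \<open>The integral of f(y + t e_i) does not depend on t by translation invariance, and its
  derivative at t = 0 is the integral of the partial derivative. This avoids Fubini and
  one-dimensional integration.\<close>

lemma integral_partial_zero:
  assumes f: "f \<in> test_functions"
  shows "(LINT y|lborel. partial i f y) = 0"
proof -
  have "((\<lambda>t. LINT y|lborel. 1 * f (y + t *\<^sub>R axis i 1)) has_vector_derivative
      (LINT y|lborel. 1 * partial i f y)) (at 0)"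
    by (intro correlation_has_derivative_0 locally_integrable_const f)
  moreover have "((\<lambda>t. LINT y|lborel. 1 * f (y + t *\<^sub>R axis i 1)) has_vector_derivative 0) (at 0)"
    by (simp add: integral_shift test_measurable[OF f] has_vector_derivative_const)
  ultimately show ?thesis
    using vector_derivative_unique_at by fastforce
qed

lemma test_integrable_mult:
  assumes "f \<in> test_functions" "g \<in> test_functions"
  shows "integrable lborel (\<lambda>y. f y * g y)"
  using assms by (intro integrable_L2_mult test_L2_lborel)

lemma test_by_parts:
  assumes f: "f \<in> test_functions" and g: "g \<in> test_functions"
  shows "(LINT y|lborel. f y * partial i g y) = - (LINT y|lborel. partial i f y * g y)"
proof -
  have "0 = (LINT y|lborel. partial i (\<lambda>y. f y * g y) y)"
    by (simp add: integral_partial_zero test_mult f g)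
  also have "\<dots> = (LINT y|lborel. f y * partial i g y + partial i f y * g y)"
    by (simp add: partial_mult test_differentiable f g)
  also have "\<dots> = (LINT y|lborel. f y * partial i g y) + (LINT y|lborel. partial i f y * g y)"
    by (intro Bochner_Integration.integral_add test_integrable_mult f g test_partial)
  finally show ?thesis by (simp add: eq_neg_iff_add_eq_0)
qed

lemma test_is_weak_partial:
  "f \<in> test_functions \<Longrightarrow> is_weak_partial i f (partial i f)"
  unfolding is_weak_partial_def
  by (simp add: test_by_parts test_partial test_L2_lborel)

text \<open>Differentiating \<open>t \<mapsto> \<integral> \<partial>\<^sub>k f(y) g(y + t e\<^sub>i) dy = - \<integral> f(y) \<partial>\<^sub>k g(y + t e\<^sub>i) dy\<close> at \<open>0\<close> in two ways
  shows that mixed derivatives have the same integral against \<open>g\<close>.\<close>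

lemma partial_commute_AE:
  fixes f :: "real ^ 'd::finite \<Rightarrow> complex"
  assumes f: "f \<in> test_functions"
  shows "AE x in lborel. partial i (partial k f) x = partial k (partial i f) x"
proof -
  have *: "(LINT y|lborel. partial i (partial k f) y * g y) = (LINT y|lborel. partial k (partial i f) y * g y)"
    if g: "g \<in> test_functions" for g
  proof -
    have f': "partial j f \<in> test_functions" and g': "partial j g \<in> test_functions" for j
      by (intro test_partial f g)+
    have "(LINT y|lborel. partial k f y * partial i g y) = - (LINT y|lborel. f y * partial i (partial k g) y)"
    proof -
      have d: "((\<lambda>t. LINT y|lborel. partial k f y * g (y + t *\<^sub>R axis i 1)) has_vector_derivative
          (LINT y|lborel. partial k f y * partial i g y)) (at 0)"
        by (intro correlation_has_derivative_0 locally_integrable_L2 test_L2_lborel f' g)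
      have "(LINT y|lborel. partial k f y * g (y + h)) = - (LINT y|lborel. f y * partial k g (y + h))" for h
      proof -
        have "partial k (\<lambda>y. g (y + h)) y = partial k g (y + h)" for y
          by (intro partial_shift test_differentiable g)
        then show ?thesis
          using test_by_parts[OF f test_shift[OF g, of h], of k] by simp
      qed
      moreover have "((\<lambda>t. - (LINT y|lborel. f y * partial k g (y + t *\<^sub>R axis i 1))) has_vector_derivative
          - (LINT y|lborel. f y * partial i (partial k g) y)) (at 0)"
        by (intro has_vector_derivative_minus correlation_has_derivative_0 locally_integrable_L2
            test_L2_lborel f g')
      ultimately show ?thesis
        using d vector_derivative_unique_at by fastforce
    qed
    also have "\<dots> = (LINT y|lborel. partial i f y * partial k g y)"
      using test_by_parts[OF f g'[of k], of i] by simp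
    finally show ?thesis
      using test_by_parts[OF f'[of k] g, of i] test_by_parts[OF f'[of i] g, of k]
      by simp
  qed
  have L: "partial i (partial k f) \<in> test_functions" "partial k (partial i f) \<in> test_functions"
    by (intro test_partial f)+
  have "AE x in lborel. partial i (partial k f) x - partial k (partial i f) x = 0"
  proof (rule zero_AE_if_orthogonal_to_test)
    show "(\<lambda>x. partial i (partial k f) x - partial k (partial i f) x) \<in> L2 lborel"
      by (intro L2.diff_closed test_L2_lborel L)
    show "(LINT x|lborel. (partial i (partial k f) x - partial k (partial i f) x) * g x) = 0"
      if g: "g \<in> test_functions" for g
      using *[OF g] test_integrable_mult[OF L(1) g] test_integrable_mult[OF L(2) g]
      by (simp add: left_diff_distrib)
  qed
  then show ?thesis by simp
qed

section \<open>Uniqueness for \<open>v - \<Delta>v = 0\<close> in \<open>L\<^sup>2\<close>\<close>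

text \<open>If D were positive, g' would vanish at 0 and be positive just to the right of it, so by
  the mean value theorem g would exceed g 0.\<close>

lemma second_derivative_at_max:
  fixes g :: "real \<Rightarrow> real"
  assumes g: "\<And>t. (g has_real_derivative g' t) (at t)"
    and g': "(g' has_real_derivative D) (at 0)"
    and max: "\<And>t. g t \<le> g 0"
  shows "D \<le> 0"
proof (rule ccontr)
  assume "\<not> D \<le> 0"
  then obtain d where d: "d > 0" "\<And>h. 0 < h \<Longrightarrow> h < d \<Longrightarrow> g' 0 < g' (0 + h)"
    using DERIV_pos_inc_right[OF g'] by auto
  have g'0: "g' 0 = 0"
    using DERIV_local_max[OF g, of 1 0] max by simp
  obtain z where z: "0 < z" "z < d / 2" "g (d / 2) - g 0 = (d / 2 - 0) * g' z"
    using MVT2[of 0 "d / 2" g g'] g d(1) by auto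
  have "g' z > 0" using d(2)[of z] z g'0 d(1) by simp
  then have "(d / 2 - 0) * g' z > 0" using d(1) by simp
  then have "g (d / 2) - g 0 > 0" using z(3) by linarith
  then show False using max[of "d / 2"] by simp
qed

text \<open>At a maximum of \<open>W - \<delta>\<bar>x\<bar>\<^sup>2\<close> the Laplacian of \<open>W\<close> is at most \<open>2 d \<delta>\<close>.\<close>

lemma bounded_maximum_principle:
  fixes W :: "real ^ 'd::finite \<Rightarrow> real"
  assumes cont: "continuous_on UNIV W" and bd: "\<And>x. \<bar>W x\<bar> \<le> K"
    and dW: "\<And>i x t. ((\<lambda>t. W (x + t *\<^sub>R axis i 1)) has_real_derivative W' i (x + t *\<^sub>R axis i 1)) (at t)"
    and dW': "\<And>i x t. ((\<lambda>t. W' i (x + t *\<^sub>R axis i 1)) has_real_derivative W'' i (x + t *\<^sub>R axis i 1)) (at t)"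
    and eq: "\<And>x. W x = (\<Sum>i\<in>UNIV. W'' i x)"
  shows "W 0 \<le> 0"
proof (rule field_le_epsilon)
  fix e :: real assume e: "e > 0"
  \<comment> \<open>Chosen so that the bound 2 d \<delta> on the Laplacian at the maximum equals
    e.\<close>
  define \<delta> where "\<delta> = e / (2 * CARD('d))"
  have \<delta>: "\<delta> > 0" using e by (simp add: \<delta>_def)
  have K: "K \<ge> 0" using bd[of 0] by simp
  \<comment> \<open>Outside the ball of radius R the penalty is at least 2 K, so P is below its
    value at 0 there, and a maximum over the compact ball is global.\<close>
  define R where "R = sqrt (2 * K / \<delta>)"
  have R: "R \<ge> 0" "\<delta> * R\<^sup>2 = 2 * K" using K \<delta> by (auto simp: R_def)
  define P where "P x = W x - \<delta> * (norm x)\<^sup>2" for x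
  have "continuous_on (cball 0 R) P"
    unfolding P_def by (intro continuous_intros continuous_on_subset[OF cont]) auto
  then have "\<exists>x0\<in>cball 0 R. \<forall>x\<in>cball 0 R. P x \<le> P x0"
    using R(1) by (intro continuous_attains_sup) auto
  then obtain x0 where x0: "\<And>x. x \<in> cball 0 R \<Longrightarrow> P x \<le> P x0" "x0 \<in> cball 0 R"
    by blast
  have max: "P x \<le> P x0" for x
  proof (cases "norm x \<le> R")
    case False
    then have "\<delta> * R\<^sup>2 \<le> \<delta> * (norm x)\<^sup>2"
      using R(1) \<delta> by (intro mult_left_mono power_mono) auto
    then have "P x \<le> P 0"
      using bd[of x] bd[of 0] R(2) by (simp add: P_def)
    also have "P 0 \<le> P x0" using x0 R(1) by simp
    finally show ?thesis .
  qed (use x0 in auto)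
  have "W'' i x0 \<le> 2 * \<delta>" for i
  proof -
    have nsq: "(norm (x0 + t *\<^sub>R axis i 1))\<^sup>2 = (norm x0)\<^sup>2 + 2 * t * x0 $ i + t\<^sup>2" for t
      unfolding power2_norm_eq_inner
      by (simp add: inner_add_left inner_add_right inner_axis inner_axis' power2_eq_square algebra_simps)
    have "W'' i (x0 + 0 *\<^sub>R axis i 1) - 2 * \<delta> \<le> 0"
    proof (rule second_derivative_at_max)
      show "((\<lambda>t. P (x0 + t *\<^sub>R axis i 1)) has_real_derivative
          (W' i (x0 + t *\<^sub>R axis i 1) - \<delta> * (2 * x0 $ i + 2 * t))) (at t)" for t
        unfolding P_def nsq by (auto intro!: derivative_eq_intros dW)
      show "((\<lambda>t. W' i (x0 + t *\<^sub>R axis i 1) - \<delta> * (2 * x0 $ i + 2 * t)) has_real_derivative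
          (W'' i (x0 + 0 *\<^sub>R axis i 1) - 2 * \<delta>)) (at 0)"
        by (auto intro!: derivative_eq_intros dW')
      show "P (x0 + t *\<^sub>R axis i 1) \<le> P (x0 + 0 *\<^sub>R axis i 1)" for t using max by simp
    qed
    then show ?thesis by simp
  qed
  then have "W x0 \<le> (\<Sum>i\<in>(UNIV :: 'd set). 2 * \<delta>)"
    unfolding eq by (intro sum_mono) auto
  also have "\<dots> = e" by (simp add: \<delta>_def)
  finally have "W x0 \<le> e" .
  moreover have "W 0 \<le> W x0 - \<delta> * (norm x0)\<^sup>2" using max[of 0] by (simp add: P_def)
  moreover have "\<delta> * (norm x0)\<^sup>2 \<ge> 0" using \<delta> by simp
  ultimately show "W 0 \<le> 0 + e" by simp
qed

lemma L2_inner_Cauchy_Schwarz: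
  "f \<in> L2 M \<Longrightarrow> g \<in> L2 M \<Longrightarrow> cmod (L2_inner M f g) \<le> L2_norm M f * L2_norm M g"
  using L2.Cauchy_Schwarz[of f M g] by (simp add: L2_nrm_eq)

lemma zero_AE_if_laplacian_eq:
  fixes v :: "real ^ 'd::finite \<Rightarrow> complex"
  assumes v: "v \<in> L2 lborel"
    and orth: "\<And>\<phi>. \<phi> \<in> test_functions \<Longrightarrow>
      (LINT x|lborel. v x * (\<phi> x - (\<Sum>i\<in>UNIV. partial i (partial i \<phi>) x))) = 0"
  shows "AE x in lborel. v x = 0"
proof (rule zero_AE_if_orthogonal_to_test[OF v])
  fix \<phi> :: "real ^ 'd \<Rightarrow> complex" assume \<phi>: "\<phi> \<in> test_functions"
  note lv = locally_integrable_L2[OF v]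
  have \<phi>': "partial i \<phi> \<in> test_functions" and \<phi>'': "partial i (partial i \<phi>) \<in> test_functions" for i
    by (intro test_partial \<phi>)+
  define I where "I \<psi> x = (LINT y|lborel. v y * \<psi> (y + x))" for \<psi> x
  have bound: "cmod (I \<phi> x) \<le> L2_norm lborel v * L2_norm lborel \<phi>" for x
  proof -
    have "I \<phi> x = L2_inner lborel v (\<lambda>y. cnj (\<phi> (y + x)))"
      by (simp add: I_def L2_inner_def)
    also have "cmod \<dots> \<le> L2_norm lborel v * L2_norm lborel (\<lambda>y. cnj (\<phi> (y + x)))"
      by (intro L2_inner_Cauchy_Schwarz v L2_cnj test_L2_lborel test_shift \<phi>)
    also have "L2_norm lborel (\<lambda>y. cnj (\<phi> (y + x))) = L2_norm lborel \<phi>"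
      using integral_shift[of "\<lambda>y. (cmod (\<phi> y))\<^sup>2" x] test_measurable[OF \<phi>]
      by (simp add: L2_norm_def)
    finally show ?thesis .
  qed
  have deriv: "((\<lambda>t. Re (c * I \<psi> (x + t *\<^sub>R axis i 1))) has_real_derivative
      Re (c * I (partial i \<psi>) (x + t *\<^sub>R axis i 1))) (at t)" if "\<psi> \<in> test_functions" for c \<psi> x i t
  proof -
    have "((\<lambda>t. I \<psi> (x + t *\<^sub>R axis i 1)) has_vector_derivative I (partial i \<psi>) (x + t *\<^sub>R axis i 1)) (at t)"
      unfolding I_def by (rule correlation_has_derivative[OF lv that])
    then have "((\<lambda>t. Re (c * I \<psi> (x + t *\<^sub>R axis i 1))) has_vector_derivative
        Re (c * I (partial i \<psi>) (x + t *\<^sub>R axis i 1))) (at t)"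
      by (intro bounded_linear.has_vector_derivative[OF bounded_linear_Re]
          bounded_linear.has_vector_derivative[OF bounded_linear_mult_right])
    then show ?thesis by (simp add: has_real_derivative_iff_has_vector_derivative)
  qed
  have eq: "I \<phi> x = (\<Sum>i\<in>UNIV. I (partial i (partial i \<phi>)) x)" for x
  proof -
    have "0 = (LINT y|lborel. v y * (\<phi> (y + x) - (\<Sum>i\<in>UNIV. partial i (partial i \<phi>) (y + x))))"
    proof -
      have "partial i (\<lambda>y. \<phi> (y + x)) = (\<lambda>y. partial i \<phi> (y + x))" for i
        by (auto simp: partial_shift test_differentiable \<phi>)
      then have "partial i (partial i (\<lambda>y. \<phi> (y + x))) y = partial i (partial i \<phi>) (y + x)" for i y
        by (simp add: partial_shift test_differentiable \<phi>')
      then show ?thesis using orth[OF test_shift[OF \<phi>, of x]] by simp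
    qed
    also have "\<dots> = (LINT y|lborel. v y * \<phi> (y + x) - (\<Sum>i\<in>UNIV. v y * partial i (partial i \<phi>) (y + x)))"
      by (simp add: right_diff_distrib sum_distrib_left)
    also have "\<dots> = I \<phi> x - (\<Sum>i\<in>UNIV. I (partial i (partial i \<phi>)) x)"
      unfolding I_def
      by (subst Bochner_Integration.integral_diff)
        (auto intro!: Bochner_Integration.integrable_sum Bochner_Integration.integral_sum
          locally_integrable_mult_test[OF lv] test_shift \<phi> \<phi>'')
    finally show ?thesis by simp
  qed
  \<comment> \<open>The maximum principle is real-valued and one-sided. Applied with c = cnj (I
    \<phi> 0), it bounds the squared modulus of I \<phi> 0 by 0.\<close>
  have "Re (c * I \<phi> 0) \<le> 0" for c
  proof (rule bounded_maximum_principle[where W = "\<lambda>x. Re (c * I \<phi> x)"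
        and W' = "\<lambda>i x. Re (c * I (partial i \<phi>) x)" and W'' = "\<lambda>i x. Re (c * I (partial i (partial i \<phi>)) x)"])
    have "continuous_on UNIV (I \<phi>)"
      unfolding continuous_on_sequentially I_def
      by (auto simp: o_def intro: correlation_tendsto[OF lv \<phi>])
    then show "continuous_on UNIV (\<lambda>x. Re (c * I \<phi> x))"
      by (intro continuous_intros)
    show "\<bar>Re (c * I \<phi> x)\<bar> \<le> cmod c * (L2_norm lborel v * L2_norm lborel \<phi>)" for x
    proof -
      have "\<bar>Re (c * I \<phi> x)\<bar> \<le> cmod c * cmod (I \<phi> x)"
        using abs_Re_le_cmod[of "c * I \<phi> x"] by (simp add: norm_mult)
      also have "\<dots> \<le> cmod c * (L2_norm lborel v * L2_norm lborel \<phi>)"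
        by (intro mult_left_mono bound) auto
      finally show ?thesis .
    qed
    show "Re (c * I \<phi> x) = (\<Sum>i\<in>UNIV. Re (c * I (partial i (partial i \<phi>)) x))" for x
      unfolding eq[of x] by (simp only: sum_distrib_left Re_sum)
  qed (intro deriv \<phi> \<phi>')+
  from this[of "cnj (I \<phi> 0)"] have "cmod (I \<phi> 0) = 0"
    by (simp add: cmod_def power2_eq_square sum_squares_le_zero_iff)
  then show "(LINT x|lborel. v x * \<phi> x) = 0"
    by (simp add: I_def)
qed

section \<open>The Sobolev space \<open>H\<^sup>1\<close>\<close>

abbreviation H0_inner :: "(real ^ 'd::finite \<Rightarrow> complex) \<Rightarrow> (real ^ 'd \<Rightarrow> complex) \<Rightarrow> complex" where
  "H0_inner \<equiv> L2_inner lborel"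

abbreviation H0_norm :: "(real ^ 'd::finite \<Rightarrow> complex) \<Rightarrow> real" where
  "H0_norm \<equiv> L2_norm lborel"

text \<open>The definition pairs functions bilinearly, while limits and linearity are available for
  the sesquilinear product. Test functions are closed under conjugation, so both versions
  agree.\<close>

lemma is_weak_partial_iff_inner:
  "is_weak_partial i f g \<longleftrightarrow> f \<in> L2 lborel \<and> g \<in> L2 lborel \<and>
     (\<forall>\<phi>\<in>test_functions. H0_inner f (partial i \<phi>) = - H0_inner g \<phi>)"
proof -
  have *: "H0_inner f (partial i (\<lambda>x. cnj (\<phi> x))) = (LINT x|lborel. f x * partial i \<phi> x)"
    "H0_inner g (\<lambda>x. cnj (\<phi> x)) = (LINT x|lborel. g x * \<phi> x)" if "\<phi> \<in> test_functions" for \<phi>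
    using that by (simp_all add: L2_inner_def partial_cnj test_differentiable)
  have **: "H0_inner f (partial i \<phi>) = (LINT x|lborel. f x * partial i (\<lambda>x. cnj (\<phi> x)) x)"
    "H0_inner g \<phi> = (LINT x|lborel. g x * cnj (\<phi> x))" if "\<phi> \<in> test_functions" for \<phi>
    using *[OF test_cnj[OF that]] by simp_all
  have "H0_inner f (partial i \<phi>) = - H0_inner g \<phi>" if "is_weak_partial i f g" "\<phi> \<in> test_functions" for \<phi>
    using that(1) test_cnj[OF that(2)] unfolding is_weak_partial_def **[OF that(2)] by blast
  moreover have "(LINT x|lborel. f x * partial i \<phi> x) = - (LINT x|lborel. g x * \<phi> x)"
    if "\<forall>\<phi>\<in>test_functions. H0_inner f (partial i \<phi>) = - H0_inner g \<phi>" "\<phi> \<in> test_functions" for \<phi>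
    using bspec[OF that(1) test_cnj[OF that(2)]] unfolding *[OF that(2)] .
  ultimately show ?thesis
    unfolding is_weak_partial_def by blast
qed

lemma is_weak_partial_lin:
  assumes "is_weak_partial i f f'" "is_weak_partial i g g'"
  shows "is_weak_partial i (\<lambda>x. a * f x + b * g x) (\<lambda>x. a * f' x + b * g' x)"
  using assms unfolding is_weak_partial_iff_inner
  by (simp add: L2_lin L2.ip_lin test_L2_lborel test_partial)

lemma is_weak_partial_unique:
  assumes "is_weak_partial i f g" "is_weak_partial i f g'"
  shows "AE x in lborel. g x = g' x"
proof -
  have L: "g \<in> L2 lborel" "g' \<in> L2 lborel"
    using assms by (auto simp: is_weak_partial_def)
  have "AE x in lborel. g x - g' x = 0"
  proof (rule zero_AE_if_orthogonal_to_test)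
    show "(\<lambda>x. g x - g' x) \<in> L2 lborel" by (intro L2.diff_closed L)
    fix \<phi> :: "real ^ 'a \<Rightarrow> complex" assume \<phi>: "\<phi> \<in> test_functions"
    have "(LINT x|lborel. g x * \<phi> x) = (LINT x|lborel. g' x * \<phi> x)"
      using assms \<phi> by (auto simp: is_weak_partial_def)
    then show "(LINT x|lborel. (g x - g' x) * \<phi> x) = 0"
      using integrable_L2_mult[OF L(1) test_L2_lborel[OF \<phi>]]
        integrable_L2_mult[OF L(2) test_L2_lborel[OF \<phi>]]
      by (simp add: left_diff_distrib)
  qed
  then show ?thesis by simp
qed

lemma is_weak_partial_cong_AE:
  assumes "is_weak_partial i f g" "AE x in lborel. f x = f' x" "f' \<in> borel_measurable borel"
  shows "is_weak_partial i f' g"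
proof -
  have L: "f \<in> L2 lborel" "f' \<in> L2 lborel"
    using assms L2_cong_AE[of f lborel f'] by (auto simp: is_weak_partial_def)
  have "H0_inner f' (partial i \<phi>) = H0_inner f (partial i \<phi>)" if "\<phi> \<in> test_functions" for \<phi>
    using assms(2) L test_L2_lborel[OF test_partial[OF that]]
    by (intro L2_inner_cong_L2) auto
  then show ?thesis
    using assms L by (simp add: is_weak_partial_iff_inner)
qed

lemma H1_is_weak_partial: "f \<in> H1 \<Longrightarrow> is_weak_partial i f (weak_partial i f)"
  unfolding H1_def weak_partial_def by (auto simp: someI_ex)

lemma weak_partial_AE: "is_weak_partial i f g \<Longrightarrow> AE x in lborel. weak_partial i f x = g x"
  unfolding weak_partial_def using is_weak_partial_unique someI by metis

lemma H1_L2: "f \<in> H1 \<Longrightarrow> f \<in> L2 lborel"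
  by (simp add: H1_def)

lemma weak_partial_L2: "f \<in> H1 \<Longrightarrow> weak_partial i f \<in> L2 lborel"
  using H1_is_weak_partial[of f i] unfolding is_weak_partial_def by blast

lemma H1I: "(\<And>i. is_weak_partial i f (g i)) \<Longrightarrow> f \<in> H1"
proof -
  assume g: "\<And>i. is_weak_partial i f (g i)"
  then have "f \<in> L2 lborel" unfolding is_weak_partial_def by blast
  with g show ?thesis unfolding H1_def by blast
qed

lemma H1_lin: "f \<in> H1 \<Longrightarrow> g \<in> H1 \<Longrightarrow> (\<lambda>x. a * f x + b * g x) \<in> H1"
  by (rule H1I) (rule is_weak_partial_lin[OF H1_is_weak_partial H1_is_weak_partial])

lemma weak_partial_lin:
  "f \<in> H1 \<Longrightarrow> g \<in> H1 \<Longrightarrow>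
    AE x in lborel. weak_partial i (\<lambda>x. a * f x + b * g x) x = a * weak_partial i f x + b * weak_partial i g x"
  by (rule weak_partial_AE) (rule is_weak_partial_lin[OF H1_is_weak_partial H1_is_weak_partial])

lemma H1_diff: "f \<in> H1 \<Longrightarrow> g \<in> H1 \<Longrightarrow> (\<lambda>x. f x - g x) \<in> H1"
  using H1_lin[of f g 1 "-1"] by simp

lemma weak_partial_diff:
  "f \<in> H1 \<Longrightarrow> g \<in> H1 \<Longrightarrow>
    AE x in lborel. weak_partial i (\<lambda>x. f x - g x) x = weak_partial i f x - weak_partial i g x"
  using weak_partial_lin[of f g i 1 "-1"] by simp

lemma H1_cong_AE:
  assumes "f \<in> H1" "AE x in lborel. f x = g x" "g \<in> borel_measurable borel"
  shows "g \<in> H1" "AE x in lborel. weak_partial i f x = weak_partial i g x"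
proof -
  have g: "is_weak_partial i g (weak_partial i f)" for i
    using is_weak_partial_cong_AE[OF H1_is_weak_partial[OF assms(1)] assms(2,3)] .
  show "g \<in> H1" by (rule H1I[OF g])
  show "AE x in lborel. weak_partial i f x = weak_partial i g x"
    using weak_partial_AE[OF g[of i]] by eventually_elim simp
qed

lemma test_H1: "f \<in> test_functions \<Longrightarrow> f \<in> H1"
  by (rule H1I) (rule test_is_weak_partial)

lemma weak_partial_test: "f \<in> test_functions \<Longrightarrow> AE x in lborel. weak_partial i f x = partial i f x"
  by (rule weak_partial_AE) (rule test_is_weak_partial)

section \<open>Inner products on \<open>H1\<close> and its completeness\<close>

definition grad_inner :: "(real ^ 'd::finite \<Rightarrow> complex) \<Rightarrow> (real ^ 'd \<Rightarrow> complex) \<Rightarrow> complex" where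
  "grad_inner f g = (\<Sum>i\<in>UNIV. H0_inner (weak_partial i f) (weak_partial i g))"

definition H1_inner :: "(real ^ 'd::finite \<Rightarrow> complex) \<Rightarrow> (real ^ 'd \<Rightarrow> complex) \<Rightarrow> complex" where
  "H1_inner f g = H0_inner f g + grad_inner f g"

lemma grad_inner_semi_inner: "semi_inner (H1 :: (real ^ 'd::finite \<Rightarrow> complex) set) grad_inner"
proof
  fix f g h :: "real ^ 'd \<Rightarrow> complex" and a b
  show "f \<in> H1 \<Longrightarrow> g \<in> H1 \<Longrightarrow> (\<lambda>x. a * f x + b * g x) \<in> H1"
    by (rule H1_lin)
  show "grad_inner (\<lambda>x. a * f x + b * g x) h = a * grad_inner f h + b * grad_inner g h"
    if "f \<in> H1" "g \<in> H1" "h \<in> H1"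
  proof -
    have "H0_inner (weak_partial i (\<lambda>x. a * f x + b * g x)) (weak_partial i h) =
        H0_inner (\<lambda>x. a * weak_partial i f x + b * weak_partial i g x) (weak_partial i h)" for i
      using that by (intro L2_inner_cong_L2 weak_partial_L2 H1_lin L2_lin weak_partial_lin) auto
    then show ?thesis
      using that by (simp add: grad_inner_def L2.ip_lin weak_partial_L2 sum.distrib sum_distrib_left)
  qed
  show "grad_inner g f = cnj (grad_inner f g)" if "f \<in> H1" "g \<in> H1"
    using that by (simp add: grad_inner_def L2.ip_cnj[of "weak_partial _ f"] weak_partial_L2)
  show "0 \<le> Re (grad_inner f f)"
    by (simp add: grad_inner_def L2_inner_self sum_nonneg)
qed

interpretation grad: semi_inner "H1 :: (real ^ 'd::finite \<Rightarrow> complex) set" grad_inner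
  by (rule grad_inner_semi_inner)

lemma grad_inner_self:
  "Re (grad_inner f f) = (\<Sum>i\<in>UNIV. (H0_norm (weak_partial i f))\<^sup>2)"
  by (simp add: grad_inner_def L2_inner_self)

lemma semi_inner_add:
  assumes "semi_inner V p" "semi_inner V q" "0 \<le> a" "0 \<le> b"
  shows "semi_inner V (\<lambda>f g. complex_of_real a * p f g + complex_of_real b * q f g)"
proof -
  interpret p: semi_inner V p by fact
  interpret q: semi_inner V q by fact
  show ?thesis
  proof
    show "f \<in> V \<Longrightarrow> g \<in> V \<Longrightarrow> complex_of_real a * p g f + complex_of_real b * q g f
        = cnj (complex_of_real a * p f g + complex_of_real b * q f g)" for f g
      by (simp add: p.ip_cnj[of f g] q.ip_cnj[of f g])
  qed (use assms in \<open>auto simp: p.lin_closed p.ip_lin q.ip_lin p.ip_nonneg q.ip_nonneg algebra_simps\<close>)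
qed

lemma semi_inner_subset:
  assumes "semi_inner V p" "W \<subseteq> V" "\<And>f g a b. f \<in> W \<Longrightarrow> g \<in> W \<Longrightarrow> (\<lambda>x. a * f x + b * g x) \<in> W"
  shows "semi_inner W p"
proof -
  interpret p: semi_inner V p by fact
  show ?thesis
    using assms(2,3) by unfold_locales (auto simp: subset_eq intro: p.ip_lin p.ip_cnj p.ip_nonneg)
qed

lemma L2_semi_inner_H1: "semi_inner H1 (H0_inner)"
  using L2.semi_inner_axioms by (rule semi_inner_subset) (auto simp: H1_L2 H1_lin)

lemma H1_inner_self:
  "Re (H1_inner f f) = (H0_norm f)\<^sup>2 + (\<Sum>i\<in>UNIV. (H0_norm (weak_partial i f))\<^sup>2)"
  by (simp add: H1_inner_def grad_inner_self L2_inner_self)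

text \<open>Weak differentiation is a closed operator, since its defining identity survives
  \<open>L2\<close> limits on both sides. Completeness of \<open>H1\<close> rests on this.\<close>

lemma is_weak_partial_limit:
  assumes "L2.tends lborel F f" "L2.tends lborel G g" "\<And>n. is_weak_partial i (F n) (G n)"
  shows "is_weak_partial i f g"
  unfolding is_weak_partial_iff_inner
proof (intro conjI ballI)
  show "f \<in> L2 lborel" "g \<in> L2 lborel"
    using assms by (auto simp: L2.tends_def)
  fix \<phi> :: "real ^ 'a \<Rightarrow> complex" assume \<phi>: "\<phi> \<in> test_functions"
  have "(\<lambda>n. H0_inner (F n) (partial i \<phi>)) \<longlonglongrightarrow> H0_inner f (partial i \<phi>)"
    by (intro L2.tends_ip assms test_L2_lborel test_partial \<phi>)
  moreover have "(\<lambda>n. - H0_inner (G n) \<phi>) \<longlonglongrightarrow> - H0_inner g \<phi>"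
    by (intro tendsto_minus L2.tends_ip assms test_L2_lborel \<phi>)
  moreover have "H0_inner (F n) (partial i \<phi>) = - H0_inner (G n) \<phi>" for n
    using assms(3)[of n] \<phi> by (simp add: is_weak_partial_iff_inner)
  ultimately show "H0_inner f (partial i \<phi>) = - H0_inner g \<phi>"
    using LIMSEQ_unique by simp
qed

interpretation H1: semi_inner "H1 :: (real ^ 'd::finite \<Rightarrow> complex) set" H1_inner
  using semi_inner_add[OF L2_semi_inner_H1 grad_inner_semi_inner, of 1 1]
  by (simp add: H1_inner_def[abs_def])

lemma H1_nrm_eq: "H1.nrm f = H1_norm f"
  by (simp add: H1.nrm_def H1_norm_def H1_inner_self)

lemma L2_norm_le_H1_norm: "H0_norm f \<le> H1_norm f"
  unfolding H1_norm_def by (rule real_le_rsqrt) (simp add: sum_nonneg)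

lemma weak_partial_le_H1_norm: "H0_norm (weak_partial i f) \<le> H1_norm f"
  unfolding H1_norm_def
  using member_le_sum[of i UNIV "\<lambda>i. (H0_norm (weak_partial i f))\<^sup>2"]
  by (intro real_le_rsqrt) (simp add: add_increasing)

lemma H1_norm_nonneg [simp]: "0 \<le> H1_norm f"
  using L2_norm_le_H1_norm[of f] L2_norm_nonneg[of lborel f] by linarith

lemma H1_norm_cong_AE:
  assumes "f \<in> H1" "AE x in lborel. f x = g x" "g \<in> borel_measurable borel"
  shows "H1_norm f = H1_norm g"
proof -
  note g = H1_cong_AE[OF assms]
  have "H0_norm f = H0_norm g"
    using assms g by (intro L2_norm_cong_L2 H1_L2)
  moreover have "H0_norm (weak_partial i f) = H0_norm (weak_partial i g)" for i
    using assms g by (intro L2_norm_cong_L2 weak_partial_L2)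
  ultimately show ?thesis by (simp add: H1_norm_def)
qed

lemma L2_norm_weak_partial_diff:
  assumes "f \<in> H1" "g \<in> H1"
  shows "H0_norm (weak_partial i (\<lambda>x. f x - g x)) = H0_norm (\<lambda>x. weak_partial i f x - weak_partial i g x)"
  using assms by (intro L2_norm_cong_L2 weak_partial_L2 H1_diff L2.diff_closed weak_partial_diff)

lemma H1_cauchy_L2:
  assumes "H1.cauchy F"
  shows "L2.cauchy lborel F" "L2.cauchy lborel (\<lambda>n. weak_partial i (F n))"
proof -
  have F: "F n \<in> H1" for n using assms by (simp add: H1.cauchy_def)
  have *: "\<exists>N. \<forall>m\<ge>N. \<forall>n\<ge>N. H1_norm (\<lambda>x. F m x - F n x) < e" if "e > 0" for e
    using assms that by (simp add: H1.cauchy_def H1_nrm_eq)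
  show "L2.cauchy lborel F"
    unfolding L2.cauchy_def L2_nrm_eq
    using H1_L2[OF F] * by (meson L2_norm_le_H1_norm le_less_trans)
  show "L2.cauchy lborel (\<lambda>n. weak_partial i (F n))"
    unfolding L2.cauchy_def L2_nrm_eq
    unfolding L2_norm_weak_partial_diff[OF F F, symmetric]
    using weak_partial_L2[OF F] * by (meson weak_partial_le_H1_norm le_less_trans)
qed

lemma H1_tendsI:
  assumes F: "\<And>n. F n \<in> H1" and f: "L2.tends lborel F f"
    and G: "\<And>i. L2.tends lborel (\<lambda>n. weak_partial i (F n)) (g i)"
  shows "H1.tends F f"
proof -
  have w: "is_weak_partial i f (g i)" for i
    by (rule is_weak_partial_limit[OF f G]) (rule H1_is_weak_partial[OF F])
  have fH: "f \<in> H1" by (rule H1I[OF w])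
  have "H0_norm (weak_partial i (\<lambda>x. F n x - f x)) = H0_norm (\<lambda>x. weak_partial i (F n) x - g i x)" for i n
    using weak_partial_diff[OF F[of n] fH, of i] weak_partial_AE[OF w[of i]] F fH w
    by (intro L2_norm_cong_L2 weak_partial_L2 H1_diff L2.diff_closed) (auto simp: is_weak_partial_def)
  then have "H1_norm (\<lambda>x. F n x - f x) = sqrt ((H0_norm (\<lambda>x. F n x - f x))\<^sup>2 +
      (\<Sum>i\<in>UNIV. (H0_norm (\<lambda>x. weak_partial i (F n) x - g i x))\<^sup>2))" for n
    by (simp add: H1_norm_def)
  moreover have "(\<lambda>n. sqrt ((H0_norm (\<lambda>x. F n x - f x))\<^sup>2 +
      (\<Sum>i\<in>UNIV. (H0_norm (\<lambda>x. weak_partial i (F n) x - g i x))\<^sup>2)))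
      \<longlonglongrightarrow> sqrt (0\<^sup>2 + (\<Sum>i\<in>(UNIV :: 'a set). 0\<^sup>2))"
    using f G by (intro tendsto_real_sqrt tendsto_add tendsto_power tendsto_sum) (auto simp: L2.tends_def L2_nrm_eq)
  ultimately show ?thesis
    using F fH by (simp add: H1.tends_def H1_nrm_eq)
qed

interpretation H1: semi_hilbert "H1 :: (real ^ 'd::finite \<Rightarrow> complex) set" H1_inner
proof
  fix F :: "nat \<Rightarrow> real ^ 'd \<Rightarrow> complex" assume F: "H1.cauchy F"
  obtain f where f: "L2.tends lborel F f"
    using L2.complete[OF H1_cauchy_L2(1)[OF F]] by blast
  have "\<exists>g. L2.tends lborel (\<lambda>n. weak_partial i (F n)) g" for i
    using L2.complete[OF H1_cauchy_L2(2)[OF F]] by blast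
  then obtain g where g: "\<And>i. L2.tends lborel (\<lambda>n. weak_partial i (F n)) (g i)" by metis
  show "\<exists>f. H1.tends F f"
    using H1_tendsI[OF _ f g] F by (auto simp: H1.cauchy_def)
qed

lemma H1_tends_L2:
  assumes "H1.tends F f"
  shows "L2.tends lborel F f" "L2.tends lborel (\<lambda>n. weak_partial i (F n)) (weak_partial i f)"
proof -
  have F: "F n \<in> H1" and f: "f \<in> H1" and lim: "(\<lambda>n. H1_norm (\<lambda>x. F n x - f x)) \<longlonglongrightarrow> 0" for n
    using assms by (auto simp: H1.tends_def H1_nrm_eq)
  have "(\<lambda>n. H0_norm (\<lambda>x. F n x - f x)) \<longlonglongrightarrow> 0"
    by (rule tendsto_0_le[OF lim, of _ 1]) (simp add: L2_norm_le_H1_norm)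
  then show "L2.tends lborel F f"
    by (simp add: L2.tends_def H1_L2 F f L2_nrm_eq)
  have "(\<lambda>n. H0_norm (\<lambda>x. weak_partial i (F n) x - weak_partial i f x)) \<longlonglongrightarrow> 0"
    by (rule tendsto_0_le[OF lim, of _ 1])
      (simp add: weak_partial_le_H1_norm L2_norm_weak_partial_diff[symmetric] F f)
  then show "L2.tends lborel (\<lambda>n. weak_partial i (F n)) (weak_partial i f)"
    by (simp add: L2.tends_def weak_partial_L2 F f L2_nrm_eq)
qed

lemma L2_inner_cnj_test: "L2_inner M f (\<lambda>x. cnj (\<phi> x)) = (LINT x|M. f x * \<phi> x)"
  by (simp add: L2_inner_def)

lemma H1_inner_test:
  assumes v: "v \<in> H1" and \<phi>: "\<phi> \<in> test_functions"
  shows "H1_inner v (\<lambda>x. cnj (\<phi> x)) =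
    (LINT x|lborel. v x * \<phi> x) + (\<Sum>i\<in>UNIV. LINT x|lborel. weak_partial i v x * partial i \<phi> x)"
proof -
  have c: "(\<lambda>x. cnj (\<phi> x)) \<in> test_functions" by (rule test_cnj[OF \<phi>])
  have "H0_inner (weak_partial i v) (weak_partial i (\<lambda>x. cnj (\<phi> x)))
      = H0_inner (weak_partial i v) (\<lambda>x. cnj (partial i \<phi> x))" for i
    using weak_partial_test[OF c, of i] weak_partial_L2[OF v] weak_partial_L2[OF test_H1[OF c]]
      L2_cnj[OF test_L2_lborel[OF test_partial[OF \<phi>]]]
    by (intro L2_inner_cong_L2) (simp_all add: partial_cnj test_differentiable \<phi>)
  then show ?thesis
    by (simp add: H1_inner_def grad_inner_def L2_inner_cnj_test)
qed

lemma integral_one_minus_laplacian: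
  assumes v: "v \<in> L2 lborel" and \<phi>: "\<phi> \<in> test_functions"
  shows "(LINT x|lborel. v x * (\<phi> x - (\<Sum>i\<in>UNIV. partial i (partial i \<phi>) x))) =
    (LINT x|lborel. v x * \<phi> x) - (\<Sum>i\<in>UNIV. LINT x|lborel. v x * partial i (partial i \<phi>) x)"
proof -
  have "integrable lborel (\<lambda>x. v x * \<phi> x)" "integrable lborel (\<lambda>x. v x * partial i (partial i \<phi>) x)" for i
    by (intro integrable_L2_mult v test_L2_lborel test_partial \<phi>)+
  then show ?thesis
    by (simp add: right_diff_distrib sum_distrib_left)
qed

text \<open>The bridge to the uniqueness fact: orthogonality to test functions in \<open>H1\<close>
  is the distributional equation v - Laplacian v = 0.\<close>

lemma H1_inner_one_minus_laplacian:
  assumes v: "v \<in> H1" and \<phi>: "\<phi> \<in> test_functions"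
  shows "H1_inner v (\<lambda>x. cnj (\<phi> x)) =
    (LINT x|lborel. v x * (\<phi> x - (\<Sum>i\<in>UNIV. partial i (partial i \<phi>) x)))"
proof -
  have "(LINT x|lborel. v x * partial i (partial i \<phi>) x) = - (LINT x|lborel. weak_partial i v x * partial i \<phi> x)" for i
    using H1_is_weak_partial[OF v, of i] test_partial[OF \<phi>] by (simp add: is_weak_partial_def)
  then show ?thesis
    by (simp add: H1_inner_test v \<phi> integral_one_minus_laplacian H1_L2 sum_negf)
qed

text \<open>A function orthogonal to all test functions solves v - Laplacian v = 0 weakly and
  therefore vanishes; no mollifiers or cut-offs are involved.\<close>

lemma test_dense_H1:
  assumes f: "f \<in> H1"
  obtains F where "\<And>n. F n \<in> test_functions" "H1.tends F f"
proof (rule H1.dense_if_orthogonal_trivial[where W = test_functions and f = f])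
  fix v :: "real ^ 'a \<Rightarrow> complex"
  assume v: "v \<in> H1" and orth: "\<And>w. w \<in> test_functions \<Longrightarrow> H1_inner v w = 0"
  have v0: "AE x in lborel. v x = 0"
    using H1_inner_one_minus_laplacian[OF v] orth[OF test_cnj]
    by (intro zero_AE_if_laplacian_eq H1_L2 v) simp
  have "H1_norm v = H1_norm (\<lambda>x :: real ^ 'a. 0)"
    using v v0 by (intro H1_norm_cong_AE) auto
  also have "\<dots> = 0"
    using H1.ip_lin[OF v v test_H1[OF test_zero], of 0 0]
    by (simp flip: H1_nrm_eq add: H1.nrm_def)
  finally show "H1.nrm v = 0" by (simp add: H1_nrm_eq)
qed (use f test_H1 test_zero test_lin in \<open>auto intro: that\<close>)

lemma test_dense_L2:
  fixes f :: "real ^ 'd::finite \<Rightarrow> complex"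
  assumes f: "f \<in> L2 lborel"
  obtains F where "\<And>n. F n \<in> test_functions" "L2.tends lborel F f"
proof (rule L2.dense_if_orthogonal_trivial[where W = test_functions and f = f and M = lborel])
  fix v :: "real ^ 'd \<Rightarrow> complex"
  assume v: "v \<in> L2 lborel" and orth: "\<And>w. w \<in> test_functions \<Longrightarrow> H0_inner v w = 0"
  have "AE x in lborel. v x = 0"
    using orth[OF test_cnj] v
    by (intro zero_AE_if_orthogonal_to_test) (simp_all add: L2_inner_cnj_test)
  then show "L2.nrm lborel v = 0" by (simp add: L2_nrm_eq L2_norm_zero_iff v)
qed (use f test_L2_lborel test_zero test_lin in \<open>auto intro: that\<close>)

text \<open>The definition of a weak derivative allows only test functions as partner; density of
  these in \<open>H1\<close> extends it to all g in \<open>H1\<close>.\<close>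

lemma H1_by_parts:
  assumes f: "f \<in> H1" and g: "g \<in> H1"
  shows "H0_inner (weak_partial i f) g = - H0_inner f (weak_partial i g)"
proof -
  obtain F where F: "\<And>n. F n \<in> test_functions" "H1.tends F g"
    using test_dense_H1[OF g] by blast
  have "H0_inner (weak_partial i f) (F n) = - H0_inner f (weak_partial i (F n))" for n
  proof -
    have "H0_inner f (weak_partial i (F n)) = H0_inner f (partial i (F n))"
      by (intro L2_inner_cong_L2 H1_L2 f weak_partial_L2 test_H1 F test_L2_lborel
          test_partial weak_partial_test) simp
    then show ?thesis
      using H1_is_weak_partial[OF f, of i] F(1)[of n] by (simp add: is_weak_partial_iff_inner)
  qed
  moreover have "(\<lambda>n. H0_inner (weak_partial i f) (F n)) \<longlonglongrightarrow> H0_inner (weak_partial i f) g"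
    by (intro L2.tends_ip2 H1_tends_L2 F weak_partial_L2 f)
  moreover have "(\<lambda>n. - H0_inner f (weak_partial i (F n))) \<longlonglongrightarrow> - H0_inner f (weak_partial i g)"
    by (intro tendsto_minus L2.tends_ip2 H1_tends_L2 F H1_L2 f)
  ultimately show ?thesis
    using LIMSEQ_unique by simp
qed

section \<open>Elliptic regularity and \<open>H\<^sup>2\<close>\<close>

lemma L2_sum: "finite I \<Longrightarrow> (\<And>i. i \<in> I \<Longrightarrow> f i \<in> L2 M) \<Longrightarrow> (\<lambda>x. \<Sum>i\<in>I. f i x) \<in> L2 M"
  by (induction I rule: finite_induct) (auto intro: L2_zero L2.add_closed)

lemma le_if_sq_le_mult: "x\<^sup>2 \<le> y * x \<Longrightarrow> 0 \<le> x \<Longrightarrow> 0 \<le> y \<Longrightarrow> x \<le> (y :: real)"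
  by (cases "x = 0") (auto simp: power2_eq_square)

text \<open>F is the weak solution of F - Laplacian F = u, obtained by representing the functional
  given by u in \<open>H1\<close>.\<close>

lemma H1_inner_Riesz:
  fixes u :: "real ^ 'd::finite \<Rightarrow> complex"
  assumes "u \<in> L2 lborel"
  obtains F where "F \<in> H1" "\<And>w. w \<in> H1 \<Longrightarrow> H1_inner F w = H0_inner u w"
proof -
  have "cmod (H0_inner u w) \<le> H0_norm u * H1.nrm w" if "w \<in> H1" for w
    using L2_inner_Cauchy_Schwarz[OF assms H1_L2[OF that]] L2_norm_le_H1_norm[of w]
      mult_left_mono[of _ _ "H0_norm u"] unfolding H1_nrm_eq
    by (meson L2_norm_nonneg order_trans)
  moreover have "(H1 :: (real ^ 'd \<Rightarrow> complex) set) \<noteq> {}"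
    using test_H1[OF test_zero] by auto
  ultimately show thesis
    using H1.Riesz[of "H0_inner u"] L2.ip_lin2[OF H1_L2 H1_L2 assms] that by blast
qed

text \<open>Differentiating the equation: the k-th derivative of F and G both satisfy w - Laplacian
  w = k-th derivative of u in the sense of distributions. Initially the former is only in
  \<open>L2\<close>, which is why uniqueness is needed in \<open>L2\<close> and not merely in
  \<open>H1\<close>.\<close>

lemma weak_partial_of_solution:
  assumes u: "u \<in> test_functions" and F: "F \<in> H1"
    and sol: "\<And>w. w \<in> H1 \<Longrightarrow> H1_inner F w = H0_inner u w"
    and G: "G \<in> H1" and Gsol: "\<And>w. w \<in> H1 \<Longrightarrow> H1_inner G w = H0_inner (partial k u) w"
  shows "AE x in lborel. weak_partial k F x = G x"
proof -
  have uL: "u \<in> L2 lborel" by (rule test_L2_lborel[OF u])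
  have wF: "weak_partial k F \<in> L2 lborel" by (rule weak_partial_L2[OF F])
  have "AE x in lborel. weak_partial k F x - G x = 0"
  proof (rule zero_AE_if_laplacian_eq)
    show "(\<lambda>x. weak_partial k F x - G x) \<in> L2 lborel"
      by (intro L2.diff_closed wF H1_L2 G)
    fix \<phi> :: "real ^ 'a \<Rightarrow> complex" assume \<phi>: "\<phi> \<in> test_functions"
    note tf = test_partial test_cnj \<phi> u
    let ?L = "\<lambda>x. \<phi> x - (\<Sum>i\<in>UNIV. partial i (partial i \<phi>) x)"
    have L: "?L \<in> L2 lborel"
      by (intro L2.diff_closed L2_sum test_L2_lborel tf) auto
    have "(LINT x|lborel. G x * ?L x) = H1_inner G (\<lambda>x. cnj (\<phi> x))"
      by (simp add: H1_inner_one_minus_laplacian G \<phi>)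
    also have "\<dots> = (LINT x|lborel. partial k u x * \<phi> x)"
      by (simp add: Gsol test_H1 tf L2_inner_cnj_test)
    finally have 1: "(LINT x|lborel. G x * ?L x) = (LINT x|lborel. partial k u x * \<phi> x)" .
    have ibp: "(LINT x|lborel. weak_partial j F x * \<psi> x) = - (LINT x|lborel. F x * partial j \<psi> x)"
      if "\<psi> \<in> test_functions" for \<psi> j
      using H1_is_weak_partial[OF F, of j] that by (simp add: is_weak_partial_def)
    have swap: "(LINT x|lborel. v x * partial i (partial j \<psi>) x) = (LINT x|lborel. v x * partial j (partial i \<psi>) x)"
      if "\<psi> \<in> test_functions" "v \<in> L2 lborel" for \<psi> v i j
    proof (rule integral_cong_AE)
      show "AE x in lborel. v x * partial i (partial j \<psi>) x = v x * partial j (partial i \<psi>) x"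
        using partial_commute_AE[OF that(1), of i j] by eventually_elim simp
      have "(\<lambda>x. v x * \<xi> x) \<in> borel_measurable lborel" if "\<xi> \<in> test_functions" for \<xi>
        by (rule borel_measurable_integrable) (rule integrable_L2_mult[OF \<open>v \<in> L2 lborel\<close> test_L2_lborel[OF that]])
      then show "(\<lambda>x. v x * partial i (partial j \<psi>) x) \<in> borel_measurable lborel"
        "(\<lambda>x. v x * partial j (partial i \<psi>) x) \<in> borel_measurable lborel"
        by (blast intro: test_partial that(1))+
    qed
    \<comment> \<open>All derivatives are moved to the test function, where mixed ones may be
      interchanged almost everywhere, and one of them is then moved back.\<close>
    have 2: "(LINT x|lborel. weak_partial k F x * partial i (partial i \<phi>) x)
        = (LINT x|lborel. weak_partial i F x * partial i (partial k \<phi>) x)" for i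
    proof -
      have "(LINT x|lborel. weak_partial k F x * partial i (partial i \<phi>) x)
          = - (LINT x|lborel. F x * partial k (partial i (partial i \<phi>)) x)"
        by (intro ibp tf)
      also have "\<dots> = - (LINT x|lborel. F x * partial i (partial k (partial i \<phi>)) x)"
        by (subst swap) (auto intro!: tf H1_L2 F)
      also have "\<dots> = (LINT x|lborel. weak_partial i F x * partial k (partial i \<phi>) x)"
        by (intro ibp[symmetric] tf)
      also have "\<dots> = (LINT x|lborel. weak_partial i F x * partial i (partial k \<phi>) x)"
        by (intro swap tf weak_partial_L2 F)
      finally show ?thesis .
    qed
    have "(LINT x|lborel. weak_partial k F x * ?L x) = - (LINT x|lborel. F x * partial k \<phi> x) -
        (\<Sum>i\<in>UNIV. LINT x|lborel. weak_partial i F x * partial i (partial k \<phi>) x)"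
      by (simp add: integral_one_minus_laplacian wF \<phi> ibp 2)
    also have "\<dots> = - H1_inner F (\<lambda>x. cnj (partial k \<phi> x))"
      by (simp add: H1_inner_test F tf)
    also have "\<dots> = - (LINT x|lborel. u x * partial k \<phi> x)"
      by (simp add: sol test_H1 tf L2_inner_cnj_test)
    also have "\<dots> = (LINT x|lborel. partial k u x * \<phi> x)"
      by (simp add: test_by_parts tf)
    finally have 3: "(LINT x|lborel. weak_partial k F x * ?L x) = (LINT x|lborel. partial k u x * \<phi> x)" .
    show "(LINT x|lborel. (weak_partial k F x - G x) * ?L x) = 0"
      using 1 3 integrable_L2_mult[OF wF L] integrable_L2_mult[OF H1_L2[OF G] L]
      by (simp add: left_diff_distrib)
  qed
  then show ?thesis by simp
qed

text \<open>The gain over \<open>H1_solution_bound\<close> applied to G is that one integration by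
  parts removes the derivative from u. The bound by the norm of u alone is what survives the passage
  to arbitrary u in \<open>L2\<close>.\<close>

lemma regularity_test:
  assumes u: "u \<in> test_functions" and F: "F \<in> H1"
    and sol: "\<And>w. w \<in> H1 \<Longrightarrow> H1_inner F w = H0_inner u w"
  shows "weak_partial k F \<in> H1" "H1_norm (weak_partial k F) \<le> H0_norm u"
proof -
  have uk: "partial k u \<in> L2 lborel" by (intro test_L2_lborel test_partial u)
  obtain G where G: "G \<in> H1" and Gsol: "\<And>w. w \<in> H1 \<Longrightarrow> H1_inner G w = H0_inner (partial k u) w"
    using H1_inner_Riesz[OF uk] by blast
  have "AE x in lborel. weak_partial k F x = G x"
    by (rule weak_partial_of_solution[OF u F sol G Gsol])
  then have ae: "AE x in lborel. G x = weak_partial k F x"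
    by eventually_elim simp
  have m: "weak_partial k F \<in> borel_measurable borel"
    using weak_partial_L2[OF F] by (auto simp: L2_def)
  show "weak_partial k F \<in> H1" by (rule H1_cong_AE(1)[OF G ae m])
  have "(H1_norm G)\<^sup>2 = cmod (H1_inner G G)"
    using H1.ip_self[OF G] by (simp add: H1_nrm_eq norm_power)
  also have "H1_inner G G = H0_inner (partial k u) G" by (rule Gsol[OF G])
  also have "\<dots> = H0_inner (weak_partial k u) G"
    using weak_partial_test[OF u, of k]
    by (intro L2_inner_cong_L2 uk H1_L2 G weak_partial_L2 test_H1 u) (auto elim: AE_mp)
  also have "\<dots> = - H0_inner u (weak_partial k G)"
    by (rule H1_by_parts[OF test_H1[OF u] G])
  also have "cmod (- H0_inner u (weak_partial k G)) \<le> H0_norm u * H0_norm (weak_partial k G)"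
    by (simp add: L2_inner_Cauchy_Schwarz test_L2_lborel u weak_partial_L2 G)
  also have "\<dots> \<le> H0_norm u * H1_norm G"
    by (intro mult_left_mono weak_partial_le_H1_norm) auto
  finally have "H1_norm G \<le> H0_norm u"
    by (rule le_if_sq_le_mult) auto
  then show "H1_norm (weak_partial k F) \<le> H0_norm u"
    using H1_norm_cong_AE[OF G ae m] by simp
qed

lemma L2_tends_unique:
  assumes "L2.tends M F f" "L2.tends M F g"
  shows "AE x in M. f x = g x"
proof -
  have L: "f \<in> L2 M" "g \<in> L2 M" using assms by (auto simp: L2.tends_def)
  have "L2_norm M (\<lambda>x. f x - g x) \<le> L2_norm M (\<lambda>x. F n x - f x) + L2_norm M (\<lambda>x. F n x - g x)" for n
    using assms L2.nrm_triangle[of f M "F n" g] L2.nrm_minus[of f M "F n"]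
    by (auto simp: L2.tends_def L2_nrm_eq)
  moreover have "(\<lambda>n. L2_norm M (\<lambda>x. F n x - f x) + L2_norm M (\<lambda>x. F n x - g x)) \<longlonglongrightarrow> 0 + 0"
    using assms by (intro tendsto_add) (auto simp: L2.tends_def L2_nrm_eq)
  ultimately have "L2_norm M (\<lambda>x. f x - g x) \<le> 0"
    by (intro LIMSEQ_le_const[of _ 0]) auto
  then have "L2_norm M (\<lambda>x. f x - g x) = 0"
    using L2_norm_nonneg[of M "\<lambda>x. f x - g x"] by linarith
  then show ?thesis using L2_norm_zero_iff[OF L2.diff_closed[OF L]] by simp
qed

lemma H1_solution_bound:
  assumes u: "u \<in> L2 lborel" and F: "F \<in> H1"
    and sol: "\<And>w. w \<in> H1 \<Longrightarrow> H1_inner F w = H0_inner u w"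
  shows "H1_norm F \<le> H0_norm u"
proof -
  have "(H1_norm F)\<^sup>2 = cmod (H0_inner u F)"
    using H1.ip_self[OF F] sol[OF F] by (simp add: H1_nrm_eq norm_power)
  also have "\<dots> \<le> H0_norm u * H0_norm F"
    by (intro L2_inner_Cauchy_Schwarz u H1_L2 F)
  also have "\<dots> \<le> H0_norm u * H1_norm F"
    by (intro mult_left_mono L2_norm_le_H1_norm) auto
  finally show ?thesis
    by (rule le_if_sq_le_mult) auto
qed

text \<open>For test functions approximating u, the bound in \<open>regularity_test\<close> makes
  the derivatives of the solutions Cauchy in \<open>H1\<close>. Their limit agrees almost everywhere
  with the derivative of F, because the solutions themselves converge in \<open>H1\<close>.\<close>

lemma regularity:
  assumes u: "u \<in> L2 lborel" and F: "F \<in> H1"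
    and sol: "\<And>w. w \<in> H1 \<Longrightarrow> H1_inner F w = H0_inner u w"
  shows "weak_partial k F \<in> H1"
proof -
  obtain U where U: "\<And>n. U n \<in> test_functions" "L2.tends lborel U u"
    using test_dense_L2[OF u] by blast
  have UL: "U n \<in> L2 lborel" for n by (intro test_L2_lborel U)
  have "\<exists>E. E \<in> H1 \<and> (\<forall>w\<in>H1. H1_inner E w = H0_inner (U n) w)" for n
    using H1_inner_Riesz[OF UL] by metis
  then obtain E where E: "\<And>n. E n \<in> H1"
    and Esol: "\<And>n w. w \<in> H1 \<Longrightarrow> H1_inner (E n) w = H0_inner (U n) w" by metis
  have Ulim: "(\<lambda>n. H0_norm (\<lambda>x. U n x - u x)) \<longlonglongrightarrow> 0"
    using U(2) by (simp add: L2.tends_def L2_nrm_eq)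
  have "H1_norm (\<lambda>x. E n x - F x) \<le> H0_norm (\<lambda>x. U n x - u x)" for n
    by (rule H1_solution_bound[OF L2.diff_closed[OF UL u] H1_diff[OF E F]])
      (simp add: H1.ip_diff L2.ip_diff E F UL u H1_L2 Esol sol)
  then have "(\<lambda>n. H1_norm (\<lambda>x. E n x - F x)) \<longlonglongrightarrow> 0"
    by (intro tendsto_0_le[OF Ulim, of _ 1] always_eventually) simp
  then have EF: "H1.tends E F"
    by (simp add: H1.tends_def H1_nrm_eq E F)
  have Ek: "weak_partial k (E n) \<in> H1" for n
    by (rule regularity_test(1)[OF U(1) E Esol])
  have "H1.cauchy (\<lambda>n. weak_partial k (E n))"
  proof (rule H1.cauchy_sub_bound[OF Ek Ulim])
    fix m n
    have UU: "(\<lambda>x. U m x - U n x) \<in> test_functions"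
      using test_lin[OF U(1)[of m] U(1)[of n], of 1 "-1"] by simp
    have d: "(\<lambda>x. E m x - E n x) \<in> H1" by (intro H1_diff E)
    have ds: "H1_inner (\<lambda>x. E m x - E n x) w = H0_inner (\<lambda>x. U m x - U n x) w" if "w \<in> H1" for w
      using that by (simp add: H1.ip_diff L2.ip_diff E UL H1_L2 Esol)
    have "H1_norm (\<lambda>x. weak_partial k (E m) x - weak_partial k (E n) x)
        = H1_norm (weak_partial k (\<lambda>x. E m x - E n x))"
      by (rule H1_norm_cong_AE[symmetric, OF regularity_test(1)[OF UU d ds] weak_partial_diff[OF E E]])
        (use L2.diff_closed[OF weak_partial_L2[OF E] weak_partial_L2[OF E]] in \<open>auto simp: L2_def\<close>)
    also have "\<dots> \<le> H0_norm (\<lambda>x. U m x - U n x)"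
      by (rule regularity_test(2)[OF UU d ds])
    also have "\<dots> \<le> H0_norm (\<lambda>x. U m x - u x) + H0_norm (\<lambda>x. U n x - u x)"
      using L2.nrm_triangle[OF UL u UL, of m n] L2.nrm_minus[OF u UL, of n] by (simp add: L2_nrm_eq)
    finally show "H1.nrm (\<lambda>x. weak_partial k (E m) x - weak_partial k (E n) x)
        \<le> H0_norm (\<lambda>x. U m x - u x) + H0_norm (\<lambda>x. U n x - u x)"
      by (simp add: H1_nrm_eq)
  qed
  then obtain G where G: "H1.tends (\<lambda>n. weak_partial k (E n)) G"
    using H1.complete by blast
  have "AE x in lborel. G x = weak_partial k F x"
    by (rule L2_tends_unique[OF H1_tends_L2(1)[OF G] H1_tends_L2(2)[OF EF]])
  then show ?thesis
    using G weak_partial_L2[OF F, of k] H1_cong_AE(1)[of G "weak_partial k F"]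
    unfolding H1.tends_def L2_def by simp
qed

lemma L2_inner_sum:
  "finite I \<Longrightarrow> (\<And>i. i \<in> I \<Longrightarrow> f i \<in> L2 M) \<Longrightarrow> g \<in> L2 M \<Longrightarrow>
    L2_inner M (\<lambda>x. \<Sum>i\<in>I. f i x) g = (\<Sum>i\<in>I. L2_inner M (f i) g)"
proof (induction I rule: finite_induct)
  case empty
  then show ?case by (simp add: L2_inner_def)
next
  case (insert i I)
  then show ?case by (simp add: L2.ip_add L2_sum)
qed

section \<open>The space \<open>H2\<close> and the weak Laplacian\<close>

lemma H2_H1: "f \<in> H2 \<Longrightarrow> f \<in> H1"
  by (simp add: H2_def)

lemma H2_weak_partial: "f \<in> H2 \<Longrightarrow> weak_partial i f \<in> H1"
  by (simp add: H2_def)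

lemma laplacian_L2: "f \<in> H2 \<Longrightarrow> laplacian f \<in> L2 lborel"
  unfolding laplacian_def[abs_def] by (intro L2_sum weak_partial_L2 H2_weak_partial) auto

lemma H2_grad_inner:
  assumes f: "f \<in> H2" and g: "g \<in> H1"
  shows "grad_inner f g = - H0_inner (laplacian f) g"
proof -
  have "H0_inner (weak_partial i f) (weak_partial i g)
      = - H0_inner (weak_partial i (weak_partial i f)) g" for i
    using H1_by_parts[OF H2_weak_partial[OF f] g] by simp
  then show ?thesis
    unfolding grad_inner_def laplacian_def
    using f g by (subst L2_inner_sum) (auto simp: sum_negf weak_partial_L2 H2_weak_partial H1_L2)
qed

lemma L2_zero_if_orthogonal_H1:
  assumes "u \<in> L2 lborel" "\<And>w. w \<in> H1 \<Longrightarrow> H0_inner u w = 0"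
  shows "AE x in lborel. u x = 0"
  using assms(2)[OF test_H1[OF test_cnj]]
  by (intro zero_AE_if_orthogonal_to_test assms) (simp add: L2_inner_cnj_test)

text \<open>Adding F to both sides turns the equation into F - Laplacian F = F + g, to which
  \<open>regularity\<close> applies. This is the way membership in \<open>H2\<close> is established
  everywhere below.\<close>

lemma weak_laplacian_H2:
  assumes F: "F \<in> H1" and g: "g \<in> L2 lborel"
    and eq: "\<And>w. w \<in> H1 \<Longrightarrow> grad_inner F w = H0_inner g w"
  shows "F \<in> H2" "AE x in lborel. laplacian F x = - g x"
proof -
  have "H1_inner F w = H0_inner (\<lambda>x. F x + g x) w" if "w \<in> H1" for w
    using that eq by (simp add: H1_inner_def L2.ip_add H1_L2 F g)
  then have "weak_partial k F \<in> H1" for k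
    by (intro regularity[of "\<lambda>x. F x + g x"] L2.add_closed H1_L2 F g)
  then show F2: "F \<in> H2" using F by (simp add: H2_def)
  have "AE x in lborel. laplacian F x + g x = 0"
  proof (rule L2_zero_if_orthogonal_H1)
    show "(\<lambda>x. laplacian F x + g x) \<in> L2 lborel"
      by (intro L2.add_closed laplacian_L2 F2 g)
    show "H0_inner (\<lambda>x. laplacian F x + g x) w = 0" if "w \<in> H1" for w
    proof -
      have "H0_inner (laplacian F) w = - H0_inner g w"
        using eq[OF that] H2_grad_inner[OF F2 that] by (metis minus_minus)
      then show ?thesis using that by (simp add: L2.ip_add laplacian_L2 F2 g H1_L2)
    qed
  qed
  then show "AE x in lborel. laplacian F x = - g x"
    by eventually_elim (simp add: eq_neg_iff_add_eq_0)
qed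

text \<open>The weak equation is linear and insensitive to the choices behind
  \<open>weak_partial\<close>, so it is simpler to work with than the iterated choices in
  \<open>laplacian\<close>.\<close>

lemma H2_lin:
  assumes f: "f \<in> H2" and g: "g \<in> H2"
  shows "(\<lambda>x. a * f x + b * g x) \<in> H2"
    "AE x in lborel. laplacian (\<lambda>x. a * f x + b * g x) x = a * laplacian f x + b * laplacian g x"
proof -
  let ?g = "\<lambda>x. (- a) * laplacian f x + (- b) * laplacian g x"
  have L: "?g \<in> L2 lborel" by (intro L2_lin laplacian_L2 f g)
  have eq: "grad_inner (\<lambda>x. a * f x + b * g x) w = H0_inner ?g w" if w: "w \<in> H1" for w
    unfolding grad.ip_lin[OF H2_H1[OF f] H2_H1[OF g] w]
      L2.ip_lin[OF laplacian_L2[OF f] laplacian_L2[OF g] H1_L2[OF w]]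
    by (simp add: H2_grad_inner f g w)
  note H = H1_lin[OF H2_H1[OF f] H2_H1[OF g], of a b]
  show "(\<lambda>x. a * f x + b * g x) \<in> H2"
    by (rule weak_laplacian_H2(1)[OF H L]) (rule eq)
  have "AE x in lborel. laplacian (\<lambda>x. a * f x + b * g x) x = - ?g x"
    by (rule weak_laplacian_H2(2)[OF H L]) (rule eq)
  then show "AE x in lborel. laplacian (\<lambda>x. a * f x + b * g x) x = a * laplacian f x + b * laplacian g x"
    by eventually_elim simp
qed

section \<open>The embedding of \<open>H\<^sup>1\<close> into \<open>L\<^sup>2\<close> of the total variation\<close>

lemma sets_total_variation: "sets (total_variation mp mn) = sets borel"
  unfolding total_variation_def using sets.sigma_sets_eq[of "borel :: (real ^ 'a) measure"]
  by (subst sets_measure_of) auto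

lemma emeasure_total_variation:
  fixes mp mn :: "(real ^ 'd::finite) measure"
  assumes "sets mp = sets borel" "sets mn = sets borel" "A \<in> sets borel"
  shows "emeasure (total_variation mp mn) A = emeasure mp A + emeasure mn A"
  unfolding total_variation_def
proof (rule emeasure_measure_of_sigma)
  show "sigma_algebra UNIV (sets (borel :: (real ^ 'd) measure))"
    using sets.sigma_algebra_axioms[of "borel :: (real ^ 'd) measure"] by simp
  show "positive (sets borel) (\<lambda>A. emeasure mp A + emeasure mn A)"
    by (simp add: positive_def)
  show "countably_additive (sets borel) (\<lambda>A. emeasure mp A + emeasure mn A)"
  proof (rule countably_additiveI)
    fix A :: "nat \<Rightarrow> (real ^ 'd) set"
    assume A: "range A \<subseteq> sets borel" "disjoint_family A"
    show "(\<Sum>i. emeasure mp (A i) + emeasure mn (A i)) = emeasure mp (\<Union> (range A)) + emeasure mn (\<Union> (range A))"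
      using A suminf_emeasure[of A mp] suminf_emeasure[of A mn] assms by (simp add: suminf_add[symmetric])
  qed
qed (use assms in auto)

lemma radon_measure_total_variation:
  assumes "real_radon_measure mp mn B"
  shows "radon_measure (total_variation mp mn)"
proof -
  have "emeasure (total_variation mp mn) K < \<infinity>" if "compact K" for K
    using assms that by (subst emeasure_total_variation)
      (auto simp: real_radon_measure_def radon_measure_def ennreal_add_less_top compact_imp_closed)
  then show ?thesis by (simp add: radon_measure_def sets_total_variation)
qed

lemma L2_norm_cmod_sq_sum:
  assumes "finite I" "\<And>i. i \<in> I \<Longrightarrow> f i \<in> L2 M"
  shows "(LINT x|M. (\<Sum>i\<in>I. (cmod (f i x))\<^sup>2)) = (\<Sum>i\<in>I. (L2_norm M (f i))\<^sup>2)"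
  using assms by (simp add: L2_norm_sq L2_integrable)

lemma form_bound_test:
  assumes "form_bound M \<eta> \<beta>" "\<phi> \<in> test_functions"
  shows "(L2_norm M \<phi>)\<^sup>2 \<le> \<eta> * (Re (grad_inner \<phi> \<phi>) + \<beta> * (H0_norm \<phi>)\<^sup>2)"
proof -
  have pL: "partial i \<phi> \<in> L2 lborel" for i
    by (intro test_L2_lborel test_partial assms)
  have "H0_norm (weak_partial i \<phi>) = H0_norm (partial i \<phi>)" for i
    by (intro L2_norm_cong_L2 weak_partial_L2 test_H1 pL weak_partial_test assms)
  then have "(LINT x|lborel. (\<Sum>i\<in>UNIV. (cmod (partial i \<phi> x))\<^sup>2)) = Re (grad_inner \<phi> \<phi>)"
    using pL by (simp add: L2_norm_cmod_sq_sum grad_inner_self)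
  then show ?thesis
    using bspec[OF assms(1)[unfolded form_bound_def] assms(2)] by (simp add: L2_norm_sq)
qed

lemma form_bound_test_H1_norm:
  assumes "form_bound M \<eta> \<beta>" "\<eta> > 0" "\<phi> \<in> test_functions"
  shows "L2_norm M \<phi> \<le> sqrt (\<eta> * (1 + \<bar>\<beta>\<bar>)) * H1_norm \<phi>"
proof -
  have g: "0 \<le> Re (grad_inner \<phi> \<phi>)" by (simp add: grad_inner_self sum_nonneg)
  have "(H1_norm \<phi>)\<^sup>2 = (H0_norm \<phi>)\<^sup>2 + Re (grad_inner \<phi> \<phi>)"
    unfolding H1_norm_def grad_inner_self by (simp add: sum_nonneg)
  then have eq: "(1 + \<bar>\<beta>\<bar>) * (H1_norm \<phi>)\<^sup>2 = Re (grad_inner \<phi> \<phi>) + \<bar>\<beta>\<bar> * (H0_norm \<phi>)\<^sup>2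
      + (\<bar>\<beta>\<bar> * Re (grad_inner \<phi> \<phi>) + (H0_norm \<phi>)\<^sup>2)"
    by (simp add: algebra_simps)
  have "\<beta> * (H0_norm \<phi>)\<^sup>2 \<le> \<bar>\<beta>\<bar> * (H0_norm \<phi>)\<^sup>2"
    by (intro mult_right_mono) auto
  moreover have "0 \<le> \<bar>\<beta>\<bar> * Re (grad_inner \<phi> \<phi>) + (H0_norm \<phi>)\<^sup>2"
    using g by simp
  ultimately have "Re (grad_inner \<phi> \<phi>) + \<beta> * (H0_norm \<phi>)\<^sup>2 \<le> (1 + \<bar>\<beta>\<bar>) * (H1_norm \<phi>)\<^sup>2"
    using eq by linarith
  then have "(L2_norm M \<phi>)\<^sup>2 \<le> \<eta> * ((1 + \<bar>\<beta>\<bar>) * (H1_norm \<phi>)\<^sup>2)"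
    using form_bound_test[OF assms(1,3)] mult_left_mono[of _ _ \<eta>] assms(2) by (meson less_imp_le order_trans)
  then have "L2_norm M \<phi> \<le> sqrt (\<eta> * ((1 + \<bar>\<beta>\<bar>) * (H1_norm \<phi>)\<^sup>2))"
    by (rule real_le_rsqrt)
  then show ?thesis
    by (simp add: real_sqrt_mult mult.assoc)
qed

text \<open>Extension by density. The relation \<open>A\<close> says that g is a limit in
  \<open>L2 M\<close> of test functions converging to f in \<open>H1\<close>; it is total on
  \<open>H1\<close> and determines g almost everywhere. Any selection from it is then linear almost
  everywhere.\<close>

lemma form_embedding_exists:
  fixes M :: "(real ^ 'd::finite) measure"
  assumes M: "radon_measure M" and fb: "form_bound M \<eta> \<beta>" and \<eta>: "\<eta> > 0"
  shows "\<exists>J. is_form_embedding M J"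
proof -
  define K where "K = sqrt (\<eta> * (1 + \<bar>\<beta>\<bar>))"
  have K: "L2_norm M \<phi> \<le> K * H1_norm \<phi>" if "\<phi> \<in> test_functions" for \<phi>
    unfolding K_def by (rule form_bound_test_H1_norm[OF fb \<eta> that])
  have K0: "K \<ge> 0" using \<eta> by (simp add: K_def)
  note tL = test_L2[OF _ M] and tH = test_H1
  have tdiff: "(\<lambda>x. f x - g x) \<in> test_functions" if "f \<in> test_functions" "g \<in> test_functions"
    for f g :: "real ^ 'd \<Rightarrow> complex"
    using test_lin[OF that, of 1 "-1"] by simp
  define A where "A f g \<longleftrightarrow> (\<exists>F. (\<forall>n. F n \<in> test_functions) \<and> H1.tends F f \<and> L2.tends M F g)" for f g
  \<comment> \<open>Two approximating sequences of the same f are compared through f. Taking them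
    equal gives the Cauchy property, taking them different gives independence of the
    sequence.\<close>
  have bd: "L2_norm M (\<lambda>x. F m x - G n x) \<le> K * H1_norm (\<lambda>x. F m x - f x) + K * H1_norm (\<lambda>x. G n x - f x)"
    if "\<And>n. F n \<in> test_functions" "\<And>n. G n \<in> test_functions" "f \<in> H1" for F G f and m n :: nat
  proof -
    have "L2_norm M (\<lambda>x. F m x - G n x) \<le> K * H1_norm (\<lambda>x. F m x - G n x)"
      by (intro K tdiff that)
    also have "H1_norm (\<lambda>x. F m x - G n x) \<le> H1_norm (\<lambda>x. F m x - f x) + H1_norm (\<lambda>x. G n x - f x)"
      using H1.nrm_triangle[OF tH that(3) tH, of "F m" "G n"] H1.nrm_minus[OF that(3) tH, of "G n"] that
      by (simp add: H1_nrm_eq)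
    finally show ?thesis using K0 by (simp add: mult_left_mono distrib_left)
  qed
  have ex: "\<exists>g. A f g" if f: "f \<in> H1" for f
  proof -
    obtain F where F: "\<And>n. F n \<in> test_functions" "H1.tends F f"
      using test_dense_H1[OF f] by blast
    have lim: "(\<lambda>n. K * H1_norm (\<lambda>x. F n x - f x)) \<longlonglongrightarrow> 0"
      using F(2) by (auto simp: H1.tends_def H1_nrm_eq intro: tendsto_mult_right_zero)
    have "L2.cauchy M F"
      by (rule L2.cauchy_sub_bound[OF tL[OF F(1)] lim]) (simp add: L2_nrm_eq bd F f)
    then obtain g where "L2.tends M F g" using L2.complete by blast
    with F show ?thesis unfolding A_def by blast
  qed
  have uniq: "AE x in M. g x = g' x" if g: "A f g" and g': "A f g'" for f g g'
  proof -
    obtain F where F: "\<And>n. F n \<in> test_functions" "H1.tends F f" "L2.tends M F g" using g by (auto simp: A_def)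
    obtain G where G: "\<And>n. G n \<in> test_functions" "H1.tends G f" "L2.tends M G g'" using g' by (auto simp: A_def)
    have f: "f \<in> H1" using F by (simp add: H1.tends_def)
    have lim: "(\<lambda>n. K * H1_norm (\<lambda>x. F n x - f x) + K * H1_norm (\<lambda>x. G n x - f x)) \<longlonglongrightarrow> 0"
      using F(2) G(2) by (auto simp: H1.tends_def H1_nrm_eq intro!: tendsto_add_zero tendsto_mult_right_zero)
    have "(\<lambda>n. L2_norm M (\<lambda>x. F n x - G n x)) \<longlonglongrightarrow> 0"
      by (rule tendsto_0_squeeze[OF _ _ lim]) (auto intro: bd[OF F(1) G(1) f])
    then have "L2.tends M F g'"
      using L2.tends_close[OF G(3) tL[OF F(1)]] by (simp add: L2_nrm_eq)
    with F(3) show ?thesis by (rule L2_tends_unique)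
  qed
  define J where "J f = (SOME g. A f g)" for f
  have J: "A f (J f)" if "f \<in> H1" for f
    unfolding J_def using ex[OF that] by (rule someI_ex)
  have "is_form_embedding M J"
    unfolding is_form_embedding_def
  proof (intro conjI ballI allI exI)
    fix f :: "real ^ 'd \<Rightarrow> complex" assume f: "f \<in> H1"
    from J[OF f] obtain F where F: "\<And>n. F n \<in> test_functions" "H1.tends F f" "L2.tends M F (J f)"
      by (auto simp: A_def)
    show "J f \<in> L2 M" using F by (simp add: L2.tends_def)
    show "L2_norm M (J f) \<le> K * H1_norm f"
      using L2.tends_nrm[OF F(3)] tendsto_mult_left[OF H1.tends_nrm[OF F(2)], of K] K[OF F(1)]
      unfolding L2_nrm_eq H1_nrm_eq by (intro LIMSEQ_le) auto
    fix g :: "real ^ 'd \<Rightarrow> complex" and a b assume g: "g \<in> H1"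
    from J[OF g] obtain G where G: "\<And>n. G n \<in> test_functions" "H1.tends G g" "L2.tends M G (J g)"
      by (auto simp: A_def)
    show "AE x in M. J (\<lambda>y. a * f y + b * g y) x = a * J f x + b * J g x"
    proof (rule uniq)
      show "A (\<lambda>y. a * f y + b * g y) (J (\<lambda>y. a * f y + b * g y))" by (intro J H1_lin f g)
      show "A (\<lambda>y. a * f y + b * g y) (\<lambda>x. a * J f x + b * J g x)"
        unfolding A_def
        by (intro exI[of _ "\<lambda>n x. a * F n x + b * G n x"] conjI allI test_lin F G
            H1.tends_lin L2.tends_lin)
    qed
  next
    fix f :: "real ^ 'd \<Rightarrow> complex" assume f: "f \<in> test_functions"
    show "AE x in M. J f x = f x"
    proof (rule uniq)
      show "A f (J f)" by (intro J tH f)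
      show "A f f" unfolding A_def
        by (intro exI[of _ "\<lambda>n. f"] conjI allI f H1.tends_const L2.tends_const tH tL)
    qed
  qed
  then show ?thesis by (rule exI[of "is_form_embedding M" J])
qed

text \<open>Test functions converging to f in \<open>H1\<close> are mapped to themselves, so they
  converge to J f in \<open>L2 M\<close> and the inequality passes to the limit. The constants are
  independent of those used to construct J, so the bound for each \<epsilon> applies to the same
  embedding.\<close>

lemma form_embedding_bound:
  fixes M :: "(real ^ 'd::finite) measure"
  assumes M: "radon_measure M" and J: "is_form_embedding M J" and fb: "form_bound M \<eta> \<beta>" and f: "f \<in> H1"
  shows "(L2_norm M (J f))\<^sup>2 \<le> \<eta> * (Re (grad_inner f f) + \<beta> * (H0_norm f)\<^sup>2)"
proof -
  obtain F where F: "\<And>n. F n \<in> test_functions" "H1.tends F f"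
    using test_dense_H1[OF f] by blast
  obtain C where C: "\<And>f. f \<in> H1 \<Longrightarrow> L2_norm M (J f) \<le> C * H1_norm f"
    using J unfolding is_form_embedding_def by blast
  have JL: "J f \<in> L2 M" if "f \<in> H1" for f using J that by (simp add: is_form_embedding_def)
  note FH = test_H1[OF F(1)] and FL = test_L2[OF F(1) M]
  have "L2_norm M (\<lambda>x. F n x - J f x) \<le> C * H1_norm (\<lambda>x. F n x - f x)" for n
  proof -
    have "AE x in M. J (\<lambda>x. 1 * F n x + (-1) * f x) x = 1 * J (F n) x + (-1) * J f x"
      using J FH f unfolding is_form_embedding_def by blast
    moreover have "AE x in M. J (F n) x = F n x"
      using J F unfolding is_form_embedding_def by blast
    ultimately have "AE x in M. F n x - J f x = J (\<lambda>x. F n x - f x) x"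
      by eventually_elim simp
    then have "L2_norm M (\<lambda>x. F n x - J f x) = L2_norm M (J (\<lambda>x. F n x - f x))"
      by (intro L2_norm_cong_L2 L2.diff_closed JL H1_diff FH FL f)
    also have "\<dots> \<le> C * H1_norm (\<lambda>x. F n x - f x)"
      by (intro C H1_diff FH f)
    finally show ?thesis .
  qed
  moreover have "(\<lambda>n. C * H1_norm (\<lambda>x. F n x - f x)) \<longlonglongrightarrow> 0"
    using F(2) by (auto simp: H1.tends_def H1_nrm_eq intro: tendsto_mult_right_zero)
  ultimately have "(\<lambda>n. L2_norm M (\<lambda>x. F n x - J f x)) \<longlonglongrightarrow> 0"
    by (rule tendsto_0_squeeze[OF L2_norm_nonneg])
  then have "L2.tends M F (J f)"
    by (simp add: L2.tends_def L2_nrm_eq FL JL f)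
  from L2.tends_nrm[OF this] have 1: "(\<lambda>n. L2_norm M (F n)) \<longlonglongrightarrow> L2_norm M (J f)"
    by (simp add: L2_nrm_eq)
  have 2: "(\<lambda>n. H0_norm (F n)) \<longlonglongrightarrow> H0_norm f"
    using L2.tends_nrm[OF H1_tends_L2(1)[OF F(2)]] by (simp add: L2_nrm_eq)
  have 3: "(\<lambda>n. Re (grad_inner (F n) (F n))) \<longlonglongrightarrow> Re (grad_inner f f)"
    unfolding grad_inner_self
    using L2.tends_nrm[OF H1_tends_L2(2)[OF F(2)]] by (intro tendsto_sum tendsto_power) (simp add: L2_nrm_eq)
  show ?thesis
    by (rule LIMSEQ_le[OF tendsto_power[OF 1] tendsto_mult_left[OF tendsto_add[OF 3 tendsto_mult_left[OF tendsto_power[OF 2]]]]])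
      (use form_bound_test[OF fb F(1)] in auto)
qed

section \<open>The forms and their resolvents\<close>

text \<open>Completeness depends only on the norm up to equivalence. This is how closedness of the
  forms is inherited from \<open>H1\<close> and \<open>H2\<close>.\<close>

lemma semi_hilbert_equivalent:
  assumes "semi_hilbert V p" "semi_inner V q" and c: "c > 0"
    and low: "\<And>f. f \<in> V \<Longrightarrow> c * Re (p f f) \<le> Re (q f f)"
    and up: "\<And>f. f \<in> V \<Longrightarrow> Re (q f f) \<le> C * Re (p f f)"
  shows "semi_hilbert V q"
proof -
  interpret p: semi_hilbert V p by fact
  interpret q: semi_inner V q by fact
  have 1: "sqrt c * p.nrm f \<le> q.nrm f" if "f \<in> V" for f
    using low[OF that] by (simp add: p.nrm_def q.nrm_def flip: real_sqrt_mult)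
  have 2: "q.nrm f \<le> sqrt C * p.nrm f" if "f \<in> V" for f
    using up[OF that] by (simp add: p.nrm_def q.nrm_def flip: real_sqrt_mult)
  show ?thesis
  proof
    fix F assume F: "q.cauchy F"
    then have FV: "F n \<in> V" for n by (simp add: q.cauchy_def)
    have "p.cauchy F"
      unfolding p.cauchy_def
    proof (intro conjI allI impI FV)
      fix e :: real assume "e > 0"
      then have "sqrt c * e > 0" using c by simp
      then obtain N where N: "\<And>m n. m \<ge> N \<Longrightarrow> n \<ge> N \<Longrightarrow> q.nrm (\<lambda>x. F m x - F n x) < sqrt c * e"
        using F unfolding q.cauchy_def by blast
      have "p.nrm (\<lambda>x. F m x - F n x) < e" if "m \<ge> N" "n \<ge> N" for m n
      proof -
        have "sqrt c * p.nrm (\<lambda>x. F m x - F n x) < sqrt c * e"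
          using 1[OF p.diff_closed[OF FV FV]] N[OF that] by (rule le_less_trans)
        then show ?thesis using c by simp
      qed
      then show "\<exists>N. \<forall>m\<ge>N. \<forall>n\<ge>N. p.nrm (\<lambda>x. F m x - F n x) < e" by blast
    qed
    then obtain f where f: "p.tends F f" using p.complete by blast
    then have fV: "f \<in> V" and lim: "(\<lambda>n. p.nrm (\<lambda>x. F n x - f x)) \<longlonglongrightarrow> 0" by (auto simp: p.tends_def)
    have "(\<lambda>n. q.nrm (\<lambda>x. F n x - f x)) \<longlonglongrightarrow> 0"
      by (rule tendsto_0_squeeze[OF q.nrm_nonneg[OF q.diff_closed[OF FV fV]] 2[OF q.diff_closed[OF FV fV]]])
        (rule tendsto_mult_right_zero[OF lim])
    then show "\<exists>f. q.tends F f" using FV fV by (auto simp: q.tends_def)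
  qed
qed

text \<open>Of the second derivatives only the Laplacian enters, matching the forms for \<epsilon> >
  0; completeness for this product comes from \<open>weak_laplacian_H2\<close>.\<close>

definition H2_inner :: "(real ^ 'd::finite \<Rightarrow> complex) \<Rightarrow> (real ^ 'd \<Rightarrow> complex) \<Rightarrow> complex" where
  "H2_inner f g = H0_inner (laplacian f) (laplacian g) + H1_inner f g"

lemma laplacian_semi_inner: "semi_inner (H2 :: (real ^ 'd::finite \<Rightarrow> complex) set) (\<lambda>f g. H0_inner (laplacian f) (laplacian g))"
proof
  fix f g h :: "real ^ 'd \<Rightarrow> complex" and a b
  show "f \<in> H2 \<Longrightarrow> g \<in> H2 \<Longrightarrow> (\<lambda>x. a * f x + b * g x) \<in> H2"
    by (rule H2_lin)
  show "H0_inner (laplacian (\<lambda>x. a * f x + b * g x)) (laplacian h) =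
      a * H0_inner (laplacian f) (laplacian h) + b * H0_inner (laplacian g) (laplacian h)"
    if "f \<in> H2" "g \<in> H2" "h \<in> H2"
  proof -
    have "H0_inner (laplacian (\<lambda>x. a * f x + b * g x)) (laplacian h) =
        H0_inner (\<lambda>x. a * laplacian f x + b * laplacian g x) (laplacian h)"
      using that by (intro L2_inner_cong_L2 laplacian_L2 H2_lin L2_lin) auto
    then show ?thesis using that by (simp add: L2.ip_lin laplacian_L2)
  qed
  show "H0_inner (laplacian g) (laplacian f) = cnj (H0_inner (laplacian f) (laplacian g))"
    if "f \<in> H2" "g \<in> H2"
    using that by (intro L2.ip_cnj laplacian_L2)
  show "0 \<le> Re (H0_inner (laplacian f) (laplacian f))"
    by (simp add: L2_inner_self)
qed

lemma H1_semi_inner_H2: "semi_inner H2 H1_inner"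
  using H1.semi_inner_axioms by (rule semi_inner_subset) (auto simp: H2_H1 H2_lin)

interpretation H2: semi_inner "H2 :: (real ^ 'd::finite \<Rightarrow> complex) set" H2_inner
  using semi_inner_add[OF laplacian_semi_inner H1_semi_inner_H2, of 1 1]
  by (simp add: H2_inner_def[abs_def])

lemma H1_inner_self_norm: "Re (H1_inner f f) = (H1_norm f)\<^sup>2"
  by (simp add: H1_inner_self H1_norm_def sum_nonneg)

lemma H2_inner_self: "Re (H2_inner f f) = (H0_norm (laplacian f))\<^sup>2 + (H1_norm f)\<^sup>2"
  by (simp add: H2_inner_def H1_inner_self_norm L2_inner_self)

lemma H1_norm_le_H2: "H1_norm f \<le> H2.nrm f" "H0_norm (laplacian f) \<le> H2.nrm f"
  unfolding H2.nrm_def H2_inner_self by (auto intro: real_le_rsqrt)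

lemma laplacian_diff:
  assumes "f \<in> H2" "g \<in> H2"
  shows "H0_norm (laplacian (\<lambda>x. f x - g x)) = H0_norm (\<lambda>x. laplacian f x - laplacian g x)"
  using H2_lin(2)[OF assms, of 1 "-1"] assms
  by (intro L2_norm_cong_L2 laplacian_L2 H2.diff_closed L2.diff_closed) auto

interpretation H2: semi_hilbert "H2 :: (real ^ 'd::finite \<Rightarrow> complex) set" H2_inner
proof
  fix F :: "nat \<Rightarrow> real ^ 'd \<Rightarrow> complex" assume F: "H2.cauchy F"
  then have F2: "F n \<in> H2" for n by (simp add: H2.cauchy_def)
  have *: "\<exists>N. \<forall>m\<ge>N. \<forall>n\<ge>N. H2.nrm (\<lambda>x. F m x - F n x) < e" if "e > 0" for e
    using F that by (simp add: H2.cauchy_def)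
  have "H1.cauchy F"
    unfolding H1.cauchy_def H1_nrm_eq using H2_H1[OF F2] * by (meson H1_norm_le_H2(1) le_less_trans)
  then obtain f where f: "H1.tends F f" using H1.complete by blast
  have "L2.cauchy lborel (\<lambda>n. laplacian (F n))"
    unfolding L2.cauchy_def L2_nrm_eq laplacian_diff[OF F2 F2, symmetric]
    using laplacian_L2[OF F2] * by (meson H1_norm_le_H2(2) le_less_trans)
  then obtain g where g: "L2.tends lborel (\<lambda>n. laplacian (F n)) g" using L2.complete by blast
  have fH: "f \<in> H1" and gL: "g \<in> L2 lborel" using f g by (auto simp: H1.tends_def L2.tends_def)
  \<comment> \<open>The function - g, written as a linear combination to fit \<open>L2_lin\<close>
    and \<open>L2.ip_lin\<close>.\<close>
  have ng: "(\<lambda>x. (-1) * g x + 0 * g x) \<in> L2 lborel" by (intro L2_lin gL)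
  have eq: "grad_inner f w = H0_inner (\<lambda>x. (-1) * g x + 0 * g x) w" if w: "w \<in> H1" for w
  proof -
    have "(\<lambda>n. grad_inner (F n) w) \<longlonglongrightarrow> grad_inner f w"
      unfolding grad_inner_def by (intro tendsto_sum L2.tends_ip H1_tends_L2 f weak_partial_L2 w)
    moreover have "(\<lambda>n. - H0_inner (laplacian (F n)) w) \<longlonglongrightarrow> - H0_inner g w"
      by (intro tendsto_minus L2.tends_ip g H1_L2 w)
    ultimately have "grad_inner f w = - H0_inner g w"
      using LIMSEQ_unique by (simp add: H2_grad_inner F2 w)
    also have "\<dots> = H0_inner (\<lambda>x. (-1) * g x + 0 * g x) w"
      using L2.ip_lin[OF gL gL H1_L2[OF w], of "-1" 0] by simp
    finally show ?thesis .
  qed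
  have f2: "f \<in> H2" by (rule weak_laplacian_H2(1)[OF fH ng eq])
  have "AE x in lborel. laplacian f x = g x"
    using weak_laplacian_H2(2)[OF fH ng eq] by simp
  then have "H0_norm (laplacian (\<lambda>x. F n x - f x)) = H0_norm (\<lambda>x. laplacian (F n) x - g x)" for n
    unfolding laplacian_diff[OF F2 f2]
    by (intro L2_norm_cong_L2 L2.diff_closed laplacian_L2 F2 f2 gL) auto
  then have nrm: "H2.nrm (\<lambda>x. F n x - f x) = sqrt ((H0_norm (\<lambda>x. laplacian (F n) x - g x))\<^sup>2
      + (H1_norm (\<lambda>x. F n x - f x))\<^sup>2)" for n
    by (simp add: H2.nrm_def H2_inner_self)
  have "(\<lambda>n. sqrt ((H0_norm (\<lambda>x. laplacian (F n) x - g x))\<^sup>2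
      + (H1_norm (\<lambda>x. F n x - f x))\<^sup>2)) \<longlonglongrightarrow> sqrt (0\<^sup>2 + 0\<^sup>2)"
    using f g by (intro tendsto_real_sqrt tendsto_add tendsto_power)
      (auto simp: H1.tends_def L2.tends_def H1_nrm_eq L2_nrm_eq)
  then show "\<exists>f. H2.tends F f"
    using F2 f2 by (auto simp: H2.tends_def nrm)
qed

text \<open>The shifted form itself serves as the inner product, so solving the resolvent equation
  is the Riesz theorem in this space. Coercivity with respect to the \<open>L2\<close> norm makes
  the right-hand side a bounded functional.\<close>

locale coercive_form = semi_hilbert V "\<lambda>f g. a f g + of_real \<alpha> * H0_inner f g"
  for V :: "(real ^ 'd::finite \<Rightarrow> complex) set" and a and \<alpha> +
  fixes c :: real
  assumes V_L2: "V \<subseteq> L2 lborel" and V_nonempty: "V \<noteq> {}" and c_pos: "c > 0"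
    and coercive: "f \<in> V \<Longrightarrow> c * (H0_norm f)\<^sup>2 \<le> Re (a f f + of_real \<alpha> * H0_inner f f)"
begin

lemma L2_norm_le_nrm: "f \<in> V \<Longrightarrow> H0_norm f \<le> (1 / sqrt c) * nrm f"
  using coercive[of f] c_pos real_sqrt_le_mono[of "c * (H0_norm f)\<^sup>2"]
  by (fastforce simp: nrm_def real_sqrt_mult field_simps)

lemma solve:
  assumes u: "u \<in> L2 lborel"
  shows "\<exists>f\<in>V. \<forall>w\<in>V. a f w + of_real \<alpha> * H0_inner f w = H0_inner u w"
proof (rule Riesz[OF V_nonempty])
  show "H0_inner u (\<lambda>x. b * f x + b' * g x) = cnj b * H0_inner u f + cnj b' * H0_inner u g"
    if "f \<in> V" "g \<in> V" for f g b b'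
    using that V_L2 u by (intro L2.ip_lin2) auto
  fix w assume w: "w \<in> V"
  have "cmod (H0_inner u w) \<le> H0_norm u * H0_norm w"
    using w V_L2 u by (intro L2_inner_Cauchy_Schwarz) auto
  also have "\<dots> \<le> H0_norm u * ((1 / sqrt c) * nrm w)"
    by (intro mult_left_mono L2_norm_le_nrm w) auto
  finally show "cmod (H0_inner u w) \<le> (H0_norm u * (1 / sqrt c)) * nrm w"
    by (simp only: mult.assoc)
qed

text \<open>The second component is determined up to null sets as u - \<alpha> f, so the resolvent
  equation for the graph reduces to a weak equation for f alone.\<close>

lemma form_operator_iff:
  assumes u: "u \<in> L2 lborel"
  shows "(\<exists>h. (f, h) \<in> form_operator V a \<and> (AE x in lborel. h x + of_real \<alpha> * f x = u x))
    \<longleftrightarrow> f \<in> V \<and> (\<forall>w\<in>V. a f w + of_real \<alpha> * H0_inner f w = H0_inner u w)"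
    (is "?L \<longleftrightarrow> ?R")
proof
  assume ?L
  then obtain h where fV: "f \<in> V" and h: "h \<in> L2 lborel" and eq: "\<And>g. g \<in> V \<Longrightarrow> a f g = H0_inner h g"
    and ae: "AE x in lborel. h x + of_real \<alpha> * f x = u x"
    by (auto simp: form_operator_def)
  have "H0_inner u w = a f w + of_real \<alpha> * H0_inner f w" if w: "w \<in> V" for w
  proof -
    have L: "f \<in> L2 lborel" "w \<in> L2 lborel" using fV w V_L2 by auto
    have "H0_inner u w = H0_inner (\<lambda>x. 1 * h x + of_real \<alpha> * f x) w"
      using ae by (intro L2_inner_cong_L2 L2_lin u h L) auto
    then show ?thesis using L2.ip_lin[OF h L, of 1 "of_real \<alpha>"] eq[OF w] by simp
  qed
  with fV show ?R by simp
next
  assume R: ?R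
  define h where "h = (\<lambda>x. 1 * u x + (- of_real \<alpha>) * f x)"
  have fL: "f \<in> L2 lborel" using R V_L2 by auto
  have "a f g = H0_inner h g" if "g \<in> V" for g
    unfolding h_def L2.ip_lin[OF u fL subsetD[OF V_L2 that]]
    using R that by (simp add: algebra_simps)
  moreover have "h \<in> L2 lborel" unfolding h_def by (intro L2_lin u fL)
  ultimately have "(f, h) \<in> form_operator V a" using R by (simp add: form_operator_def)
  moreover have "AE x in lborel. h x + of_real \<alpha> * f x = u x" by (simp add: h_def)
  ultimately show ?L by blast
qed

lemma boundedly_invertible: "boundedly_invertible_shift (form_operator V a) \<alpha>"
  unfolding boundedly_invertible_shift_def
proof (intro conjI ballI exI)
  fix u :: "real ^ 'd \<Rightarrow> complex" assume u: "u \<in> L2 lborel"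
  show "\<exists>(f, h)\<in>form_operator V a. AE x in lborel. h x + of_real \<alpha> * f x = u x"
    using solve[OF u] form_operator_iff[OF u] by fast
next
  fix p assume p: "p \<in> form_operator V a"
  show "case p of (f, h) \<Rightarrow> H0_norm f \<le> (1 / c) * H0_norm (\<lambda>x. h x + of_real \<alpha> * f x)"
  proof (cases p)
    case (Pair f h)
    have fh: "f \<in> V" "h \<in> L2 lborel" using p Pair by (auto simp: form_operator_def)
    define u where "u = (\<lambda>x. h x + of_real \<alpha> * f x)"
    have u: "u \<in> L2 lborel"
      using L2_lin[OF fh(2) subsetD[OF V_L2 fh(1)], of 1 "of_real \<alpha>"] by (simp add: u_def)
    have "a f f + of_real \<alpha> * H0_inner f f = H0_inner u f"
      using form_operator_iff[OF u, of f] p Pair fh by (auto simp: u_def)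
    then have "c * (H0_norm f)\<^sup>2 \<le> Re (H0_inner u f)"
      using coercive[OF fh(1)] by simp
    also have "\<dots> \<le> H0_norm u * H0_norm f"
      using complex_Re_le_cmod[of "H0_inner u f"] L2_inner_Cauchy_Schwarz[OF u subsetD[OF V_L2 fh(1)]]
      by linarith
    finally have "(H0_norm f)\<^sup>2 \<le> (1 / c * H0_norm u) * H0_norm f"
      using c_pos by (simp add: field_simps)
    then have "H0_norm f \<le> 1 / c * H0_norm u"
      by (rule le_if_sq_le_mult) (use c_pos in auto)
    then show ?thesis using Pair by (simp add: u_def)
  qed
qed

lemma shift_inverse_solves:
  fixes u
  defines "R \<equiv> shift_inverse (form_operator V a) \<alpha> u"
  assumes u: "u \<in> L2 lborel"
  shows "R \<in> V" "w \<in> V \<Longrightarrow> a R w + of_real \<alpha> * H0_inner R w = H0_inner u w"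
proof -
  have "\<exists>f. \<exists>h. (f, h) \<in> form_operator V a \<and> (AE x in lborel. h x + of_real \<alpha> * f x = u x)"
    unfolding form_operator_iff[OF u] using solve[OF u] by blast
  then have "\<exists>h. (R, h) \<in> form_operator V a \<and> (AE x in lborel. h x + of_real \<alpha> * R x = u x)"
    unfolding R_def shift_inverse_def by (rule someI_ex)
  then have "R \<in> V \<and> (\<forall>w\<in>V. a R w + of_real \<alpha> * H0_inner R w = H0_inner u w)"
    unfolding form_operator_iff[OF u] .
  then show "R \<in> V" "w \<in> V \<Longrightarrow> a R w + of_real \<alpha> * H0_inner R w = H0_inner u w"
    by auto
qed

end

lemma H1_norm_sq: "(H1_norm f)\<^sup>2 = (H0_norm f)\<^sup>2 + Re (grad_inner f f)"
  unfolding H1_inner_self_norm[symmetric] by (simp add: H1_inner_def L2_inner_self)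

lemma Re_grad_inner_nonneg: "0 \<le> Re (grad_inner f f)"
  by (simp add: grad_inner_self sum_nonneg)

lemma sign_op_L2:
  assumes "h \<in> L2 M" "B \<in> sets M"
  shows "sign_op B h \<in> L2 M" "L2_norm M (sign_op B h) = L2_norm M h"
proof -
  have n: "cmod (sign_op B h x) = cmod (h x)" for x by (simp add: sign_op_def)
  have "sign_op B h \<in> borel_measurable M"
    unfolding sign_op_def[abs_def] using assms by (auto simp: L2_def intro!: measurable_If_set)
  then show "sign_op B h \<in> L2 M" using assms by (simp add: L2_def n)
  show "L2_norm M (sign_op B h) = L2_norm M h" by (simp add: L2_norm_def n)
qed

text \<open>The factor 1/2 lets the gradient term absorb the potential and still leaves half of it
  for coercivity.\<close>

locale form_bounded_potential =
  fixes mp mn :: "(real ^ 'd::finite) measure" and B :: "(real ^ 'd) set" and \<beta> :: real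
  assumes real_radon: "real_radon_measure mp mn B"
    and half_bound: "form_bound (total_variation mp mn) (1 / 2) \<beta>"
begin

abbreviation "M \<equiv> total_variation mp mn"
abbreviation "J \<equiv> form_embedding M"

definition potential :: "(real ^ 'd \<Rightarrow> complex) \<Rightarrow> (real ^ 'd \<Rightarrow> complex) \<Rightarrow> complex" where
  "potential f g = L2_inner M (sign_op B (J f)) (J g)"

text \<open>It has two roles: it bounds |m| relative to the squared \<open>H1\<close> norm, and
  \<alpha> > K ensures \<alpha> - \<beta> / 2 \<ge> 1 / 2, whence coercivity.\<close>

definition K :: real where "K = (1 + \<bar>\<beta>\<bar>) / 2"

lemma K_pos: "K > 0"
  by (simp add: K_def)

lemma B_sets: "B \<in> sets M"
  using real_radon by (simp add: real_radon_measure_def sets_total_variation)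

lemma radon: "radon_measure M"
  by (rule radon_measure_total_variation[OF real_radon])

lemma embedding: "is_form_embedding M J"
  unfolding form_embedding_def
  by (rule someI_ex[OF form_embedding_exists[OF radon half_bound]]) simp

lemma J_L2: "f \<in> H1 \<Longrightarrow> J f \<in> L2 M"
  using embedding by (simp add: is_form_embedding_def)

lemma J_lin: "f \<in> H1 \<Longrightarrow> g \<in> H1 \<Longrightarrow> AE x in M. J (\<lambda>y. a * f y + b * g y) x = a * J f x + b * J g x"
  using embedding unfolding is_form_embedding_def by blast

lemmas J_form_bound = form_embedding_bound[OF radon embedding]

lemma J_bound: "f \<in> H1 \<Longrightarrow> (L2_norm M (J f))\<^sup>2 \<le> K * (H1_norm f)\<^sup>2"
proof -
  assume f: "f \<in> H1"
  have "(L2_norm M (J f))\<^sup>2 \<le> (1 / 2) * (Re (grad_inner f f) + \<beta> * (H0_norm f)\<^sup>2)"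
    by (rule J_form_bound[OF half_bound f])
  also have "\<beta> * (H0_norm f)\<^sup>2 \<le> \<bar>\<beta>\<bar> * (H0_norm f)\<^sup>2"
    by (intro mult_right_mono) auto
  also have "(1 / 2) * (Re (grad_inner f f) + \<bar>\<beta>\<bar> * (H0_norm f)\<^sup>2) \<le> K * (H1_norm f)\<^sup>2"
  proof -
    have "0 \<le> (H0_norm f)\<^sup>2 + \<bar>\<beta>\<bar> * Re (grad_inner f f)"
      using Re_grad_inner_nonneg[of f] by simp
    then show ?thesis unfolding K_def H1_norm_sq by (simp add: algebra_simps add_divide_distrib)
  qed
  finally show ?thesis by simp
qed

lemma J_norm_le: "f \<in> H1 \<Longrightarrow> L2_norm M (J f) \<le> sqrt K * H1_norm f"
  using real_le_rsqrt[OF J_bound] by (simp add: real_sqrt_mult)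

lemma potential_bound:
  assumes "f \<in> H1" "g \<in> H1"
  shows "cmod (potential f g) \<le> L2_norm M (J f) * L2_norm M (J g)"
  unfolding potential_def
  using L2_inner_Cauchy_Schwarz[OF sign_op_L2(1)[OF J_L2[OF assms(1)] B_sets] J_L2[OF assms(2)]]
  by (simp add: sign_op_L2 J_L2 assms B_sets)

lemma potential_lin:
  assumes "f \<in> H1" "g \<in> H1" "h \<in> H1"
  shows "potential (\<lambda>x. a * f x + b * g x) h = a * potential f h + b * potential g h"
proof -
  have L: "sign_op B (J f) \<in> L2 M" "sign_op B (J g) \<in> L2 M" "sign_op B (J (\<lambda>x. a * f x + b * g x)) \<in> L2 M"
    by (intro sign_op_L2 J_L2 H1_lin assms B_sets)+
  have "AE x in M. sign_op B (J (\<lambda>x. a * f x + b * g x)) x = a * sign_op B (J f) x + b * sign_op B (J g) x"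
    using J_lin[OF assms(1,2), of a b] by eventually_elim (simp add: sign_op_def)
  then have "potential (\<lambda>x. a * f x + b * g x) h
      = L2_inner M (\<lambda>x. a * sign_op B (J f) x + b * sign_op B (J g) x) (J h)"
    unfolding potential_def by (intro L2_inner_cong_L2 L2_lin L J_L2 assms) auto
  then show ?thesis by (simp add: potential_def L2.ip_lin L J_L2 assms)
qed

lemma potential_cnj: "potential g f = cnj (potential f g)"
  unfolding potential_def L2_inner_def sign_op_def
  by (subst Bochner_Integration.integral_cnj[symmetric]) (auto intro!: Bochner_Integration.integral_cong)

abbreviation "form \<equiv> schroedinger_form mp mn B"

text \<open>For \<epsilon> = 0 the function \<open>laplacian f\<close> may be meaningless, but its
  term carries the factor 0, so one formula covers both cases.\<close>

lemma schroedinger_form_eq: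
  "form \<epsilon> f g =
    of_real (\<epsilon>\<^sup>2) * H0_inner (laplacian f) (laplacian g) + grad_inner f g + potential f g"
  by (simp add: schroedinger_form_def grad_inner_def potential_def Let_def)

lemma domain_H1: "f \<in> schroedinger_domain \<epsilon> \<Longrightarrow> f \<in> H1"
  by (auto simp: schroedinger_domain_def H2_H1 split: if_splits)

text \<open>The potential takes at most half of the gradient term and \<beta> / 2 times the squared
  \<open>L2\<close> norm; the shift by \<alpha> compensates the latter and leaves 1/2 of the squared
  \<open>H1\<close> norm, uniformly in \<epsilon>.\<close>

lemma lower_bound:
  assumes "K < \<alpha>" "f \<in> H1"
  shows "\<epsilon>\<^sup>2 * (H0_norm (laplacian f))\<^sup>2 + (1 / 2) * (H1_norm f)\<^sup>2
    \<le> Re (form \<epsilon> f f + of_real \<alpha> * H0_inner f f)"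
proof -
  have "- Re (potential f f) \<le> cmod (potential f f)"
    using abs_Re_le_cmod[of "potential f f"] by linarith
  also have "\<dots> \<le> (L2_norm M (J f))\<^sup>2"
    using potential_bound[OF assms(2,2)] by (simp add: power2_eq_square)
  also have "\<dots> \<le> (1 / 2) * (Re (grad_inner f f) + \<beta> * (H0_norm f)\<^sup>2)"
    by (rule J_form_bound[OF half_bound assms(2)])
  finally have 1: "- Re (potential f f) \<le> \<dots>" .
  have "1 / 2 + \<beta> / 2 \<le> \<alpha>" using assms(1) by (simp add: K_def field_simps)
  then have "(1 / 2 + \<beta> / 2) * (H0_norm f)\<^sup>2 \<le> \<alpha> * (H0_norm f)\<^sup>2"
    by (intro mult_right_mono) auto
  with 1 show ?thesis
    unfolding schroedinger_form_eq L2_inner_self H1_norm_sq by (simp add: algebra_simps)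
qed

lemma upper_bound:
  assumes "0 \<le> \<alpha>" "f \<in> H1"
  shows "Re (form \<epsilon> f f + of_real \<alpha> * H0_inner f f)
    \<le> \<epsilon>\<^sup>2 * (H0_norm (laplacian f))\<^sup>2 + (1 + K + \<alpha>) * (H1_norm f)\<^sup>2"
proof -
  have "Re (potential f f) \<le> (L2_norm M (J f))\<^sup>2"
    using potential_bound[OF assms(2,2)] complex_Re_le_cmod[of "potential f f"]
    by (simp add: power2_eq_square)
  also have "\<dots> \<le> K * (H1_norm f)\<^sup>2" by (rule J_bound[OF assms(2)])
  finally have 1: "Re (potential f f) \<le> K * (H1_norm f)\<^sup>2" .
  have "\<alpha> * (H0_norm f)\<^sup>2 \<le> \<alpha> * (H1_norm f)\<^sup>2"
    using assms(1) by (intro mult_left_mono power_mono L2_norm_le_H1_norm) auto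
  moreover have "Re (grad_inner f f) \<le> (H1_norm f)\<^sup>2" by (simp add: H1_norm_sq)
  ultimately show ?thesis using 1
    unfolding schroedinger_form_eq L2_inner_self by (simp add: algebra_simps)
qed

lemma form_semi_inner:
  assumes \<alpha>: "K < \<alpha>"
  shows "semi_inner (schroedinger_domain \<epsilon>)
    (\<lambda>f g. form \<epsilon> f g + of_real \<alpha> * H0_inner f g)"
proof
  fix f g h :: "real ^ 'd \<Rightarrow> complex" and a b
  let ?D = "schroedinger_domain \<epsilon> :: (real ^ 'd \<Rightarrow> complex) set"
  show "f \<in> ?D \<Longrightarrow> g \<in> ?D \<Longrightarrow> (\<lambda>x. a * f x + b * g x) \<in> ?D"
    by (auto simp: schroedinger_domain_def H1_lin H2_lin split: if_splits)
  show "form \<epsilon> (\<lambda>x. a * f x + b * g x) h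
        + of_real \<alpha> * H0_inner (\<lambda>x. a * f x + b * g x) h =
      a * (form \<epsilon> f h + of_real \<alpha> * H0_inner f h)
      + b * (form \<epsilon> g h + of_real \<alpha> * H0_inner g h)"
    if D: "f \<in> ?D" "g \<in> ?D" "h \<in> ?D"
  proof -
    note H = D[THEN domain_H1]
    have "of_real (\<epsilon>\<^sup>2) * H0_inner (laplacian (\<lambda>x. a * f x + b * g x)) (laplacian h) =
        of_real (\<epsilon>\<^sup>2) * (a * H0_inner (laplacian f) (laplacian h)
          + b * H0_inner (laplacian g) (laplacian h))"
    proof (cases "\<epsilon> = 0")
      case False
      then have "f \<in> H2" "g \<in> H2" "h \<in> H2" using D by (auto simp: schroedinger_domain_def)
      then show ?thesis by (simp add: semi_inner.ip_lin[OF laplacian_semi_inner])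
    qed simp
    then show ?thesis
      unfolding schroedinger_form_eq
      by (simp add: H potential_lin grad.ip_lin L2.ip_lin H1_L2 algebra_simps)
  qed
  show "form \<epsilon> g f + of_real \<alpha> * H0_inner g f =
      cnj (form \<epsilon> f g + of_real \<alpha> * H0_inner f g)"
    if D: "f \<in> ?D" "g \<in> ?D"
  proof -
    note H = D[THEN domain_H1]
    have "of_real (\<epsilon>\<^sup>2) * H0_inner (laplacian g) (laplacian f) =
        of_real (\<epsilon>\<^sup>2) * cnj (H0_inner (laplacian f) (laplacian g))"
    proof (cases "\<epsilon> = 0")
      case False
      then have "f \<in> H2" "g \<in> H2" using D by (auto simp: schroedinger_domain_def)
      then show ?thesis by (simp add: semi_inner.ip_cnj[OF laplacian_semi_inner, of f g])
    qed simp
    then show ?thesis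
      unfolding schroedinger_form_eq
      using H by (simp add: potential_cnj[of g f] grad.ip_cnj[of f g] L2.ip_cnj[of f lborel g] H1_L2)
  qed
  show "0 \<le> Re (form \<epsilon> f f + of_real \<alpha> * H0_inner f f)"
    if D: "f \<in> ?D"
    using lower_bound[OF \<alpha> domain_H1[OF D], of \<epsilon>]
    by (rule order_trans[rotated]) simp
qed

lemma form_coercive:
  assumes \<alpha>: "K < \<alpha>"
  shows "coercive_form (schroedinger_domain \<epsilon>) (form \<epsilon>) \<alpha> (1 / 2)"
proof -
  let ?q = "\<lambda>f g. form \<epsilon> f g + of_real \<alpha> * H0_inner f g"
  let ?D = "schroedinger_domain \<epsilon> :: (real ^ 'd \<Rightarrow> complex) set"
  have \<alpha>0: "0 \<le> \<alpha>" using \<alpha> K_pos by simp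
  have sh: "semi_hilbert ?D ?q"
  proof (cases "\<epsilon> = 0")
    case True
    show ?thesis
    proof (rule semi_hilbert_equivalent[of _ H1_inner _ "1 / 2" "1 + K + \<alpha>"])
      show "semi_hilbert ?D H1_inner" using True H1.semi_hilbert_axioms by (simp add: schroedinger_domain_def)
      show "semi_inner ?D ?q" by (rule form_semi_inner[OF \<alpha>])
      show "1 / 2 * Re (H1_inner f f) \<le> Re (?q f f)" if "f \<in> ?D" for f
        using lower_bound[OF \<alpha> domain_H1[OF that], of \<epsilon>] True by (simp add: H1_inner_self_norm)
      show "Re (?q f f) \<le> (1 + K + \<alpha>) * Re (H1_inner f f)" if "f \<in> ?D" for f
        using upper_bound[OF \<alpha>0 domain_H1[OF that], of \<epsilon>] True by (simp add: H1_inner_self_norm)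
    qed simp
  next
    case False
    show ?thesis
    proof (rule semi_hilbert_equivalent[of _ H2_inner _ "min (\<epsilon>\<^sup>2) (1 / 2)" "max (\<epsilon>\<^sup>2) (1 + K + \<alpha>)"])
      show "semi_hilbert ?D H2_inner" using False H2.semi_hilbert_axioms by (simp add: schroedinger_domain_def)
      show "semi_inner ?D ?q" by (rule form_semi_inner[OF \<alpha>])
      show "min (\<epsilon>\<^sup>2) (1 / 2) > 0" using False by simp
      show "min (\<epsilon>\<^sup>2) (1 / 2) * Re (H2_inner f f) \<le> Re (?q f f)" if "f \<in> ?D" for f
      proof -
        have "min (\<epsilon>\<^sup>2) (1 / 2) * Re (H2_inner f f) \<le> \<epsilon>\<^sup>2 * (H0_norm (laplacian f))\<^sup>2 + (1 / 2) * (H1_norm f)\<^sup>2"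
          unfolding H2_inner_self distrib_left by (intro add_mono mult_right_mono) auto
        then show ?thesis using lower_bound[OF \<alpha> domain_H1[OF that], of \<epsilon>] by linarith
      qed
      show "Re (?q f f) \<le> max (\<epsilon>\<^sup>2) (1 + K + \<alpha>) * Re (H2_inner f f)" if "f \<in> ?D" for f
      proof -
        have "\<epsilon>\<^sup>2 * (H0_norm (laplacian f))\<^sup>2 + (1 + K + \<alpha>) * (H1_norm f)\<^sup>2
            \<le> max (\<epsilon>\<^sup>2) (1 + K + \<alpha>) * Re (H2_inner f f)"
          unfolding H2_inner_self distrib_left by (intro add_mono mult_right_mono) auto
        then show ?thesis using upper_bound[OF \<alpha>0 domain_H1[OF that], of \<epsilon>] by linarith
      qed
    qed
  qed
  interpret semi_hilbert ?D ?q by (rule sh)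
  show ?thesis
  proof
    show "?D \<subseteq> L2 lborel" using domain_H1 H1_L2 by blast
    have "(\<lambda>x. 0) \<in> ?D"
    proof (cases "\<epsilon> = 0")
      case False
      \<comment> \<open>The chosen derivatives of the zero function are only almost everywhere zero,
        so its membership in \<open>H2\<close> is derived from the weak equation.\<close>
      have g0: "grad_inner (\<lambda>x. 0 :: complex) w = H0_inner (\<lambda>x. 0) w" if "w \<in> H1" for w :: "real ^ 'd \<Rightarrow> complex"
        using grad.ip_lin[OF that that that, of 0 0] by (simp add: L2_inner_def)
      have "(\<lambda>x. 0) \<in> (H2 :: (real ^ 'd \<Rightarrow> complex) set)"
        by (rule weak_laplacian_H2(1)[OF test_H1[OF test_zero] L2_zero]) (rule g0)
      with False show ?thesis by (simp add: schroedinger_domain_def)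
    qed (simp add: schroedinger_domain_def test_H1 test_zero)
    then show "?D \<noteq> {}" by blast
    show "1 / 2 * (H0_norm f)\<^sup>2 \<le> Re (?q f f)" if "f \<in> ?D" for f
    proof -
      have "1 / 2 * (H0_norm f)\<^sup>2 \<le> 1 / 2 * (H1_norm f)\<^sup>2"
        by (intro mult_left_mono power_mono L2_norm_le_H1_norm) auto
      moreover have "0 \<le> \<epsilon>\<^sup>2 * (H0_norm (laplacian f))\<^sup>2" by simp
      ultimately show ?thesis using lower_bound[OF \<alpha> domain_H1[OF that], of \<epsilon>] by linarith
    qed
  qed simp
qed

end

text \<open>The smoothing \<open>f' = (1 - \<epsilon>\<^sup>2\<Delta>)\<^sup>-\<^sup>1 f\<close>, for which \<open>\<epsilon>\<^sup>2\<Delta>\<^sup>2f' - \<Delta>f' = - \<Delta>f\<close>.\<close>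

lemma smoothing:
  fixes f :: "real ^ 'd::finite \<Rightarrow> complex"
  assumes f: "f \<in> H1" and \<epsilon>: "\<epsilon> > 0"
  obtains f' where "f' \<in> H2" "AE x in lborel. of_real (\<epsilon>\<^sup>2) * laplacian f' x = f' x - f x"
proof -
  let ?p = "\<lambda>f g :: real ^ 'd \<Rightarrow> complex. complex_of_real 1 * H0_inner f g + of_real (\<epsilon>\<^sup>2) * grad_inner f g"
  have self: "Re (?p f f) = (H0_norm f)\<^sup>2 + \<epsilon>\<^sup>2 * Re (grad_inner f f)" for f
    by (simp add: L2_inner_self)
  have "semi_hilbert H1 ?p"
  proof (rule semi_hilbert_equivalent[OF H1.semi_hilbert_axioms, of _ "min 1 (\<epsilon>\<^sup>2)" "max 1 (\<epsilon>\<^sup>2)"])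
    show "semi_inner H1 ?p"
      by (intro semi_inner_add L2_semi_inner_H1 grad_inner_semi_inner) auto
    fix f :: "real ^ 'd \<Rightarrow> complex"
    have "min 1 (\<epsilon>\<^sup>2) * Re (H1_inner f f) \<le> 1 * (H0_norm f)\<^sup>2 + \<epsilon>\<^sup>2 * Re (grad_inner f f)"
      unfolding H1_inner_self_norm H1_norm_sq distrib_left
      by (intro add_mono mult_right_mono Re_grad_inner_nonneg) auto
    then show "min 1 (\<epsilon>\<^sup>2) * Re (H1_inner f f) \<le> Re (?p f f)" unfolding self by simp
    have "1 * (H0_norm f)\<^sup>2 + \<epsilon>\<^sup>2 * Re (grad_inner f f) \<le> max 1 (\<epsilon>\<^sup>2) * Re (H1_inner f f)"
      unfolding H1_inner_self_norm H1_norm_sq distrib_left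
      by (intro add_mono mult_right_mono Re_grad_inner_nonneg) auto
    then show "Re (?p f f) \<le> max 1 (\<epsilon>\<^sup>2) * Re (H1_inner f f)" unfolding self by simp
  qed (use \<epsilon> in simp)
  then interpret p: semi_hilbert H1 ?p .
  have "cmod (H0_inner f w) \<le> H0_norm f * p.nrm w" if w: "w \<in> H1" for w
  proof -
    have "cmod (H0_inner f w) \<le> H0_norm f * H0_norm w"
      by (intro L2_inner_Cauchy_Schwarz H1_L2 f w)
    also have "H0_norm w \<le> p.nrm w"
      unfolding p.nrm_def self by (intro real_le_rsqrt) (simp add: Re_grad_inner_nonneg)
    finally show ?thesis by (simp add: mult_left_mono)
  qed
  then have "\<exists>f'\<in>H1. \<forall>w\<in>H1. ?p f' w = H0_inner f w"
    using f by (intro p.Riesz[of "H0_inner f"] L2.ip_lin2 H1_L2) auto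
  then obtain f' where f': "f' \<in> H1" and eq: "\<And>w. w \<in> H1 \<Longrightarrow> ?p f' w = H0_inner f w"
    by blast
  let ?c = "complex_of_real (1 / \<epsilon>\<^sup>2)"
  \<comment> \<open>This is (f - f') / \<epsilon>^2, the value that the equation of f' prescribes
    for - Laplacian f'.\<close>
  let ?g = "\<lambda>x. ?c * f x + (- ?c) * f' x"
  have g: "?g \<in> L2 lborel" by (intro L2_lin H1_L2 f f')
  have geq: "grad_inner f' w = H0_inner ?g w" if w: "w \<in> H1" for w
    unfolding L2.ip_lin[OF H1_L2[OF f] H1_L2[OF f'] H1_L2[OF w]]
    using eq[OF w] \<epsilon> by (simp add: field_simps)
  have f2: "f' \<in> H2" by (rule weak_laplacian_H2(1)[OF f' g]) (rule geq)
  have "AE x in lborel. laplacian f' x = - ?g x" by (rule weak_laplacian_H2(2)[OF f' g]) (rule geq)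
  then have "AE x in lborel. of_real (\<epsilon>\<^sup>2) * laplacian f' x = f' x - f x"
    by eventually_elim (use \<epsilon> in \<open>simp add: field_simps\<close>)
  with f2 show thesis using that by blast
qed

lemma le_if_sq_le_mult_add:
  fixes n :: real
  assumes "n\<^sup>2 \<le> a * n + b * n" "0 \<le> n" "0 \<le> a" "0 \<le> b"
  shows "n \<le> a + b"
  using assms by (intro le_if_sq_le_mult[of n "a + b"]) (auto simp: distrib_right)

section \<open>The resolvent estimate\<close>

context form_bounded_potential
begin

lemma resolvent_difference:
  assumes \<alpha>: "K < \<alpha>" and \<epsilon>: "\<epsilon> > 0" and \<eta>: "\<eta> > 0" and \<gamma>: "\<gamma> \<le> 1 / \<epsilon>\<^sup>2"
    and fb: "form_bound M \<eta> \<gamma>"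
    and u: "u \<in> L2 lborel" "H0_norm u \<le> 1"
    and f: "f \<in> H1" and feq: "\<And>w. w \<in> H1 \<Longrightarrow>
      grad_inner f w + potential f w + of_real \<alpha> * H0_inner f w = H0_inner u w"
    and g: "g \<in> H2" and geq: "\<And>w. w \<in> H2 \<Longrightarrow>
      form \<epsilon> g w + of_real \<alpha> * H0_inner g w = H0_inner u w"
  shows "H0_norm (\<lambda>x. g x - f x) \<le> 2 * (1 + 2 * \<alpha>) * (1 + 4 * K) * (\<epsilon>\<^sup>2 + \<eta>)"
proof -
  have \<alpha>0: "0 < \<alpha>" using \<alpha> K_pos by simp
  let ?G = "\<lambda>f. Re (grad_inner f f)"
  let ?n = "H0_norm"
  \<comment> \<open>The equation of f tested with f itself; the factor 2 is the inverse of the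
    coercivity constant 1/2.\<close>
  have Jn: "H1_norm f \<le> 2"
  proof -
    have "(1 / 2) * (H1_norm f)\<^sup>2 \<le> Re (H0_inner u f)"
      using lower_bound[OF \<alpha> f, of 0] feq[OF f] by (simp add: schroedinger_form_eq)
    also have "\<dots> \<le> ?n u * ?n f"
      using complex_Re_le_cmod[of "H0_inner u f"] L2_inner_Cauchy_Schwarz[OF u(1) H1_L2[OF f]] by linarith
    also have "\<dots> \<le> 1 * H1_norm f"
      by (intro mult_mono u L2_norm_le_H1_norm) auto
    finally have "(H1_norm f)\<^sup>2 \<le> 2 * H1_norm f" by simp
    then show ?thesis by (rule le_if_sq_le_mult) auto
  qed
  obtain f' where f': "f' \<in> H2" and lap: "AE x in lborel. of_real (\<epsilon>\<^sup>2) * laplacian f' x = f' x - f x"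
    using smoothing[OF f \<epsilon>] by blast
  note f'1 = H2_H1[OF f']
  define h where "h = (\<lambda>x. f x - f' x)"
  have h: "h \<in> H1" unfolding h_def by (intro H1_diff f f'1)
  have lap_h: "of_real (\<epsilon>\<^sup>2) * H0_inner (laplacian f') w = - H0_inner h w"
    if w: "w \<in> L2 lborel" for w
  proof -
    have "of_real (\<epsilon>\<^sup>2) * H0_inner (laplacian f') w
        = H0_inner (\<lambda>x. of_real (\<epsilon>\<^sup>2) * laplacian f' x + 0 * laplacian f' x) w"
      using L2.ip_lin[OF laplacian_L2[OF f'] laplacian_L2[OF f'] w, of "of_real (\<epsilon>\<^sup>2)" 0] by simp
    also have "\<dots> = H0_inner (\<lambda>x. (-1) * h x + 0 * h x) w"
      using lap by (intro L2_inner_cong_L2 L2_lin laplacian_L2 f' H1_L2 h w) (auto simp: h_def elim: AE_mp)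
    also have "\<dots> = - H0_inner h w"
      using L2.ip_lin[OF H1_L2[OF h] H1_L2[OF h] w, of "-1" 0] by simp
    finally show ?thesis .
  qed
  have grad_f': "of_real (\<epsilon>\<^sup>2) * grad_inner f' w = H0_inner h w" if w: "w \<in> H1" for w
    using lap_h[OF H1_L2[OF w]] by (simp add: H2_grad_inner[OF f' w])
  have f_split: "f = (\<lambda>x. h x + f' x)" by (simp add: h_def)
  define N where "N = sqrt (?G h + (?n h)\<^sup>2 / \<epsilon>\<^sup>2)"
  have N0: "0 \<le> ?G h + (?n h)\<^sup>2 / \<epsilon>\<^sup>2"
    by (intro add_nonneg_nonneg Re_grad_inner_nonneg) auto
  have N: "N \<ge> 0" "N\<^sup>2 = ?G h + (?n h)\<^sup>2 / \<epsilon>\<^sup>2" using N0 by (auto simp: N_def)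
  have hN: "?n h \<le> \<epsilon> * N"
  proof -
    have "(?n h)\<^sup>2 \<le> (\<epsilon> * N)\<^sup>2"
      using N(2) Re_grad_inner_nonneg[of h] \<epsilon> by (simp add: power_mult_distrib distrib_left)
    then show ?thesis by (rule power2_le_imp_le) (use N \<epsilon> in simp)
  qed
  \<comment> \<open>Replacing \<gamma> by 1 / \<epsilon>^2 turns the right-hand side of the form
    bound into \<eta> N^2.\<close>
  have JhN: "L2_norm M (J h) \<le> sqrt \<eta> * N"
  proof -
    have "(L2_norm M (J h))\<^sup>2 \<le> \<eta> * (?G h + \<gamma> * (?n h)\<^sup>2)"
      by (rule J_form_bound[OF fb h])
    also have "\<dots> \<le> \<eta> * (?G h + (1 / \<epsilon>\<^sup>2) * (?n h)\<^sup>2)"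
      using \<eta> by (intro mult_left_mono add_left_mono mult_right_mono \<gamma>) auto
    also have "\<dots> = (sqrt \<eta> * N)\<^sup>2"
      using \<eta> N(2) by (simp add: power_mult_distrib)
    finally show ?thesis by (rule power2_le_imp_le) (use N \<eta> in simp)
  qed
  have Jf: "L2_norm M (J f) \<le> 2 * sqrt K"
  proof -
    have "sqrt K * H1_norm f \<le> sqrt K * 2" using Jn K_pos by (intro mult_left_mono) auto
    then show ?thesis using J_norm_le[OF f] by simp
  qed
  have N_le: "N \<le> \<epsilon> + 2 * sqrt K * sqrt \<eta>"
  proof -
    have "Re (H0_inner f' h) = \<epsilon>\<^sup>2 * ?G f'"
    proof -
      have "Re (H0_inner h f') = \<epsilon>\<^sup>2 * ?G f'"
        unfolding grad_f'[OF f'1, symmetric] by simp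
      then show ?thesis using L2.ip_cnj[OF H1_L2[OF h] H1_L2[OF f'1]] by simp
    qed
    then have a1: "0 \<le> Re (H0_inner f' h)"
      using Re_grad_inner_nonneg[of f'] by simp
    have a2: "Re (grad_inner f' h) = (?n h)\<^sup>2 / \<epsilon>\<^sup>2"
    proof -
      have "\<epsilon>\<^sup>2 * Re (grad_inner f' h) = (?n h)\<^sup>2"
        using arg_cong[OF grad_f'[OF h], of Re] by (simp add: L2_inner_self)
      then show ?thesis using \<epsilon> by (simp add: field_simps)
    qed
    have "grad_inner f h = grad_inner h h + grad_inner f' h"
      by (subst f_split) (rule grad.ip_add[OF h f'1 h])
    moreover have "H0_inner f h = H0_inner h h + H0_inner f' h"
      by (subst f_split) (rule L2.ip_add[OF H1_L2[OF h] H1_L2[OF f'1] H1_L2[OF h]])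
    moreover have "0 \<le> \<alpha> * (Re (H0_inner h h) + Re (H0_inner f' h))"
      using \<alpha>0 a1 by (simp add: L2_inner_self)
    ultimately have "N\<^sup>2 \<le> Re (grad_inner f h + of_real \<alpha> * H0_inner f h)"
      using a2 N(2) by simp
    also have "\<dots> = Re (H0_inner u h) - Re (potential f h)"
      using arg_cong[OF feq[OF h], of Re] by simp
    also have "\<dots> \<le> ?n u * ?n h + L2_norm M (J f) * L2_norm M (J h)"
      using complex_Re_le_cmod[of "H0_inner u h"] abs_Re_le_cmod[of "potential f h"]
        L2_inner_Cauchy_Schwarz[OF u(1) H1_L2[OF h]] potential_bound[OF f h] by linarith
    also have "\<dots> \<le> 1 * (\<epsilon> * N) + (2 * sqrt K) * (sqrt \<eta> * N)"
      by (intro add_mono mult_mono u hN JhN Jf) (use K_pos in auto)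
    finally have "N\<^sup>2 \<le> \<epsilon> * N + (2 * sqrt K * sqrt \<eta>) * N" by (simp add: mult.assoc)
    then show ?thesis
      by (rule le_if_sq_le_mult_add) (use N(1) \<epsilon> \<eta> K_pos in auto)
  qed
  define e where "e = (\<lambda>x. f' x - g x)"
  have e2: "e \<in> H2" unfolding e_def by (intro H2.diff_closed f' g)
  note e = H2_H1[OF e2]
  \<comment> \<open>As e lies in \<open>H2\<close>, the fourth-order term of f' against e equals -
    (h, Laplacian e) = (grad h, grad e). Together with (grad f', grad e) it restores (grad f, grad
    e), so the equations of f and g cancel up to terms of order zero in h.\<close>
  have e_eq: "form \<epsilon> e e + of_real \<alpha> * H0_inner e e
      = - potential h e - of_real \<alpha> * H0_inner h e"
  proof -
    have "e \<in> schroedinger_domain \<epsilon>" "f' \<in> schroedinger_domain \<epsilon>" "g \<in> schroedinger_domain \<epsilon>"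
      using \<epsilon> e2 f' g by (simp_all add: schroedinger_domain_def)
    then have "form \<epsilon> e e + of_real \<alpha> * H0_inner e e
        = (form \<epsilon> f' e + of_real \<alpha> * H0_inner f' e)
          - (form \<epsilon> g e + of_real \<alpha> * H0_inner g e)"
      using semi_inner.ip_diff[OF form_semi_inner[OF \<alpha>], of f' \<epsilon> g e] unfolding e_def[symmetric] by blast
    also have "form \<epsilon> g e + of_real \<alpha> * H0_inner g e
        = grad_inner f e + potential f e + of_real \<alpha> * H0_inner f e"
      using geq[OF e2] feq[OF e] by simp
    also have "grad_inner f e = grad_inner h e + grad_inner f' e"
      by (subst f_split) (rule grad.ip_add[OF h f'1 e])
    also have "potential f e = potential h e + potential f' e"
      using potential_lin[OF h f'1 e, of 1 1] by (subst f_split) simp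
    also have "H0_inner f e = H0_inner h e + H0_inner f' e"
      by (subst f_split) (rule L2.ip_add[OF H1_L2[OF h] H1_L2[OF f'1] H1_L2[OF e]])
    also have "form \<epsilon> f' e = grad_inner h e + grad_inner f' e + potential f' e"
    proof -
      have "of_real (\<epsilon>\<^sup>2) * H0_inner (laplacian f') (laplacian e) = - H0_inner h (laplacian e)"
        by (rule lap_h[OF laplacian_L2[OF e2]])
      also have "\<dots> = grad_inner h e"
        using H2_grad_inner[OF e2 h] grad.ip_cnj[OF e h] L2.ip_cnj[OF laplacian_L2[OF e2] H1_L2[OF h]] by simp
      finally show ?thesis by (simp add: schroedinger_form_eq)
    qed
    finally show ?thesis by (simp add: algebra_simps)
  qed
  have e_le: "H1_norm e \<le> 2 * (sqrt K * L2_norm M (J h) + \<alpha> * ?n h)"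
  proof -
    have "(1 / 2) * (H1_norm e)\<^sup>2 \<le> Re (- potential h e - of_real \<alpha> * H0_inner h e)"
      using lower_bound[OF \<alpha> e, of \<epsilon>] unfolding e_eq
      by (rule order_trans[rotated]) simp
    also have "\<dots> \<le> cmod (potential h e) + \<alpha> * cmod (H0_inner h e)"
    proof -
      have "- Re (H0_inner h e) \<le> cmod (H0_inner h e)"
        using abs_Re_le_cmod[of "H0_inner h e"] by linarith
      from mult_left_mono[OF this, of \<alpha>] show ?thesis
        using abs_Re_le_cmod[of "potential h e"] \<alpha>0 by simp
    qed
    also have "\<dots> \<le> L2_norm M (J h) * (sqrt K * H1_norm e) + \<alpha> * (?n h * H1_norm e)"
    proof (intro add_mono mult_left_mono)
      have "cmod (potential h e) \<le> L2_norm M (J h) * L2_norm M (J e)"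
        by (rule potential_bound[OF h e])
      also have "\<dots> \<le> L2_norm M (J h) * (sqrt K * H1_norm e)"
        by (intro mult_left_mono J_norm_le e) simp
      finally show "cmod (potential h e) \<le> L2_norm M (J h) * (sqrt K * H1_norm e)" .
      have "cmod (H0_inner h e) \<le> ?n h * ?n e"
        by (intro L2_inner_Cauchy_Schwarz H1_L2 h e)
      also have "\<dots> \<le> ?n h * H1_norm e"
        by (intro mult_left_mono L2_norm_le_H1_norm) simp
      finally show "cmod (H0_inner h e) \<le> ?n h * H1_norm e" .
    qed (use \<alpha>0 in simp)
    finally have "(H1_norm e)\<^sup>2 \<le> (2 * (sqrt K * L2_norm M (J h) + \<alpha> * ?n h)) * H1_norm e"
      by (simp add: algebra_simps)
    then show ?thesis
      by (rule le_if_sq_le_mult) (use \<alpha>0 K_pos in auto)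
  qed
  \<comment> \<open>The bound on N and the final combination of the norms of h now both involve
    \<epsilon> + s sqrt \<eta>, whose square gives the rate.\<close>
  define s where "s = 2 * sqrt K"
  have s: "s \<ge> 0" "s\<^sup>2 = 4 * K" using K_pos by (auto simp: s_def power_mult_distrib)
  have "?n (\<lambda>x. g x - f x) = ?n (\<lambda>x. h x + e x)"
    using L2.nrm_minus[OF H1_L2[OF H2_H1[OF g]] H1_L2[OF f]] by (simp add: h_def e_def L2_nrm_eq)
  also have "\<dots> \<le> ?n h + ?n e"
    using L2.nrm_add[OF H1_L2[OF h] H1_L2[OF e]] by (simp add: L2_nrm_eq)
  also have "\<dots> \<le> ?n h + 2 * (sqrt K * L2_norm M (J h) + \<alpha> * ?n h)"
    using e_le L2_norm_le_H1_norm[of e] by linarith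
  also have "\<dots> = (1 + 2 * \<alpha>) * ?n h + s * L2_norm M (J h)"
    by (simp add: s_def algebra_simps)
  also have "\<dots> \<le> (1 + 2 * \<alpha>) * (\<epsilon> * N) + s * (sqrt \<eta> * N)"
    using \<alpha>0 s(1) by (intro add_mono mult_left_mono hN JhN) auto
  \<comment> \<open>The second term is enlarged so that a common factor 1 + 2 \<alpha> can be taken
    out.\<close>
  also have "\<dots> \<le> (1 + 2 * \<alpha>) * (\<epsilon> * N) + (1 + 2 * \<alpha>) * (s * (sqrt \<eta> * N))"
  proof -
    have "0 \<le> s * (sqrt \<eta> * N)"
      by (intro mult_nonneg_nonneg s N) (use \<eta> in simp)
    then have "1 * (s * (sqrt \<eta> * N)) \<le> (1 + 2 * \<alpha>) * (s * (sqrt \<eta> * N))"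
      using \<alpha>0 by (intro mult_right_mono) auto
    then show ?thesis by simp
  qed
  also have "\<dots> = (1 + 2 * \<alpha>) * ((\<epsilon> + s * sqrt \<eta>) * N)"
    by (simp add: algebra_simps)
  also have "\<dots> \<le> (1 + 2 * \<alpha>) * ((\<epsilon> + s * sqrt \<eta>) * (\<epsilon> + s * sqrt \<eta>))"
    using \<alpha>0 s(1) \<epsilon> \<eta> N_le by (intro mult_left_mono) (auto simp: s_def)
  also have "\<dots> \<le> (1 + 2 * \<alpha>) * (2 * (1 + 4 * K) * (\<epsilon>\<^sup>2 + \<eta>))"
  proof (rule mult_left_mono)
    have "0 \<le> (\<epsilon> - s * sqrt \<eta>)\<^sup>2" by simp
    then have "(\<epsilon> + s * sqrt \<eta>) * (\<epsilon> + s * sqrt \<eta>) \<le> 2 * \<epsilon>\<^sup>2 + 2 * (s * sqrt \<eta>)\<^sup>2"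
      by (simp add: power2_eq_square algebra_simps)
    also have "(s * sqrt \<eta>)\<^sup>2 = 4 * K * \<eta>"
      using s(2) \<eta> by (simp add: power_mult_distrib)
    also have "2 * \<epsilon>\<^sup>2 + 2 * (4 * K * \<eta>) \<le> 2 * (1 + 4 * K) * (\<epsilon>\<^sup>2 + \<eta>)"
      using K_pos \<eta> by (simp add: algebra_simps)
    finally show "(\<epsilon> + s * sqrt \<eta>) * (\<epsilon> + s * sqrt \<eta>) \<le> 2 * (1 + 4 * K) * (\<epsilon>\<^sup>2 + \<eta>)" .
  qed (use \<alpha>0 in simp)
  finally show ?thesis by (simp only: mult_ac)
qed

end

text \<open>The invertibility claims give meaning to \<open>shift_inverse\<close>, which is a
  choice: they ensure that it picks an actual resolvent value, unique up to null sets. The constant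
  c is fixed before \<epsilon> and \<eta>.\<close>

theorem mainTheorem5:
  fixes mp mn :: "(real ^ 'd::finite) measure" and B :: "(real ^ 'd) set"
  assumes "real_radon_measure mp mn B"
    and "\<forall>\<eta>>0. \<exists>\<beta>. form_bound (total_variation mp mn) \<eta> \<beta>"
  shows "\<exists>\<alpha>\<^sub>0>0. \<forall>\<alpha>>\<alpha>\<^sub>0.
    boundedly_invertible_shift (schroedinger_op mp mn B 0) \<alpha> \<and>
    (\<exists>c\<ge>0. \<exists>\<epsilon>\<^sub>0>0. \<forall>\<epsilon>. 0 < \<epsilon> \<and> \<epsilon> < \<epsilon>\<^sub>0 \<longrightarrow>
      boundedly_invertible_shift (schroedinger_op mp mn B \<epsilon>) \<alpha> \<and>
      (\<forall>\<eta>>0. form_bound (total_variation mp mn) \<eta> ((1 + sqrt (1 - 4 * \<epsilon>\<^sup>2 * \<alpha>)) / (2 * \<epsilon>\<^sup>2)) \<longrightarrow>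
        L2_opnorm lborel (\<lambda>u x. shift_inverse (schroedinger_op mp mn B \<epsilon>) \<alpha> u x
                              - shift_inverse (schroedinger_op mp mn B 0) \<alpha> u x)
          \<le> ennreal (c * (\<epsilon>\<^sup>2 + \<eta>))))"
proof -
  obtain \<beta> where "form_bound (total_variation mp mn) (1 / 2) \<beta>"
    using assms(2)[rule_format, of "1 / 2"] by auto
  with assms(1) interpret form_bounded_potential mp mn B \<beta> by unfold_locales
  have inv: "boundedly_invertible_shift (schroedinger_op mp mn B \<epsilon>) \<alpha>" if "K < \<alpha>" for \<epsilon> \<alpha>
    unfolding schroedinger_op_def by (rule coercive_form.boundedly_invertible[OF form_coercive[OF that]])
  have est: "L2_opnorm lborel (\<lambda>u x. shift_inverse (schroedinger_op mp mn B \<epsilon>) \<alpha> u x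
        - shift_inverse (schroedinger_op mp mn B 0) \<alpha> u x)
      \<le> ennreal (2 * (1 + 2 * \<alpha>) * (1 + 4 * K) * (\<epsilon>\<^sup>2 + \<eta>))"
    if \<alpha>: "K < \<alpha>" and \<epsilon>: "0 < \<epsilon>" and \<eta>: "0 < \<eta>"
      and fb: "form_bound M \<eta> ((1 + sqrt (1 - 4 * \<epsilon>\<^sup>2 * \<alpha>)) / (2 * \<epsilon>\<^sup>2))" for \<alpha> \<epsilon> \<eta>
    unfolding L2_opnorm_def
  proof (intro SUP_least ennreal_leI)
    fix u :: "real ^ 'd \<Rightarrow> complex" assume "u \<in> {u \<in> L2 lborel. H0_norm u \<le> 1}"
    then have u: "u \<in> L2 lborel" "H0_norm u \<le> 1" by auto
    \<comment> \<open>The real \<open>sqrt\<close> of a negative number is negative, so this holds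
      for large \<epsilon> as well.\<close>
    have "sqrt (1 - 4 * \<epsilon>\<^sup>2 * \<alpha>) \<le> 1"
      using \<alpha> K_pos by (simp add: zero_le_mult_iff)
    then have \<gamma>: "(1 + sqrt (1 - 4 * \<epsilon>\<^sup>2 * \<alpha>)) / (2 * \<epsilon>\<^sup>2) \<le> 1 / \<epsilon>\<^sup>2"
      using \<epsilon> by (simp add: field_simps)
    define R where "R \<delta> = shift_inverse (schroedinger_op mp mn B \<delta>) \<alpha> u" for \<delta>
    note sol = coercive_form.shift_inverse_solves[OF form_coercive[OF \<alpha>] u(1), folded schroedinger_op_def, folded R_def]
    have "H0_norm (\<lambda>x. R \<epsilon> x - R 0 x) \<le> 2 * (1 + 2 * \<alpha>) * (1 + 4 * K) * (\<epsilon>\<^sup>2 + \<eta>)"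
    proof (rule resolvent_difference[OF \<alpha> \<epsilon> \<eta> \<gamma> fb u])
      show "R 0 \<in> H1"
        using sol(1)[of 0] by (simp add: schroedinger_domain_def)
      show "R \<epsilon> \<in> H2"
        using sol(1)[of \<epsilon>] \<epsilon> by (simp add: schroedinger_domain_def)
      show "grad_inner (R 0) w
          + potential (R 0) w
          + of_real \<alpha> * H0_inner (R 0) w
          = H0_inner u w" if "w \<in> H1" for w
        using sol(2)[of w 0] that by (simp add: schroedinger_domain_def schroedinger_form_eq)
      show "form \<epsilon> (R \<epsilon>) w
          + of_real \<alpha> * H0_inner (R \<epsilon>) w
          = H0_inner u w" if "w \<in> H2" for w
        using sol(2)[of w \<epsilon>] that \<epsilon> by (simp add: schroedinger_domain_def)
    qed
    then show "H0_norm (\<lambda>x. shift_inverse (schroedinger_op mp mn B \<epsilon>) \<alpha> u x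
        - shift_inverse (schroedinger_op mp mn B 0) \<alpha> u x) \<le> 2 * (1 + 2 * \<alpha>) * (1 + 4 * K) * (\<epsilon>\<^sup>2 + \<eta>)"
      by (simp add: R_def)
  qed
  show ?thesis
  \<comment> \<open>The threshold for \<alpha> is K, where coercivity starts.\<close>
  proof (rule exI[of _ K], intro conjI allI impI)
    show "K > 0" by (rule K_pos)
    fix \<alpha> assume \<alpha>: "K < \<alpha>"
    show "boundedly_invertible_shift (schroedinger_op mp mn B 0) \<alpha>" by (rule inv[OF \<alpha>])
    have "0 \<le> 2 * (1 + 2 * \<alpha>) * (1 + 4 * K)" using \<alpha> K_pos by simp
    then show "\<exists>c\<ge>0. \<exists>\<epsilon>\<^sub>0>0. \<forall>\<epsilon>. 0 < \<epsilon> \<and> \<epsilon> < \<epsilon>\<^sub>0 \<longrightarrow>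
      boundedly_invertible_shift (schroedinger_op mp mn B \<epsilon>) \<alpha> \<and>
      (\<forall>\<eta>>0. form_bound (total_variation mp mn) \<eta> ((1 + sqrt (1 - 4 * \<epsilon>\<^sup>2 * \<alpha>)) / (2 * \<epsilon>\<^sup>2)) \<longrightarrow>
        L2_opnorm lborel (\<lambda>u x. shift_inverse (schroedinger_op mp mn B \<epsilon>) \<alpha> u x
                              - shift_inverse (schroedinger_op mp mn B 0) \<alpha> u x)
          \<le> ennreal (c * (\<epsilon>\<^sup>2 + \<eta>)))"
      \<comment> \<open>The estimate holds for every \<epsilon> > 0 with c = 2 (1 + 2 \<alpha>) (1 +
        4 K), so 1 serves as the bound on \<epsilon>.\<close>
      using inv[OF \<alpha>] est[OF \<alpha>] zero_less_one by blast
  qed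
qed

end
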